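(* Let $S$ be a countable abelian semigroup with identity and suppose that $(A, S, \alpha, L)$ is a dynamical system with extendible endomorphisms and an action of transfer operators. Let $X$ be the associated product system over $S$, let $\mathcal{T}_X$ be the Toeplitz algebra of $X$ and $i_X:X\to \mathcal{T}_X$ the universal Toeplitz representation. (1) If $(u_\lambda)$ is an approximate unit for $A$, then for every $s\in S$ the net $(i_X(s, \alpha_s(u_\lambda)))_\lambda$ converges strictly in $M(\mathcal{T}_X)$. (2) Let $i_A:A\to \mathcal{T}_X$ and $i_S:S\to M(\mathcal{T}_X)$ be given by $$i_A(a):=i_X(0,a)\quad\text{and}\quad i_S(s):=\lim_\lambda i_X(s, \alpha_s(u_\lambda))$$ for $a\in A$, $s\in S$. Then $(\mathcal{T}_X, i_A, i_S)$ is a Toeplitz crossed product for $(A, S, \alpha, L)$, and $i_A$ is injective.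
   Context: System: $A$ is a (not necessarily unital) $C^*$-algebra with multiplier algebra $M(A)$; $S$ is written additively with identity $0$. $\alpha:S\to\operatorname{End}(A)$ is an action ($\alpha_{s+t}=\alpha_s\circ\alpha_t$, $\alpha_0=\operatorname{id}$) such that each $\alpha_s$ is extendible: it extends uniquely to an endomorphism $\overline{\alpha_s}$ of $M(A)$ with $\overline{\alpha_s}(1_{M(A)})=\lim\alpha_s(u_\lambda)$ (strict limit) for some (hence every) approximate unit $(u_\lambda)$ of $A$. An action of transfer operators $L$ is an action of $S$ ($L_{s+t}=L_s\circ L_t$, $L_0=\operatorname{id}$) by continuous linear positive maps $L_s:A\to A$ admitting continuous linear extensions $\overline{L_s}:M(A)\to M(A)$ with $L_s(\alpha_s(a)u)=a\overline{L_s}(u)$ for all $a\in A$, $u\in M(A)$, $s\in S$. Product system $X$: for $s\in S$ put $A_s:=A\overline{\alpha_s}(1)$ with right action $x\cdot a:=x\alpha_s(a)$ and pre-inner product $\langle x,y\rangle_s:=L_s(x^*y)$; let $M_s$ be the right Hilbert $A$-module obtained by quotienting by $\{x:\langle x,x\rangle_s=0\}$ and completing; left multiplication $x\mapsto ax$ extends to a homomorphism $\phi_s:A\to\mathcal{L}(M_s)$. Set $X_s:=\{s\}\times M_s$ and $X:=\bigsqcup_s X_s$, with multiplication $X_s\times X_t\to X_{s+t}$ extending $(s,a\overline{\alpha_s}(1))(t,b\overline{\alpha_t}(1))=(s+t,a\alpha_s(b\overline{\alpha_t}(1)))$ by continuity; here $X_0=A$. Toeplitz algebra: a Toeplitz representation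 of $X$ in a $C^*$-algebra $B$ is a map $\psi:X\to B$ such that $\psi(u)\psi(v)=\psi(uv)$ for all $u,v\in X$ and, with $\psi_s:=\psi|_{X_s}$, each $\psi_s$ is linear, $\psi_0:A\to B$ is a homomorphism, and $\psi_s(u\cdot a)=\psi_s(u)\psi_0(a)$, $\psi_s(u)^*\psi_s(v)=\psi_0(\langle u,v\rangle_s)$, $\psi_s(a\cdot u)=\psi_0(a)\psi_s(u)$ for $s\in S$, $a\in A$, $u,v\in X_s$. By a theorem of Fowler there are a $C^*$-algebra $\mathcal{T}_X$ and a Toeplitz representation $i_X:X\to\mathcal{T}_X$, isometric and with range generating $\mathcal{T}_X$, such that for every Toeplitz representation $\psi$ of $X$ there is a homomorphism $\psi_*$ on $\mathcal{T}_X$ with $\psi_*\circ i_X=\psi$. Toeplitz crossed product: a representation of $S$ in a $C^*$-algebra $B$ is a map $V:S\to M(B)$ with $V_{s+t}=V_sV_t$ and $V_0=1$ (similarly $V:S\to B(H)$). A Toeplitz covariant representation of $(A,S,\alpha,L)$ is a pair $(\pi,V)$ of a non-degenerate representation $\pi:A\to B(H)$ and a representation $V:S\to B(H)$ with $V_s\pi(a)=\pi(\alpha_s(a))V_s$ and $V_s^*\pi(a)V_s=\pi(L_s(a))$ for all $a\in A$, $s\in S$. A Toeplitz crossed product for $(A,S,\alpha,L)$ is a triple $(B,i_A,i_S)$, where $i_A:A\to B$ is a non-degenerate homomorphism and $i_S:S\to M(B)$ is a representation, such that (i) if $\sigma$ is a non-degenerate representation of $B$, then $(\sigma\circ i_A,\overline{\sigma}\circ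 i_S)$ is a Toeplitz covariant representation ($\overline\sigma$ being the extension to $M(B)$); (ii) for every Toeplitz covariant representation $(\pi,V)$ there is a representation $\pi\times V$ of $B$ with $(\pi\times V)\circ i_A=\pi$ and $\overline{\pi\times V}\circ i_S=V$; (iii) $B$ is generated as a $C^*$-algebra by $\{i_A(a)i_S(s): a\in A,s\in S\}$. *)

theory Defs
  imports "HOL-Analysis.Analysis"
begin

section \<open>C*-algebras and complex Hilbert spaces\<close>

class cnormed_space = real_normed_vector +
  fixes scaleC :: "complex \<Rightarrow> 'a \<Rightarrow> 'a"  (infixr "*\<^sub>C" 75)
  assumes scaleC_add_right: "c *\<^sub>C (x + y) = c *\<^sub>C x + c *\<^sub>C y"
    and scaleC_add_left: "(c + d) *\<^sub>C x = c *\<^sub>C x + d *\<^sub>C x"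
    and scaleC_scaleC: "c *\<^sub>C (d *\<^sub>C x) = (c * d) *\<^sub>C x"
    and scaleR_scaleC: "r *\<^sub>R x = complex_of_real r *\<^sub>C x"
    and norm_scaleC: "norm (c *\<^sub>C x) = cmod c * norm x"

text \<open>C*-algebras are not assumed to be unital.\<close>

class cstar_algebra = cnormed_space + banach + real_normed_algebra +
  fixes star :: "'a \<Rightarrow> 'a"
  assumes mult_scaleC_left: "(c *\<^sub>C x) * y = c *\<^sub>C (x * y)"
    and mult_scaleC_right: "x * (c *\<^sub>C y) = c *\<^sub>C (x * y)"
    and star_star: "star (star x) = x"
    and star_add: "star (x + y) = star x + star y"
    and star_scaleC: "star (c *\<^sub>C x) = cnj c *\<^sub>C star x"
    and star_mult: "star (x * y) = star y * star x"
    and cstar_identity: "norm (star x * x) = (norm x)\<^sup>2"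

class chilbert_space = cnormed_space + banach +
  fixes cinner :: "'a \<Rightarrow> 'a \<Rightarrow> complex"
  assumes cinner_add_right: "cinner x (y + z) = cinner x y + cinner x z"
    and cinner_scaleC_right: "cinner x (c *\<^sub>C y) = c * cinner x y"
    and cinner_commute: "cinner x y = cnj (cinner y x)"
    and cinner_self: "cinner x x = complex_of_real ((norm x)\<^sup>2)"

definition clinear_map :: "('a::cnormed_space \<Rightarrow> 'b::cnormed_space) \<Rightarrow> bool" where
  "clinear_map f \<longleftrightarrow> (\<forall>x y. f (x + y) = f x + f y) \<and> (\<forall>c x. f (c *\<^sub>C x) = c *\<^sub>C f x)"

definition star_hom :: "('a::cstar_algebra \<Rightarrow> 'b::cstar_algebra) \<Rightarrow> bool" where
  "star_hom f \<longleftrightarrow> clinear_map f \<and> (\<forall>x y. f (x * y) = f x * f y) \<and> (\<forall>x. f (star x) = star (f x))"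

definition positive_elem :: "'a::cstar_algebra \<Rightarrow> bool" where
  "positive_elem a \<longleftrightarrow> (\<exists>x. a = star x * x)"

definition positive_map :: "('a::cstar_algebra \<Rightarrow> 'a) \<Rightarrow> bool" where
  "positive_map f \<longleftrightarrow> (\<forall>a. positive_elem a \<longrightarrow> positive_elem (f a))"

definition cstar_generated :: "'a::cstar_algebra set \<Rightarrow> 'a set" where
  "cstar_generated G = \<Inter>{C. G \<subseteq> C \<and> closed C \<and> 0 \<in> C \<and>
     (\<forall>x\<in>C. \<forall>y\<in>C. x + y \<in> C \<and> x * y \<in> C) \<and> (\<forall>x\<in>C. star x \<in> C \<and> (\<forall>c. c *\<^sub>C x \<in> C))}"

lemma scaleC_zero_left [simp]: "0 *\<^sub>C x = (0::'a::cnormed_space)"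
  using scaleR_scaleC[of 0 x] by simp

lemma scaleC_one [simp]: "1 *\<^sub>C x = (x::'a::cnormed_space)"
  using scaleR_scaleC[of 1 x] by simp

lemma scaleC_zero_right [simp]: "c *\<^sub>C 0 = (0::'a::cnormed_space)"
  using norm_scaleC[of c "0::'a"] by simp

lemma scaleC_minus_right: "c *\<^sub>C (- x) = - (c *\<^sub>C x::'a::cnormed_space)"
  using scaleC_add_right[of c x "- x"] by (simp add: eq_neg_iff_add_eq_0 add.commute)

lemma scaleC_diff_right: "c *\<^sub>C (x - y) = c *\<^sub>C x - (c *\<^sub>C y::'a::cnormed_space)"
  using scaleC_add_right[of c x "- y"] by (simp add: scaleC_minus_right)

lemma bounded_linear_scaleC_right: "bounded_linear (\<lambda>x. c *\<^sub>C x :: 'a::cnormed_space)"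
proof (rule bounded_linear_intro)
  show "c *\<^sub>C (r *\<^sub>R x) = r *\<^sub>R (c *\<^sub>C x)" for r and x :: 'a
    by (simp add: scaleR_scaleC scaleC_scaleC mult.commute)
  show "norm (c *\<^sub>C x) \<le> norm x * cmod c" for x :: 'a
    by (simp add: norm_scaleC)
qed (rule scaleC_add_right)

lemma star_zero [simp]: "star 0 = (0::'a::cstar_algebra)"
  using star_scaleC[of 0 "0::'a"] by simp

lemma star_minus: "star (- x) = - star (x::'a::cstar_algebra)"
  using star_add[of x "- x"] by (simp add: eq_neg_iff_add_eq_0 add.commute)

lemma star_diff: "star (x - y) = star x - star (y::'a::cstar_algebra)"
  using star_add[of x "- y"] by (simp add: star_minus)

lemma star_scaleR: "star (r *\<^sub>R x) = r *\<^sub>R star (x::'a::cstar_algebra)"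
  by (simp add: scaleR_scaleC star_scaleC)

lemma norm_star [simp]: "norm (star x) = norm (x::'a::cstar_algebra)"
proof -
  have *: "norm y \<le> norm (star y)" for y :: 'a
  proof (cases "y = 0")
    case False
    have "norm y * norm y \<le> norm (star y) * norm y"
      using norm_mult_ineq[of "star y" y] by (simp add: cstar_identity power2_eq_square)
    with False show ?thesis by simp
  qed simp
  from *[of x] *[of "star x"] show ?thesis by (simp add: star_star)
qed

lemma cstar_sq: "star x * x = 0 \<longleftrightarrow> x = (0::'a::cstar_algebra)"
  using cstar_identity[of x] by auto

lemma mult_all_zero: "(\<And>b. b * x = 0) \<Longrightarrow> x = (0::'a::cstar_algebra)"
  using cstar_sq by blast

lemma mult_all_eq: "(\<And>b. b * x = b * y) \<Longrightarrow> x = (y::'a::cstar_algebra)"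
  using mult_all_zero[of "x - y"] by (simp add: right_diff_distrib)

lemma bounded_linear_star: "bounded_linear (star :: 'a::cstar_algebra \<Rightarrow> 'a)"
  by (rule bounded_linear_intro[of _ 1]) (simp_all add: star_add star_scaleR)


section \<open>The multiplier algebra\<close>

text \<open>\<open>M(A)\<close> is the algebra of adjointable operators on \<open>A\<close>, regarded as a right Hilbert module
  over itself with \<open>\<langle>a, b\<rangle> = a\<^sup>* b\<close>. It has a unit even if \<open>A = 0\<close>, but then \<open>0 = 1\<close>, so it is
  an instance of \<^class>\<open>monoid_mult\<close> rather than of \<^class>\<open>ring_1\<close>.\<close>

typedef (overloaded) 'a multiplier =
  "{T :: 'a::cstar_algebra \<Rightarrow>\<^sub>L 'a. \<exists>T'::'a \<Rightarrow>\<^sub>L 'a. \<forall>a b. star (blinfun_apply T a) * b = star a * blinfun_apply T' b}"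
  morphisms blinfun_of_mult Mult
proof
  show "(0 :: 'a \<Rightarrow>\<^sub>L 'a) \<in> {T. \<exists>T'::'a \<Rightarrow>\<^sub>L 'a. \<forall>a b. star (blinfun_apply T a) * b = star a * blinfun_apply T' b}"
    by (auto intro!: exI[of _ 0] simp: blinfun.zero_left)
qed

setup_lifting type_definition_multiplier

lift_definition lmul :: "'a::cstar_algebra multiplier \<Rightarrow> 'a \<Rightarrow> 'a" is blinfun_apply .

lemma blinfun_compose_mult_star:
  fixes S T S' T' :: "'a::cstar_algebra \<Rightarrow>\<^sub>L 'a"
  assumes "\<And>a b. star (blinfun_apply S a) * b = star a * blinfun_apply S' b"
    and "\<And>a b. star (blinfun_apply T a) * b = star a * blinfun_apply T' b"
  shows "star (blinfun_apply (S o\<^sub>L T) a) * b = star a * blinfun_apply (T' o\<^sub>L S') b"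
  by (simp add: assms)

lemma adjoint_blinfun_sym:
  fixes T T' :: "'a::cstar_algebra \<Rightarrow>\<^sub>L 'a"
  assumes "\<And>a b. star (blinfun_apply T a) * b = star a * blinfun_apply T' b"
  shows "star (blinfun_apply T' a) * b = star a * blinfun_apply T b"
proof -
  have "star (star (blinfun_apply T b) * a) = star (star b * blinfun_apply T' a)"
    by (simp add: assms)
  then show ?thesis by (simp add: star_mult star_star)
qed

lemma adjoint_blinfun_unique:
  fixes T' T'' :: "'a::cstar_algebra \<Rightarrow>\<^sub>L 'a"
  assumes "\<And>a b. star (blinfun_apply T a) * b = star a * blinfun_apply T' b"
    and "\<And>a b. star (blinfun_apply T a) * b = star a * blinfun_apply T'' b"
  shows "T' = T''"
proof (rule blinfun_eqI)
  fix b
  show "blinfun_apply T' b = blinfun_apply T'' b"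
  proof (rule mult_all_eq)
    fix c
    show "c * blinfun_apply T' b = c * blinfun_apply T'' b"
      using assms(1)[of "star c" b] assms(2)[of "star c" b] by (simp add: star_star)
  qed
qed

lemma adjoint_blinfun_mult:
  fixes T T' :: "'a::cstar_algebra \<Rightarrow>\<^sub>L 'a"
  assumes "\<And>a b. star (blinfun_apply T a) * b = star a * blinfun_apply T' b"
  shows "blinfun_apply T (a * b) = blinfun_apply T a * b"
proof (rule mult_all_eq)
  fix c
  note * = adjoint_blinfun_sym[OF assms, of "star c"]
  show "c * blinfun_apply T (a * b) = c * (blinfun_apply T a * b)"
    using *[of "a * b"] *[of a] by (metis mult.assoc star_star)
qed

lemma adjoint_blinfun_scaleC:
  fixes T T' :: "'a::cstar_algebra \<Rightarrow>\<^sub>L 'a"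
  assumes "\<And>a b. star (blinfun_apply T a) * b = star a * blinfun_apply T' b"
  shows "blinfun_apply T (c *\<^sub>C a) = c *\<^sub>C blinfun_apply T a"
proof (rule mult_all_eq)
  fix d
  note * = adjoint_blinfun_sym[OF assms, of "star d"]
  show "d * blinfun_apply T (c *\<^sub>C a) = d * (c *\<^sub>C blinfun_apply T a)"
    using *[of "c *\<^sub>C a"] *[of a] by (metis mult_scaleC_right star_star)
qed

lemma lmul_eqI: "(\<And>a. lmul m a = lmul n a) \<Longrightarrow> m = n"
  by transfer (rule blinfun_eqI)

lemma lmul_mult: "lmul m (a * b) = lmul m a * b"
  by transfer (use adjoint_blinfun_mult in blast)

lemma bounded_linear_lmul: "bounded_linear (lmul m)"
  by transfer (rule blinfun.bounded_linear_right)

definition blinfun_scaleC :: "complex \<Rightarrow> ('a::real_normed_vector \<Rightarrow>\<^sub>L 'b::cnormed_space) \<Rightarrow> ('a \<Rightarrow>\<^sub>L 'b)" where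
  "blinfun_scaleC c T = Blinfun (\<lambda>x. c *\<^sub>C blinfun_apply T x)"

lemma blinfun_scaleC_apply [simp]: "blinfun_apply (blinfun_scaleC c T) x = c *\<^sub>C blinfun_apply T x"
proof -
  have "bounded_linear (\<lambda>x. c *\<^sub>C blinfun_apply T x)"
    by (rule bounded_linear_compose[OF bounded_linear_scaleC_right]) (rule blinfun.bounded_linear_right)
  then show ?thesis by (simp add: blinfun_scaleC_def bounded_linear_Blinfun_apply)
qed

lemma norm_blinfun_scaleC: "norm (blinfun_scaleC c T) = cmod c * norm T"
proof -
  have *: "norm (blinfun_scaleC c T) \<le> cmod c * norm T" for c and T :: "'a \<Rightarrow>\<^sub>L 'b"
    by (rule norm_blinfun_bound)
      (simp_all add: norm_scaleC mult.assoc mult_left_mono norm_blinfun)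
  show ?thesis
  proof (cases "c = 0")
    case True
    then show ?thesis using *[of 0 T] by simp
  next
    case False
    have "blinfun_scaleC (inverse c) (blinfun_scaleC c T) = T"
      by (rule blinfun_eqI) (simp add: scaleC_scaleC False)
    then have "norm T \<le> cmod (inverse c) * norm (blinfun_scaleC c T)"
      using *[of "inverse c" "blinfun_scaleC c T"] by simp
    then have "cmod c * norm T \<le> cmod c * (inverse (cmod c) * norm (blinfun_scaleC c T))"
      by (simp add: norm_inverse mult_left_mono)
    then have "cmod c * norm T \<le> norm (blinfun_scaleC c T)"
      using False by (simp add: mult.assoc[symmetric])
    with *[of c T] show ?thesis by simp
  qed
qed

instantiation multiplier :: (cstar_algebra) cnormed_space
begin

lift_definition norm_multiplier :: "'a multiplier \<Rightarrow> real" is norm .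
lift_definition zero_multiplier :: "'a multiplier" is 0
  by (auto intro!: exI[of _ 0] simp: blinfun.zero_left)
lift_definition plus_multiplier :: "'a multiplier \<Rightarrow> 'a multiplier \<Rightarrow> 'a multiplier" is "(+)"
proof -
  fix S T :: "'a \<Rightarrow>\<^sub>L 'a"
  assume "\<exists>S'::'a \<Rightarrow>\<^sub>L 'a. \<forall>a b. star (blinfun_apply S a) * b = star a * blinfun_apply S' b"
    and "\<exists>T'::'a \<Rightarrow>\<^sub>L 'a. \<forall>a b. star (blinfun_apply T a) * b = star a * blinfun_apply T' b"
  then obtain S' T' :: "'a \<Rightarrow>\<^sub>L 'a" where
    "\<forall>a b. star (blinfun_apply S a) * b = star a * blinfun_apply S' b"
    "\<forall>a b. star (blinfun_apply T a) * b = star a * blinfun_apply T' b" by blast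
  then show "\<exists>T'::'a \<Rightarrow>\<^sub>L 'a. \<forall>a b. star (blinfun_apply (S + T) a) * b = star a * blinfun_apply T' b"
    by (auto intro!: exI[of _ "S' + T'"] simp: blinfun.add_left star_add algebra_simps)
qed
lift_definition uminus_multiplier :: "'a multiplier \<Rightarrow> 'a multiplier" is uminus
proof -
  fix T :: "'a \<Rightarrow>\<^sub>L 'a"
  assume "\<exists>T'::'a \<Rightarrow>\<^sub>L 'a. \<forall>a b. star (blinfun_apply T a) * b = star a * blinfun_apply T' b"
  then obtain T' :: "'a \<Rightarrow>\<^sub>L 'a" where
    "\<forall>a b. star (blinfun_apply T a) * b = star a * blinfun_apply T' b" by blast
  then show "\<exists>T'::'a \<Rightarrow>\<^sub>L 'a. \<forall>a b. star (blinfun_apply (- T) a) * b = star a * blinfun_apply T' b"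
    by (auto intro!: exI[of _ "- T'"] simp: blinfun.minus_left star_minus)
qed
definition minus_multiplier :: "'a multiplier \<Rightarrow> 'a multiplier \<Rightarrow> 'a multiplier" where
  "minus_multiplier m n = m + (- n)"
lift_definition scaleC_multiplier :: "complex \<Rightarrow> 'a multiplier \<Rightarrow> 'a multiplier" is blinfun_scaleC
proof -
  fix c and T :: "'a \<Rightarrow>\<^sub>L 'a"
  assume "\<exists>T'::'a \<Rightarrow>\<^sub>L 'a. \<forall>a b. star (blinfun_apply T a) * b = star a * blinfun_apply T' b"
  then obtain T' :: "'a \<Rightarrow>\<^sub>L 'a" where
    "\<forall>a b. star (blinfun_apply T a) * b = star a * blinfun_apply T' b" by blast
  then show "\<exists>T'::'a \<Rightarrow>\<^sub>L 'a. \<forall>a b. star (blinfun_apply (blinfun_scaleC c T) a) * b = star a * blinfun_apply T' b"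
    by (auto intro!: exI[of _ "blinfun_scaleC (cnj c) T'"]
        simp: star_scaleC mult_scaleC_left mult_scaleC_right)
qed
definition scaleR_multiplier :: "real \<Rightarrow> 'a multiplier \<Rightarrow> 'a multiplier" where
  "scaleR_multiplier r m = complex_of_real r *\<^sub>C m"
definition dist_multiplier :: "'a multiplier \<Rightarrow> 'a multiplier \<Rightarrow> real" where
  "dist_multiplier m n = norm (m - n)"
definition sgn_multiplier :: "'a multiplier \<Rightarrow> 'a multiplier" where
  "sgn_multiplier m = inverse (norm m) *\<^sub>R m"
definition uniformity_multiplier :: "('a multiplier \<times> 'a multiplier) filter" where
  "uniformity_multiplier = (INF e\<in>{0<..}. principal {(m, n). dist m n < e})"
definition open_multiplier :: "'a multiplier set \<Rightarrow> bool" where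
  "open_multiplier U \<longleftrightarrow> (\<forall>m\<in>U. \<forall>\<^sub>F (m', n) in uniformity. m' = m \<longrightarrow> n \<in> U)"

lemma scaleC_multiplier_add: "c *\<^sub>C (m + n) = c *\<^sub>C m + c *\<^sub>C (n::'a multiplier)"
  by transfer (rule blinfun_eqI, simp add: blinfun.add_left scaleC_add_right)

lemma scaleC_multiplier_add_left: "(c + d) *\<^sub>C m = c *\<^sub>C m + d *\<^sub>C (m::'a multiplier)"
  by transfer (rule blinfun_eqI, simp add: blinfun.add_left scaleC_add_left)

lemma scaleC_scaleC_multiplier: "c *\<^sub>C d *\<^sub>C m = (c * d) *\<^sub>C (m::'a multiplier)"
  by transfer (rule blinfun_eqI, simp add: scaleC_scaleC)

lemma scaleC_one_multiplier: "1 *\<^sub>C m = (m::'a multiplier)"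
  by transfer (rule blinfun_eqI, simp)

lemma norm_scaleC_multiplier: "norm (c *\<^sub>C m) = cmod c * norm (m::'a multiplier)"
  by transfer (rule norm_blinfun_scaleC)

instance
proof
  fix k m n :: "'a multiplier" and r q :: real and c d :: complex
  show "k + m + n = k + (m + n)" by transfer (simp add: add.assoc)
  show "m + n = n + m" by transfer (simp add: add.commute)
  show "0 + m = m" by transfer simp
  show "- m + m = 0" by transfer simp
  show "m - n = m + - n" by (rule minus_multiplier_def)
  show "r *\<^sub>R (m + n) = r *\<^sub>R m + r *\<^sub>R n" by (simp add: scaleR_multiplier_def scaleC_multiplier_add)
  show "(r + q) *\<^sub>R m = r *\<^sub>R m + q *\<^sub>R m"
    by (simp add: scaleR_multiplier_def scaleC_multiplier_add_left)
  show "r *\<^sub>R q *\<^sub>R m = (r * q) *\<^sub>R m"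
    by (simp add: scaleR_multiplier_def scaleC_scaleC_multiplier)
  show "1 *\<^sub>R m = m" by (simp add: scaleR_multiplier_def scaleC_one_multiplier)
  show "dist m n = norm (m - n)" by (rule dist_multiplier_def)
  show "sgn m = inverse (norm m) *\<^sub>R m" by (rule sgn_multiplier_def)
  show "uniformity = (INF e\<in>{0<..}. principal {(m, n::'a multiplier). dist m n < e})"
    by (rule uniformity_multiplier_def)
  show "open U = (\<forall>m\<in>U. \<forall>\<^sub>F (m', n) in uniformity. m' = m \<longrightarrow> n \<in> U)" for U :: "'a multiplier set"
    by (rule open_multiplier_def)
  show "norm m = 0 \<longleftrightarrow> m = 0" by transfer simp
  show "norm (m + n) \<le> norm m + norm n" by transfer (rule norm_triangle_ineq)
  show "norm (r *\<^sub>R m) = \<bar>r\<bar> * norm m" by (simp add: scaleR_multiplier_def norm_scaleC_multiplier)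
  show "c *\<^sub>C (m + n) = c *\<^sub>C m + c *\<^sub>C n" by (rule scaleC_multiplier_add)
  show "(c + d) *\<^sub>C m = c *\<^sub>C m + d *\<^sub>C m" by (rule scaleC_multiplier_add_left)
  show "c *\<^sub>C d *\<^sub>C m = (c * d) *\<^sub>C m" by (rule scaleC_scaleC_multiplier)
  show "r *\<^sub>R m = complex_of_real r *\<^sub>C m" by (rule scaleR_multiplier_def)
  show "norm (c *\<^sub>C m) = cmod c * norm m" by (rule norm_scaleC_multiplier)
qed

end

lift_definition adj_multiplier :: "'a::cstar_algebra multiplier \<Rightarrow> 'a multiplier" is
  "\<lambda>T. SOME T'::'a \<Rightarrow>\<^sub>L 'a. \<forall>a b. star (blinfun_apply T a) * b = star a * blinfun_apply T' b"
proof -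
  fix T :: "'a \<Rightarrow>\<^sub>L 'a"
  assume ex: "\<exists>T'::'a \<Rightarrow>\<^sub>L 'a. \<forall>a b. star (blinfun_apply T a) * b = star a * blinfun_apply T' b"
  from adjoint_blinfun_sym[OF someI_ex[OF ex, rule_format]]
  show "\<exists>T''::'a \<Rightarrow>\<^sub>L 'a. \<forall>a b. star (blinfun_apply (SOME T'. \<forall>a b. star (blinfun_apply T a) * b = star a * blinfun_apply T' b) a) * b = star a * blinfun_apply T'' b"
    by blast
qed

lemma lmul_adj: "star (lmul m a) * b = star a * lmul (adj_multiplier m) b"
proof transfer
  fix T :: "'a \<Rightarrow>\<^sub>L 'a" and a b
  assume ex: "\<exists>T'::'a \<Rightarrow>\<^sub>L 'a. \<forall>a b. star (blinfun_apply T a) * b = star a * blinfun_apply T' b"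
  from someI_ex[OF ex] show "star (blinfun_apply T a) * b = star a *
    blinfun_apply (SOME T'. \<forall>a b. star (blinfun_apply T a) * b = star a * blinfun_apply T' b) b" by blast
qed

lemma lmul_adj_unique:
  assumes "\<And>a b. star (lmul m a) * b = star a * lmul n b"
  shows "adj_multiplier m = n"
proof (rule lmul_eqI, rule mult_all_eq)
  fix a c
  show "c * lmul (adj_multiplier m) a = c * lmul n a"
    using assms[of "star c" a] lmul_adj[of m "star c" a] by (simp add: star_star)
qed

lemma lmul_adj': "star (lmul (adj_multiplier m) a) * b = star a * lmul m b"
  using arg_cong[OF lmul_adj[of m b a], of star] by (simp add: star_mult star_star)

lemma adj_adj: "adj_multiplier (adj_multiplier m) = m"
  by (rule lmul_adj_unique) (rule lmul_adj')

lemma norm_lmul_le: "norm (lmul m a) \<le> norm m * norm a"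
  by transfer (rule norm_blinfun)

lemma norm_multiplier_bound: "0 \<le> b \<Longrightarrow> (\<And>a. norm (lmul m a) \<le> b * norm a) \<Longrightarrow> norm m \<le> b"
  by transfer (rule norm_blinfun_bound)

lemma lmul_add_left: "lmul (m + n) a = lmul m a + lmul n a"
  by transfer (rule blinfun.add_left)

lemma lmul_minus_left: "lmul (- m) a = - lmul m a"
  by transfer (rule blinfun.minus_left)

lemma lmul_diff_left: "lmul (m - n) a = lmul m a - lmul n a"
  by (metis diff_conv_add_uminus lmul_add_left lmul_minus_left)

lemma lmul_scaleC_left: "lmul (c *\<^sub>C m) a = c *\<^sub>C lmul m a"
  by transfer simp

lemma lmul_scaleC_right: "lmul m (c *\<^sub>C a) = c *\<^sub>C lmul m a"
  by transfer (use adjoint_blinfun_scaleC in blast)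

lemma adj_add: "adj_multiplier (m + n) = adj_multiplier m + adj_multiplier n"
  by (rule lmul_adj_unique) (simp add: lmul_add_left star_add lmul_adj algebra_simps)

lemma adj_minus: "adj_multiplier (- m) = - adj_multiplier m"
  by (rule lmul_adj_unique) (simp add: lmul_minus_left star_minus lmul_adj)

lemma adj_diff: "adj_multiplier (m - n) = adj_multiplier m - adj_multiplier n"
  by (metis diff_conv_add_uminus adj_add adj_minus)

lemma adj_scaleC: "adj_multiplier (c *\<^sub>C m) = cnj c *\<^sub>C adj_multiplier m"
  by (rule lmul_adj_unique)
    (simp add: lmul_scaleC_left star_scaleC mult_scaleC_left mult_scaleC_right lmul_adj)

lemma norm_adj: "norm (adj_multiplier m) = norm m"
proof -
  have "norm (adj_multiplier m) \<le> norm m" for m :: "'a multiplier"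
  proof (rule norm_multiplier_bound)
    fix b
    let ?x = "lmul (adj_multiplier m) b"
    have "(norm ?x)\<^sup>2 = norm (star (lmul m ?x) * b)"
      by (simp only: lmul_adj[of m] cstar_identity)
    also have "\<dots> \<le> norm (lmul m ?x) * norm b"
      by (metis norm_mult_ineq norm_star)
    also have "\<dots> \<le> norm m * norm ?x * norm b"
      by (simp add: mult_right_mono norm_lmul_le)
    finally have "norm ?x * norm ?x \<le> (norm m * norm b) * norm ?x"
      by (simp add: power2_eq_square algebra_simps)
    then show "norm ?x \<le> norm m * norm b"
      by (cases "?x = 0") auto
  qed simp
  from this[of m] this[of "adj_multiplier m"] show ?thesis by (simp add: adj_adj)
qed

instance multiplier :: (cstar_algebra) banach
proof
  fix X :: "nat \<Rightarrow> 'a multiplier"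
  assume X: "Cauchy X"
  have rep_diff: "norm (blinfun_of_mult m - blinfun_of_mult n) = norm (m - n)" for m n :: "'a multiplier"
  proof -
    have "blinfun_of_mult m - blinfun_of_mult n = blinfun_of_mult (m - n)"
      unfolding minus_multiplier_def by transfer simp
    then show ?thesis by (simp add: norm_multiplier.rep_eq)
  qed
  have "Cauchy (\<lambda>n. blinfun_of_mult (X n))"
    using X by (simp add: Cauchy_def dist_norm rep_diff)
  then obtain T where T: "(\<lambda>n. blinfun_of_mult (X n)) \<longlonglongrightarrow> T"
    using Cauchy_convergent convergent_def by blast
  have "Cauchy (\<lambda>n. blinfun_of_mult (adj_multiplier (X n)))"
    using X by (simp add: Cauchy_def dist_norm rep_diff norm_adj flip: adj_diff)
  then obtain T' where T': "(\<lambda>n. blinfun_of_mult (adj_multiplier (X n))) \<longlonglongrightarrow> T'"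
    using Cauchy_convergent convergent_def by blast
  have "star (blinfun_apply T a) * b = star a * blinfun_apply T' b" for a b
  proof (rule LIMSEQ_unique)
    show "(\<lambda>n. star (blinfun_apply (blinfun_of_mult (X n)) a) * b) \<longlonglongrightarrow> star (blinfun_apply T a) * b"
      by (intro tendsto_mult tendsto_const bounded_linear.tendsto[OF bounded_linear_star]
          blinfun.tendsto T)
    have "(\<lambda>n. star a * blinfun_apply (blinfun_of_mult (adj_multiplier (X n))) b) \<longlonglongrightarrow> star a * blinfun_apply T' b"
      by (intro tendsto_mult tendsto_const blinfun.tendsto T')
    then show "(\<lambda>n. star (blinfun_apply (blinfun_of_mult (X n)) a) * b) \<longlonglongrightarrow> star a * blinfun_apply T' b"
      using lmul_adj[of _ a b] by (simp add: lmul.rep_eq)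
  qed
  then have "T \<in> {T. \<exists>T'::'a \<Rightarrow>\<^sub>L 'a. \<forall>a b. star (blinfun_apply T a) * b = star a * blinfun_apply T' b}"
    by blast
  then have "blinfun_of_mult (Mult T) = T" by (rule Mult_inverse)
  then have "X \<longlonglongrightarrow> Mult T"
    using T by (simp add: LIMSEQ_iff flip: rep_diff)
  then show "convergent X" by (auto simp: convergent_def)
qed

instantiation multiplier :: (cstar_algebra) "{cstar_algebra, monoid_mult}"
begin

lift_definition one_multiplier :: "'a multiplier" is id_blinfun
  by (auto intro!: exI[of _ id_blinfun])
lift_definition times_multiplier :: "'a multiplier \<Rightarrow> 'a multiplier \<Rightarrow> 'a multiplier" is blinfun_compose
proof -
  fix S T :: "'a \<Rightarrow>\<^sub>L 'a"
  assume "\<exists>S'::'a \<Rightarrow>\<^sub>L 'a. \<forall>a b. star (blinfun_apply S a) * b = star a * blinfun_apply S' b"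
    and "\<exists>T'::'a \<Rightarrow>\<^sub>L 'a. \<forall>a b. star (blinfun_apply T a) * b = star a * blinfun_apply T' b"
  then show "\<exists>T'::'a \<Rightarrow>\<^sub>L 'a. \<forall>a b. star (blinfun_apply (S o\<^sub>L T) a) * b = star a * blinfun_apply T' b"
    using blinfun_compose_mult_star by blast
qed
definition star_multiplier :: "'a multiplier \<Rightarrow> 'a multiplier" where
  "star_multiplier = adj_multiplier"

lemma lmul_times: "lmul (m * n) a = lmul m (lmul n (a::'a))"
  by transfer simp

lemma lmul_one: "lmul 1 a = (a::'a)"
  by transfer simp

lemma lmul_add_right: "lmul m (a + b) = lmul m a + lmul m (b::'a)"
  using bounded_linear_lmul by (rule bounded_linear.axioms(1)[THEN linear_add])

instance
proof
  fix k m n :: "'a multiplier" and r :: real and c :: complex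
  show "k * m * n = k * (m * n)" by (rule lmul_eqI) (simp add: lmul_times)
  show "1 * m = m" by (rule lmul_eqI) (simp add: lmul_times lmul_one)
  show "m * 1 = m" by (rule lmul_eqI) (simp add: lmul_times lmul_one)
  show "(k + m) * n = k * n + m * n" by (rule lmul_eqI) (simp add: lmul_times lmul_add_left)
  show "k * (m + n) = k * m + k * n"
    by (rule lmul_eqI) (simp add: lmul_times lmul_add_left lmul_add_right)
  show "r *\<^sub>R m * n = r *\<^sub>R (m * n)"
    by (rule lmul_eqI) (simp add: lmul_times lmul_scaleC_left scaleR_multiplier_def)
  show "m * r *\<^sub>R n = r *\<^sub>R (m * n)"
    by (rule lmul_eqI) (simp add: lmul_times lmul_scaleC_left lmul_scaleC_right scaleR_multiplier_def)
  show "c *\<^sub>C m * n = c *\<^sub>C (m * n)" by (rule lmul_eqI) (simp add: lmul_times lmul_scaleC_left)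
  show "m * c *\<^sub>C n = c *\<^sub>C (m * n)"
    by (rule lmul_eqI) (simp add: lmul_times lmul_scaleC_left lmul_scaleC_right)
  show mult_le: "norm (m * n) \<le> norm m * norm n" for m n :: "'a multiplier"
  proof (rule norm_multiplier_bound)
    fix a
    have "norm (lmul m (lmul n a)) \<le> norm m * norm (lmul n a)" by (rule norm_lmul_le)
    also have "\<dots> \<le> norm m * (norm n * norm a)" by (simp add: mult_left_mono norm_lmul_le)
    finally show "norm (lmul (m * n) a) \<le> norm m * norm n * norm a"
      by (simp add: lmul_times mult.assoc)
  qed simp
  show "star (star m) = m" by (simp add: star_multiplier_def adj_adj)
  show "star (m + n) = star m + star n" by (simp add: star_multiplier_def adj_add)
  show "star (c *\<^sub>C m) = cnj c *\<^sub>C star m" by (simp add: star_multiplier_def adj_scaleC)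
  show "star (m * n) = star n * star m"
    unfolding star_multiplier_def by (rule lmul_adj_unique) (simp add: lmul_times lmul_adj)
  show "norm (star m * m) = (norm m)\<^sup>2"
  proof (rule antisym)
    show "norm (star m * m) \<le> (norm m)\<^sup>2"
      using mult_le[of "star m" m] by (simp add: star_multiplier_def norm_adj power2_eq_square)
    have "norm m \<le> sqrt (norm (star m * m))"
    proof (rule norm_multiplier_bound)
      fix a
      have "(norm (lmul m a))\<^sup>2 = norm (star a * lmul (star m * m) a)"
        by (simp add: lmul_adj lmul_times star_multiplier_def flip: cstar_identity)
      also have "\<dots> \<le> norm a * norm (lmul (star m * m) a)"
        by (metis norm_mult_ineq norm_star)
      also have "\<dots> \<le> norm a * (norm (star m * m) * norm a)"
        by (simp add: mult_left_mono norm_lmul_le)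
      also have "\<dots> = (sqrt (norm (star m * m)) * norm a)\<^sup>2"
        by (simp add: power_mult_distrib power2_eq_square[of "norm a"])
      finally show "norm (lmul m a) \<le> sqrt (norm (star m * m)) * norm a"
        by (rule power2_le_imp_le) simp
    qed simp
    then show "(norm m)\<^sup>2 \<le> norm (star m * m)"
      using sqrt_ge_absD[of "norm m"] by simp
  qed
qed

end

text \<open>The products \<open>m a\<close> and \<open>a m\<close> in \<open>A\<close> are \<open>lmul m a\<close> and \<open>rmul a m\<close>;
  \<open>mult_of\<close> is the embedding of \<open>A\<close> into \<open>M(A)\<close>.\<close>

definition rmul :: "'a::cstar_algebra \<Rightarrow> 'a multiplier \<Rightarrow> 'a" where
  "rmul a m = star (lmul (star m) (star a))"

lift_definition mult_of :: "'a::cstar_algebra \<Rightarrow> 'a multiplier" is blinfun_mult_right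
proof -
  fix a :: 'a
  show "\<exists>T'::'a \<Rightarrow>\<^sub>L 'a. \<forall>b c. star (blinfun_apply (blinfun_mult_right a) b) * c = star b * blinfun_apply T' c"
    by (rule exI[of _ "blinfun_mult_right (star a)"])
      (simp add: blinfun_mult_right.rep_eq star_mult mult.assoc)
qed

lemma mult_of_rmul: "mult_of (rmul a m) = mult_of a * m"
proof (rule lmul_eqI)
  fix b
  have "rmul a m * b = a * lmul m b"
    using lmul_adj[of "star m" "star a" b] by (simp add: rmul_def star_star star_multiplier_def adj_adj)
  then show "lmul (mult_of (rmul a m)) b = lmul (mult_of a * m) b"
    by (simp add: lmul_times) (simp add: mult_of.rep_eq lmul.rep_eq blinfun_mult_right.rep_eq)
qed

lemma mult_of_lmul: "mult_of (lmul m a) = m * mult_of a"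
  by (rule lmul_eqI) (simp add: lmul_times, simp add: mult_of.rep_eq lmul.rep_eq
      blinfun_mult_right.rep_eq lmul_mult[unfolded lmul.rep_eq])

definition strict_tendsto :: "('i \<Rightarrow> 'a::cstar_algebra multiplier) \<Rightarrow> 'a multiplier \<Rightarrow> 'i filter \<Rightarrow> bool" where
  "strict_tendsto f m F \<longleftrightarrow>
     (\<forall>a. ((\<lambda>i. lmul (f i) a) \<longlongrightarrow> lmul m a) F \<and> ((\<lambda>i. rmul a (f i)) \<longlongrightarrow> rmul a m) F)"

definition strict_Lim :: "'i filter \<Rightarrow> ('i \<Rightarrow> 'a::cstar_algebra multiplier) \<Rightarrow> 'a multiplier" where
  "strict_Lim F f = (THE m. strict_tendsto f m F)"


section \<open>Bounded operators on a Hilbert space\<close>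

lemma cinner_add_left: "cinner (x + y) z = cinner x z + cinner y (z::'h::chilbert_space)"
  by (metis cinner_add_right cinner_commute complex_cnj_add)

lemma cinner_scaleC_left: "cinner (c *\<^sub>C x) y = cnj c * cinner x (y::'h::chilbert_space)"
  by (metis cinner_commute cinner_scaleC_right complex_cnj_mult)

lemma cinner_zero_right [simp]: "cinner x 0 = (0::complex)" for x :: "'h::chilbert_space"
  using cinner_scaleC_right[of x 0 0] by simp

lemma cinner_minus_right: "cinner x (- y) = - cinner x (y::'h::chilbert_space)"
  using cinner_add_right[of x y "- y"] by (simp add: eq_neg_iff_add_eq_0 add.commute)

lemma cinner_diff_right: "cinner x (y - z) = cinner x y - cinner x (z::'h::chilbert_space)"
  using cinner_add_right[of x y "- z"] by (simp add: cinner_minus_right)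

lemma norm_add_cinner: "(norm (x + y))\<^sup>2 = (norm x)\<^sup>2 + (norm y)\<^sup>2 + 2 * Re (cinner x (y::'h::chilbert_space))"
proof -
  have "complex_of_real ((norm (x + y))\<^sup>2) =
      complex_of_real ((norm x)\<^sup>2) + complex_of_real ((norm y)\<^sup>2) + (cinner x y + cnj (cinner x y))"
    unfolding cinner_self[symmetric]
    by (simp add: cinner_add_left cinner_add_right cinner_commute[of y x])
  then have "Re (complex_of_real ((norm (x + y))\<^sup>2)) =
      Re (complex_of_real ((norm x)\<^sup>2) + complex_of_real ((norm y)\<^sup>2) + (cinner x y + cnj (cinner x y)))"
    by (rule arg_cong)
  then show ?thesis by simp
qed

lemma Re_cinner_le: "Re (cinner x y) \<le> norm x * norm (y::'h::chilbert_space)"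
proof -
  have "(norm (x + y))\<^sup>2 \<le> (norm x + norm y)\<^sup>2"
    by (simp add: norm_triangle_ineq power_mono)
  then show ?thesis by (simp add: norm_add_cinner power2_sum)
qed

lemma cinner_eqI: "(\<And>x. cinner x y = cinner x z) \<Longrightarrow> y = (z::'h::chilbert_space)"
  using cinner_self[of "y - z"] by (simp add: cinner_diff_right)

text \<open>Riesz representation, by minimising \<open>\<parallel>x\<parallel>\<^sup>2 - 2 Re (f x)\<close>.\<close>

lemma riesz_Re:
  fixes f :: "'h::chilbert_space \<Rightarrow> real"
  assumes f: "bounded_linear f"
  obtains z where "\<And>x. Re (cinner z x) = f x"
proof -
  interpret f: bounded_linear f by (rule f)
  define J where "J x = (norm x)\<^sup>2 - 2 * f x" for x
  obtain K where K: "\<And>x. norm (f x) \<le> norm x * K"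
    using f.bounded by blast
  have J_ge: "- K\<^sup>2 \<le> J x" for x
  proof -
    have "f x \<le> norm x * K" using K[of x] by (simp add: abs_le_iff)
    moreover have "0 \<le> (norm x - K)\<^sup>2" by simp
    ultimately show ?thesis by (simp add: J_def power2_diff algebra_simps)
  qed
  define m where "m = (INF x. J x)"
  have bdd: "bdd_below (range J)" using J_ge by (auto intro!: bdd_belowI)
  have m_le: "m \<le> J x" for x unfolding m_def by (rule cINF_lower[OF bdd]) simp
  have "\<exists>x. J x < m + 1 / real (Suc n)" for n
  proof (rule ccontr)
    assume "\<nexists>x. J x < m + 1 / real (Suc n)"
    then have "m + 1 / real (Suc n) \<le> (INF x. J x)"
      by (intro cINF_greatest) (auto simp: not_less)
    then show False by (simp add: m_def)
  qed
  then obtain x where x: "\<And>n. J (x n) < m + 1 / real (Suc n)" by metis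
  have par: "(norm (a - b))\<^sup>2 \<le> 2 * (J a - m) + 2 * (J b - m)" for a b
  proof -
    have h: "(norm ((1/2) *\<^sub>R (a + b)))\<^sup>2 = (norm (a + b))\<^sup>2 / 4"
      by (simp add: power_divide)
    have "(norm (a + b))\<^sup>2 + (norm (a + - b))\<^sup>2 = 2 * (norm a)\<^sup>2 + 2 * (norm b)\<^sup>2"
      unfolding norm_add_cinner by (simp add: cinner_minus_right)
    moreover have "f ((1/2) *\<^sub>R (a + b)) = (f a + f b) / 2"
      by (simp add: f.scaleR f.add)
    moreover have "m \<le> J ((1/2) *\<^sub>R (a + b))" by (rule m_le)
    ultimately show ?thesis unfolding J_def h by simp
  qed
  have "Cauchy x"
  proof (rule CauchyI)
    fix e :: real
    assume e: "0 < e"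
    define q where "q = e\<^sup>2 / 4"
    have "0 < q" using e by (simp add: q_def)
    then obtain N where N: "1 / real (Suc N) < q"
      using reals_Archimedean[of q] by (auto simp: inverse_eq_divide)
    have "norm (x i - x j) < e" if "N \<le> i" "N \<le> j" for i j
    proof -
      have *: "J (x k) - m < q" if "N \<le> k" for k
      proof -
        have "1 / real (Suc k) \<le> 1 / real (Suc N)" using that by (simp add: field_simps)
        with x[of k] N show ?thesis by linarith
      qed
      have "(norm (x i - x j))\<^sup>2 < 4 * q"
        using par[of "x i" "x j"] *[OF that(1)] *[OF that(2)] by argo
      then have "(norm (x i - x j))\<^sup>2 < e\<^sup>2" by (simp add: q_def)
      then show ?thesis by (rule power2_less_imp_less) (use e in simp)
    qed
    then show "\<exists>M. \<forall>i\<ge>M. \<forall>j\<ge>M. norm (x i - x j) < e" by blast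
  qed
  then obtain z where z: "x \<longlonglongrightarrow> z" using Cauchy_convergent convergent_def by blast
  have "(\<lambda>n. J (x n)) \<longlonglongrightarrow> J z"
    unfolding J_def by (intro tendsto_intros f.tendsto z)
  moreover have "(\<lambda>n. m + 1 / real (Suc n)) \<longlonglongrightarrow> m + 0"
    by (intro tendsto_add tendsto_const LIMSEQ_Suc[OF lim_1_over_n])
  ultimately have "J z \<le> m + 0"
  proof (rule LIMSEQ_le)
    show "\<exists>N. \<forall>n\<ge>N. J (x n) \<le> m + 1 / real (Suc n)" using x less_imp_le by blast
  qed
  then have min: "J z \<le> J y" for y using m_le[of y] by simp
  have "Re (cinner z v) = f v" for v
  proof -
    define d where "d = Re (cinner z v) - f v"
    have quad: "0 \<le> t\<^sup>2 * (norm v)\<^sup>2 + 2 * t * d" for t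
    proof -
      have r: "Re (cinner z (t *\<^sub>R v)) = t * Re (cinner z v)"
        by (simp add: scaleR_scaleC cinner_scaleC_right)
      show ?thesis using min[of "z + t *\<^sub>R v"]
        by (simp add: J_def norm_add_cinner r f.add f.scaleR d_def power_mult_distrib algebra_simps)
    qed
    have "d = 0"
    proof (rule ccontr)
      assume d: "d \<noteq> 0"
      define t where "t = - d / ((norm v)\<^sup>2 + 1)"
      have "t * ((norm v)\<^sup>2 + 1) = - d"
      proof -
        have "(norm v)\<^sup>2 + 1 \<noteq> 0" by (metis add_nonneg_pos less_irrefl zero_le_power2 zero_less_one)
        then show ?thesis by (simp add: t_def)
      qed
      then have d': "d = - (t * ((norm v)\<^sup>2 + 1))" by simp
      with d have t: "t \<noteq> 0" by auto
      have "t\<^sup>2 * (norm v)\<^sup>2 + 2 * t * d = - (t\<^sup>2 * ((norm v)\<^sup>2 + 2))"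
        unfolding d' by (simp add: power2_eq_square algebra_simps)
      moreover have "t\<^sup>2 * ((norm v)\<^sup>2 + 2) > 0"
        using t by (intro mult_pos_pos) (auto intro: add_nonneg_pos)
      ultimately show False using quad[of t] by simp
    qed
    then show ?thesis by (simp add: d_def)
  qed
  then show ?thesis by (rule that)
qed

typedef (overloaded) 'h bop =
  "{T :: 'h::chilbert_space \<Rightarrow>\<^sub>L 'h. \<forall>c x. blinfun_apply T (c *\<^sub>C x) = c *\<^sub>C blinfun_apply T x}"
  morphisms blinfun_of_bop Bop
  by (rule exI[of _ 0]) (simp add: blinfun.zero_left)

setup_lifting type_definition_bop

lift_definition bop_apply :: "'h::chilbert_space bop \<Rightarrow> 'h \<Rightarrow> 'h" is blinfun_apply .

lemma bop_eqI: "(\<And>x. bop_apply S x = bop_apply T x) \<Longrightarrow> S = T"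
  by transfer (rule blinfun_eqI)

lemma bop_apply_add: "bop_apply T (x + y) = bop_apply T x + bop_apply T y"
  by transfer (rule blinfun.add_right)

lemma bop_apply_scaleC: "bop_apply T (c *\<^sub>C x) = c *\<^sub>C bop_apply T x"
  by transfer simp

lemma bounded_linear_bop_apply: "bounded_linear (bop_apply T)"
  by transfer (rule blinfun.bounded_linear_right)

instantiation bop :: (chilbert_space) cnormed_space
begin

lift_definition norm_bop :: "'a bop \<Rightarrow> real" is norm .
lift_definition zero_bop :: "'a bop" is 0 by (simp add: blinfun.zero_left)
lift_definition plus_bop :: "'a bop \<Rightarrow> 'a bop \<Rightarrow> 'a bop" is "(+)"
  by (simp add: blinfun.add_left scaleC_add_right)
lift_definition uminus_bop :: "'a bop \<Rightarrow> 'a bop" is uminus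
  by (simp add: blinfun.minus_left scaleC_minus_right)
lift_definition minus_bop :: "'a bop \<Rightarrow> 'a bop \<Rightarrow> 'a bop" is "(-)"
  by (simp add: blinfun.diff_left scaleC_diff_right)
lift_definition scaleC_bop :: "complex \<Rightarrow> 'a bop \<Rightarrow> 'a bop" is blinfun_scaleC
  by (simp add: scaleC_scaleC mult.commute)
definition scaleR_bop :: "real \<Rightarrow> 'a bop \<Rightarrow> 'a bop" where
  "scaleR_bop r S = complex_of_real r *\<^sub>C S"
definition dist_bop :: "'a bop \<Rightarrow> 'a bop \<Rightarrow> real" where
  "dist_bop S T = norm (S - T)"
definition sgn_bop :: "'a bop \<Rightarrow> 'a bop" where
  "sgn_bop S = inverse (norm S) *\<^sub>R S"
definition uniformity_bop :: "('a bop \<times> 'a bop) filter" where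
  "uniformity_bop = (INF e\<in>{0<..}. principal {(S, T). dist S T < e})"
definition open_bop :: "'a bop set \<Rightarrow> bool" where
  "open_bop U \<longleftrightarrow> (\<forall>S\<in>U. \<forall>\<^sub>F (S', T) in uniformity. S' = S \<longrightarrow> T \<in> U)"

lemma scaleC_bop_add: "c *\<^sub>C (S + T) = c *\<^sub>C S + c *\<^sub>C (T::'a bop)"
  by transfer (rule blinfun_eqI, simp add: blinfun.add_left scaleC_add_right)

lemma scaleC_bop_add_left: "(c + d) *\<^sub>C T = c *\<^sub>C T + d *\<^sub>C (T::'a bop)"
  by transfer (rule blinfun_eqI, simp add: blinfun.add_left scaleC_add_left)

lemma scaleC_scaleC_bop: "c *\<^sub>C d *\<^sub>C T = (c * d) *\<^sub>C (T::'a bop)"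
  by transfer (rule blinfun_eqI, simp add: scaleC_scaleC)

lemma scaleC_one_bop: "1 *\<^sub>C T = (T::'a bop)"
  by transfer (rule blinfun_eqI, simp)

lemma norm_scaleC_bop: "norm (c *\<^sub>C T) = cmod c * norm (T::'a bop)"
  by transfer (rule norm_blinfun_scaleC)

instance
proof
  fix R S T :: "'a bop" and r q :: real and c d :: complex
  show "R + S + T = R + (S + T)" by transfer (simp add: add.assoc)
  show "S + T = T + S" by transfer (simp add: add.commute)
  show "0 + S = S" by transfer simp
  show "- S + S = 0" by transfer simp
  show "S - T = S + - T" by transfer simp
  show "r *\<^sub>R (S + T) = r *\<^sub>R S + r *\<^sub>R T" by (simp add: scaleR_bop_def scaleC_bop_add)
  show "(r + q) *\<^sub>R S = r *\<^sub>R S + q *\<^sub>R S"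
    by (simp add: scaleR_bop_def scaleC_bop_add_left)
  show "r *\<^sub>R q *\<^sub>R S = (r * q) *\<^sub>R S"
    by (simp add: scaleR_bop_def scaleC_scaleC_bop)
  show "1 *\<^sub>R S = S" by (simp add: scaleR_bop_def scaleC_one_bop)
  show "dist S T = norm (S - T)" by (rule dist_bop_def)
  show "sgn S = inverse (norm S) *\<^sub>R S" by (rule sgn_bop_def)
  show "uniformity = (INF e\<in>{0<..}. principal {(S, T::'a bop). dist S T < e})"
    by (rule uniformity_bop_def)
  show "open U = (\<forall>S\<in>U. \<forall>\<^sub>F (S', T) in uniformity. S' = S \<longrightarrow> T \<in> U)" for U :: "'a bop set"
    by (rule open_bop_def)
  show "norm S = 0 \<longleftrightarrow> S = 0" by transfer simp
  show "norm (S + T) \<le> norm S + norm T" by transfer (rule norm_triangle_ineq)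
  show "norm (r *\<^sub>R S) = \<bar>r\<bar> * norm S" by (simp add: scaleR_bop_def norm_scaleC_bop)
  show "c *\<^sub>C (S + T) = c *\<^sub>C S + c *\<^sub>C T" by (rule scaleC_bop_add)
  show "(c + d) *\<^sub>C S = c *\<^sub>C S + d *\<^sub>C S" by (rule scaleC_bop_add_left)
  show "c *\<^sub>C d *\<^sub>C S = (c * d) *\<^sub>C S" by (rule scaleC_scaleC_bop)
  show "r *\<^sub>R S = complex_of_real r *\<^sub>C S" by (rule scaleR_bop_def)
  show "norm (c *\<^sub>C S) = cmod c * norm S" by (rule norm_scaleC_bop)
qed

end

instance bop :: (chilbert_space) banach
proof
  fix X :: "nat \<Rightarrow> 'a bop"
  assume X: "Cauchy X"
  have rep_diff: "norm (blinfun_of_bop S - blinfun_of_bop T) = norm (S - T)" for S T :: "'a bop"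
    by transfer simp
  have "Cauchy (\<lambda>n. blinfun_of_bop (X n))"
    using X by (simp add: Cauchy_def dist_norm rep_diff)
  then obtain T where T: "(\<lambda>n. blinfun_of_bop (X n)) \<longlonglongrightarrow> T"
    using Cauchy_convergent convergent_def by blast
  have lin: "blinfun_apply (blinfun_of_bop S) (c *\<^sub>C x) = c *\<^sub>C blinfun_apply (blinfun_of_bop S) x"
    for S :: "'a bop" and c x
    using bop_apply_scaleC[of S c x] by (simp only: bop_apply.rep_eq)
  have "blinfun_apply T (c *\<^sub>C x) = c *\<^sub>C blinfun_apply T x" for c x
  proof (rule LIMSEQ_unique)
    show "(\<lambda>n. blinfun_apply (blinfun_of_bop (X n)) (c *\<^sub>C x)) \<longlonglongrightarrow> blinfun_apply T (c *\<^sub>C x)"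
      by (intro blinfun.tendsto T tendsto_const)
    have "(\<lambda>n. c *\<^sub>C blinfun_apply (blinfun_of_bop (X n)) x) \<longlonglongrightarrow> c *\<^sub>C blinfun_apply T x"
      by (intro bounded_linear.tendsto[OF bounded_linear_scaleC_right] blinfun.tendsto T tendsto_const)
    then show "(\<lambda>n. blinfun_apply (blinfun_of_bop (X n)) (c *\<^sub>C x)) \<longlonglongrightarrow> c *\<^sub>C blinfun_apply T x"
      by (simp only: lin)
  qed
  then have "blinfun_of_bop (Bop T) = T" by (intro Bop_inverse) simp
  then have "X \<longlonglongrightarrow> Bop T"
    using T by (simp add: LIMSEQ_iff flip: rep_diff)
  then show "convergent X" by (auto simp: convergent_def)
qed

lemma norm_bop_apply_le: "norm (bop_apply T x) \<le> norm T * norm x"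
  by transfer (rule norm_blinfun)

lemma norm_bop_bound: "0 \<le> b \<Longrightarrow> (\<And>x. norm (bop_apply T x) \<le> b * norm x) \<Longrightarrow> norm T \<le> b"
  by transfer (rule norm_blinfun_bound)

lemma bop_apply_add_left: "bop_apply (S + T) x = bop_apply S x + bop_apply T x"
  by transfer (rule blinfun.add_left)

lemma bop_apply_scaleC_left: "bop_apply (c *\<^sub>C T) x = c *\<^sub>C bop_apply T x"
  by transfer simp

lemma bop_adjoint_exists: "\<exists>S. \<forall>x y. cinner (bop_apply S x) y = cinner x (bop_apply T y)"
proof -
  have bl: "bounded_linear (\<lambda>y. Re (cinner x (bop_apply T y)))" for x
  proof (rule bounded_linear_intro)
    show "Re (cinner x (bop_apply T (y + z))) = Re (cinner x (bop_apply T y)) + Re (cinner x (bop_apply T z))" for y z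
      by (simp add: bop_apply_add cinner_add_right)
    show "Re (cinner x (bop_apply T (r *\<^sub>R y))) = r *\<^sub>R Re (cinner x (bop_apply T y))" for r y
      by (simp add: scaleR_scaleC[where 'a='a] bop_apply_scaleC cinner_scaleC_right)
    show "norm (Re (cinner x (bop_apply T y))) \<le> norm y * (norm x * norm T)" for y
    proof -
      have "Re (cinner x (bop_apply T z)) \<le> norm z * (norm x * norm T)" for z
      proof -
        have "Re (cinner x (bop_apply T z)) \<le> norm x * norm (bop_apply T z)" by (rule Re_cinner_le)
        also have "\<dots> \<le> norm x * (norm T * norm z)" by (simp add: mult_left_mono norm_bop_apply_le)
        finally show ?thesis by (simp add: mult_ac)
      qed
      from this[of y] this[of "- y"] show ?thesis
        by (simp add: linear_neg[OF bounded_linear.linear[OF bounded_linear_bop_apply]]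
            cinner_minus_right abs_le_iff)
    qed
  qed
  have "\<exists>z. \<forall>y. cinner z y = cinner x (bop_apply T y)" for x
  proof -
    obtain z where z: "\<And>y. Re (cinner z y) = Re (cinner x (bop_apply T y))"
      using riesz_Re[OF bl[of x]] by blast
    have "Im (cinner z y) = Im (cinner x (bop_apply T y))" for y
      using z[of "\<i> *\<^sub>C y"] by (simp add: bop_apply_scaleC cinner_scaleC_right)
    with z show ?thesis by (auto intro!: exI[of _ z] complex_eqI)
  qed
  then obtain A where A: "\<And>x y. cinner (A x) y = cinner x (bop_apply T y)" by metis
  have eqI: "u = v" if "\<And>y. cinner u y = cinner v y" for u v :: 'a
    by (rule cinner_eqI) (metis cinner_commute that)
  have add: "A (x + y) = A x + A y" for x y
    by (rule eqI) (simp add: A cinner_add_left)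
  have scale: "A (c *\<^sub>C x) = c *\<^sub>C A x" for c x
    by (rule eqI) (simp add: A cinner_scaleC_left)
  have bd: "norm (A x) \<le> norm x * norm T" for x
  proof -
    have "(norm (A x))\<^sup>2 = Re (cinner x (bop_apply T (A x)))"
      unfolding A[symmetric] cinner_self by simp
    also have "\<dots> \<le> norm x * norm (bop_apply T (A x))" by (rule Re_cinner_le)
    also have "\<dots> \<le> norm x * (norm T * norm (A x))" by (simp add: mult_left_mono norm_bop_apply_le)
    finally have "norm (A x) * norm (A x) \<le> (norm x * norm T) * norm (A x)"
      by (simp add: power2_eq_square mult_ac)
    then show ?thesis by (cases "A x = 0") auto
  qed
  have "bounded_linear A"
    by (rule bounded_linear_intro[OF add _ bd]) (simp add: scaleR_scaleC scale)
  then have *: "blinfun_apply (Blinfun A) = A" by (rule bounded_linear_Blinfun_apply)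
  then have "blinfun_of_bop (Bop (Blinfun A)) = Blinfun A"
    by (intro Bop_inverse) (simp add: scale)
  then have "bop_apply (Bop (Blinfun A)) = A" by (simp add: bop_apply.rep_eq *)
  then have "cinner (bop_apply (Bop (Blinfun A)) x) y = cinner x (bop_apply T y)" for x y
    by (simp only: A)
  then show ?thesis by blast
qed

definition bop_adj :: "'h::chilbert_space bop \<Rightarrow> 'h bop" where
  "bop_adj T = (SOME S. \<forall>x y. cinner (bop_apply S x) y = cinner x (bop_apply T y))"

lemma bop_adj: "cinner (bop_apply (bop_adj T) x) y = cinner x (bop_apply T y)"
  using someI_ex[OF bop_adjoint_exists[of T]] unfolding bop_adj_def by blast

lemma bop_adj_unique:
  assumes "\<And>x y. cinner (bop_apply S x) y = cinner x (bop_apply T y)"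
  shows "bop_adj T = S"
proof (rule bop_eqI, rule cinner_eqI)
  fix x y
  show "cinner y (bop_apply (bop_adj T) x) = cinner y (bop_apply S x)"
    by (metis assms bop_adj cinner_commute)
qed

lemma bop_adj_adj: "bop_adj (bop_adj T) = T"
  by (rule bop_adj_unique) (metis bop_adj cinner_commute)

lemma norm_bop_adj_le: "norm (bop_adj T) \<le> norm T"
proof (rule norm_bop_bound)
  fix x
  let ?z = "bop_apply (bop_adj T) x"
  have "(norm ?z)\<^sup>2 = Re (cinner x (bop_apply T ?z))"
    unfolding bop_adj[symmetric] cinner_self by simp
  also have "\<dots> \<le> norm x * norm (bop_apply T ?z)" by (rule Re_cinner_le)
  also have "\<dots> \<le> norm x * (norm T * norm ?z)" by (simp add: mult_left_mono norm_bop_apply_le)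
  finally have "norm ?z * norm ?z \<le> (norm T * norm x) * norm ?z"
    by (simp add: power2_eq_square mult_ac)
  then show "norm ?z \<le> norm T * norm x" by (cases "?z = 0") auto
qed simp

instantiation bop :: (chilbert_space) "{cstar_algebra, monoid_mult}"
begin

lift_definition one_bop :: "'a bop" is id_blinfun by simp
lift_definition times_bop :: "'a bop \<Rightarrow> 'a bop \<Rightarrow> 'a bop" is blinfun_compose by simp
definition star_bop :: "'a bop \<Rightarrow> 'a bop" where "star_bop = bop_adj"

lemma bop_apply_times: "bop_apply (S * T) x = bop_apply S (bop_apply T (x::'a))"
  by transfer simp

lemma bop_apply_one: "bop_apply 1 x = (x::'a)"
  by transfer simp

instance
proof
  fix R S T :: "'a bop" and r :: real and c :: complex
  show "R * S * T = R * (S * T)" by (rule bop_eqI) (simp add: bop_apply_times)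
  show "1 * S = S" by (rule bop_eqI) (simp add: bop_apply_times bop_apply_one)
  show "S * 1 = S" by (rule bop_eqI) (simp add: bop_apply_times bop_apply_one)
  show "(R + S) * T = R * T + S * T" by (rule bop_eqI) (simp add: bop_apply_times bop_apply_add_left)
  show "R * (S + T) = R * S + R * T"
    by (rule bop_eqI) (simp add: bop_apply_times bop_apply_add_left bop_apply_add)
  show "r *\<^sub>R S * T = r *\<^sub>R (S * T)"
    by (rule bop_eqI) (simp add: bop_apply_times bop_apply_scaleC_left scaleR_bop_def)
  show "S * r *\<^sub>R T = r *\<^sub>R (S * T)"
    by (rule bop_eqI) (simp add: bop_apply_times bop_apply_scaleC_left bop_apply_scaleC scaleR_bop_def)
  show "c *\<^sub>C S * T = c *\<^sub>C (S * T)" by (rule bop_eqI) (simp add: bop_apply_times bop_apply_scaleC_left)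
  show "S * c *\<^sub>C T = c *\<^sub>C (S * T)"
    by (rule bop_eqI) (simp add: bop_apply_times bop_apply_scaleC_left bop_apply_scaleC)
  show mult_le: "norm (S * T) \<le> norm S * norm T" for S T :: "'a bop"
    by transfer (rule norm_blinfun_compose)
  show "star (star S) = S" by (simp add: star_bop_def bop_adj_adj)
  show "star (S + T) = star S + star T"
    unfolding star_bop_def
    by (rule bop_adj_unique) (simp add: bop_apply_add_left cinner_add_left cinner_add_right bop_adj)
  show "star (c *\<^sub>C S) = cnj c *\<^sub>C star S"
    unfolding star_bop_def
    by (rule bop_adj_unique) (simp add: bop_apply_scaleC_left cinner_scaleC_left cinner_scaleC_right bop_adj)
  show "star (S * T) = star T * star S"
    unfolding star_bop_def by (rule bop_adj_unique) (simp add: bop_apply_times bop_adj)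
  show "norm (star S * S) = (norm S)\<^sup>2"
  proof (rule antisym)
    have "norm (star S * S) \<le> norm (star S) * norm S" by (rule mult_le)
    also have "\<dots> \<le> norm S * norm S" by (simp add: star_bop_def mult_right_mono norm_bop_adj_le)
    finally show "norm (star S * S) \<le> (norm S)\<^sup>2" by (simp add: power2_eq_square)
    have "norm S \<le> sqrt (norm (star S * S))"
    proof (rule norm_bop_bound)
      fix x
      have "(norm (bop_apply S x))\<^sup>2 = Re (cinner (bop_apply (star S * S) x) x)"
        by (simp add: bop_apply_times star_bop_def bop_adj cinner_self)
      also have "\<dots> \<le> norm (bop_apply (star S * S) x) * norm x" by (rule Re_cinner_le)
      also have "\<dots> \<le> (norm (star S * S) * norm x) * norm x"
        by (simp add: mult_right_mono norm_bop_apply_le)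
      also have "\<dots> = (sqrt (norm (star S * S)) * norm x)\<^sup>2"
        by (simp add: power_mult_distrib power2_eq_square[of "norm x"])
      finally show "norm (bop_apply S x) \<le> sqrt (norm (star S * S)) * norm x"
        by (rule power2_le_imp_le) simp
    qed simp
    then show "(norm S)\<^sup>2 \<le> norm (star S * S)"
      using sqrt_ge_absD[of "norm S"] by simp
  qed
qed

end


section \<open>Non-degenerate homomorphisms and generalised nets\<close>

text \<open>The sets whose closed span is taken are stable under multiplication by complex scalars,
  so it does not matter that \<^const>\<open>span\<close> is the real linear span.\<close>

definition nondegenerate_hom :: "('a::cstar_algebra \<Rightarrow> 'b::cstar_algebra) \<Rightarrow> bool" where
  "nondegenerate_hom f \<longleftrightarrow> star_hom f \<and> closure (span {f a * b |a b. True}) = UNIV"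

definition nondegenerate_rep :: "('a::cstar_algebra \<Rightarrow> 'h::chilbert_space bop) \<Rightarrow> bool" where
  "nondegenerate_rep \<pi> \<longleftrightarrow> star_hom \<pi> \<and> closure (span {bop_apply (\<pi> a) \<xi> |a \<xi>. True}) = UNIV"

text \<open>The canonical extension of a non-degenerate representation to the multiplier algebra
  (it is unique because \<open>\<tau>(m) \<sigma>(b) \<xi> = \<sigma>(m b) \<xi>\<close>).\<close>

definition rep_extension ::
  "('b::cstar_algebra \<Rightarrow> 'h::chilbert_space bop) \<Rightarrow> 'b multiplier \<Rightarrow> 'h bop" where
  "rep_extension \<sigma> = (THE \<tau>. star_hom \<tau> \<and> (\<forall>b. \<tau> (mult_of b) = \<sigma> b))"

text \<open>A net \<open>(u\<^sub>\<lambda>)\<close> is given by a function on the index type together with the proper filter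
  generated by the tails of the index set. Neither positivity nor monotonicity of the \<open>u\<^sub>\<lambda>\<close> is
  required, so that all usual conventions for approximate units of C*-algebras are covered.\<close>

definition approximate_unit :: "('i \<Rightarrow> 'a::cstar_algebra) \<Rightarrow> 'i filter \<Rightarrow> bool" where
  "approximate_unit u F \<longleftrightarrow> F \<noteq> bot \<and> (\<forall>\<^sub>F i in F. norm (u i) \<le> 1) \<and>
     (\<forall>a. ((\<lambda>i. u i * a) \<longlongrightarrow> a) F \<and> ((\<lambda>i. a * u i) \<longlongrightarrow> a) F)"


section \<open>Extendible endomorphisms and transfer operators\<close>

text \<open>Quantifying over filters on \<open>A\<close> itself amounts to quantifying over all approximate
  units, with arbitrary index sets: replace a net by its image filter.\<close>

definition is_mult_extension ::
  "('a::cstar_algebra \<Rightarrow> 'a) \<Rightarrow> ('a multiplier \<Rightarrow> 'a multiplier) \<Rightarrow> bool" where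
  "is_mult_extension f g \<longleftrightarrow> star_hom g \<and> (\<forall>a. g (mult_of a) = mult_of (f a)) \<and>
     (\<exists>F. approximate_unit (\<lambda>a. a) F \<and> strict_tendsto (\<lambda>a. mult_of (f a)) (g 1) F)"

definition extendible :: "('a::cstar_algebra \<Rightarrow> 'a) \<Rightarrow> bool" where
  "extendible f \<longleftrightarrow> star_hom f \<and> (\<exists>!g. is_mult_extension f g)"

definition mult_extension :: "('a::cstar_algebra \<Rightarrow> 'a) \<Rightarrow> 'a multiplier \<Rightarrow> 'a multiplier" where
  "mult_extension f = (THE g. is_mult_extension f g)"

definition semigroup_action :: "('s::comm_monoid_add \<Rightarrow> 'a \<Rightarrow> 'a) \<Rightarrow> bool" where
  "semigroup_action f \<longleftrightarrow> f 0 = id \<and> (\<forall>s t. f (s + t) = f s \<circ> f t)"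

definition extendible_action :: "('s::comm_monoid_add \<Rightarrow> 'a::cstar_algebra \<Rightarrow> 'a) \<Rightarrow> bool" where
  "extendible_action \<alpha> \<longleftrightarrow> semigroup_action \<alpha> \<and> (\<forall>s. extendible (\<alpha> s))"

definition transfer_action ::
  "('s::comm_monoid_add \<Rightarrow> 'a::cstar_algebra \<Rightarrow> 'a) \<Rightarrow> ('s \<Rightarrow> 'a \<Rightarrow> 'a) \<Rightarrow> bool" where
  "transfer_action \<alpha> L \<longleftrightarrow> semigroup_action L \<and>
     (\<forall>s. clinear_map (L s) \<and> continuous_on UNIV (L s) \<and> positive_map (L s) \<and>
       (\<exists>L' :: 'a multiplier \<Rightarrow> 'a multiplier.
          clinear_map L' \<and> continuous_on UNIV L' \<and> (\<forall>a. L' (mult_of a) = mult_of (L s a)) \<and>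
          (\<forall>a m. L s (rmul (\<alpha> s a) m) = rmul a (L' m))))"


section \<open>The product system\<close>

text \<open>The fibre over \<open>s\<close> is built from \<open>A\<^sub>s = A p\<close>, where \<open>p\<close> is the value at \<open>1\<close> of the
  extension of \<open>\<alpha>\<^sub>s\<close> to \<open>M(A)\<close>.\<close>

definition pre_fibre :: "('s \<Rightarrow> 'a::cstar_algebra \<Rightarrow> 'a) \<Rightarrow> 's \<Rightarrow> 'a set" where
  "pre_fibre \<alpha> s = {rmul a (mult_extension (\<alpha> s) 1) |a. True}"

definition pre_norm :: "('s \<Rightarrow> 'a::cstar_algebra \<Rightarrow> 'a) \<Rightarrow> 's \<Rightarrow> 'a \<Rightarrow> real" where
  "pre_norm L s x = sqrt (norm (L s (star x * x)))"

text \<open>Dividing by the null vectors and completing is done in one step: \<open>M\<^sub>s\<close> consists of the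
  classes of Cauchy sequences in \<open>A\<^sub>s\<close> modulo sequences tending to \<open>0\<close> in the seminorm.\<close>

definition Cauchy_seqs ::
  "('s \<Rightarrow> 'a::cstar_algebra \<Rightarrow> 'a) \<Rightarrow> ('s \<Rightarrow> 'a \<Rightarrow> 'a) \<Rightarrow> 's \<Rightarrow> (nat \<Rightarrow> 'a) set" where
  "Cauchy_seqs \<alpha> L s = {x. (\<forall>n. x n \<in> pre_fibre \<alpha> s) \<and>
     (\<forall>e>0. \<exists>N. \<forall>m\<ge>N. \<forall>n\<ge>N. pre_norm L s (x m - x n) < e)}"

definition seq_class ::
  "('s \<Rightarrow> 'a::cstar_algebra \<Rightarrow> 'a) \<Rightarrow> ('s \<Rightarrow> 'a \<Rightarrow> 'a) \<Rightarrow> 's \<Rightarrow> (nat \<Rightarrow> 'a) \<Rightarrow> (nat \<Rightarrow> 'a) set" where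
  "seq_class \<alpha> L s x = {y \<in> Cauchy_seqs \<alpha> L s. (\<lambda>n. pre_norm L s (x n - y n)) \<longlonglongrightarrow> 0}"

definition fibre ::
  "('s \<Rightarrow> 'a::cstar_algebra \<Rightarrow> 'a) \<Rightarrow> ('s \<Rightarrow> 'a \<Rightarrow> 'a) \<Rightarrow> 's \<Rightarrow> (nat \<Rightarrow> 'a) set set" where
  "fibre \<alpha> L s = seq_class \<alpha> L s ` Cauchy_seqs \<alpha> L s"

text \<open>The canonical map \<open>A\<^sub>s \<rightarrow> M\<^sub>s\<close>. For \<open>s = 0\<close> it is the identification \<open>A = X\<^sub>0\<close>.\<close>

definition fibre_of ::
  "('s \<Rightarrow> 'a::cstar_algebra \<Rightarrow> 'a) \<Rightarrow> ('s \<Rightarrow> 'a \<Rightarrow> 'a) \<Rightarrow> 's \<Rightarrow> 'a \<Rightarrow> (nat \<Rightarrow> 'a) set" where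
  "fibre_of \<alpha> L s x = seq_class \<alpha> L s (\<lambda>_. x)"

text \<open>The operations on \<open>M\<^sub>s\<close> are the continuous extensions of those on \<open>A\<^sub>s\<close>, computed on
  representing Cauchy sequences.\<close>

definition seq_of :: "(nat \<Rightarrow> 'a) set \<Rightarrow> nat \<Rightarrow> 'a" where
  "seq_of U = (SOME x. x \<in> U)"

definition fibre_add ::
  "('s \<Rightarrow> 'a::cstar_algebra \<Rightarrow> 'a) \<Rightarrow> ('s \<Rightarrow> 'a \<Rightarrow> 'a) \<Rightarrow> 's \<Rightarrow>
     (nat \<Rightarrow> 'a) set \<Rightarrow> (nat \<Rightarrow> 'a) set \<Rightarrow> (nat \<Rightarrow> 'a) set" where
  "fibre_add \<alpha> L s U V = seq_class \<alpha> L s (\<lambda>n. seq_of U n + seq_of V n)"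

definition fibre_scale ::
  "('s \<Rightarrow> 'a::cstar_algebra \<Rightarrow> 'a) \<Rightarrow> ('s \<Rightarrow> 'a \<Rightarrow> 'a) \<Rightarrow> 's \<Rightarrow>
     complex \<Rightarrow> (nat \<Rightarrow> 'a) set \<Rightarrow> (nat \<Rightarrow> 'a) set" where
  "fibre_scale \<alpha> L s c U = seq_class \<alpha> L s (\<lambda>n. c *\<^sub>C seq_of U n)"

definition right_act ::
  "('s \<Rightarrow> 'a::cstar_algebra \<Rightarrow> 'a) \<Rightarrow> ('s \<Rightarrow> 'a \<Rightarrow> 'a) \<Rightarrow> 's \<Rightarrow>
     (nat \<Rightarrow> 'a) set \<Rightarrow> 'a \<Rightarrow> (nat \<Rightarrow> 'a) set" where
  "right_act \<alpha> L s U a = seq_class \<alpha> L s (\<lambda>n. seq_of U n * \<alpha> s a)"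

definition left_act ::
  "('s \<Rightarrow> 'a::cstar_algebra \<Rightarrow> 'a) \<Rightarrow> ('s \<Rightarrow> 'a \<Rightarrow> 'a) \<Rightarrow> 's \<Rightarrow>
     'a \<Rightarrow> (nat \<Rightarrow> 'a) set \<Rightarrow> (nat \<Rightarrow> 'a) set" where
  "left_act \<alpha> L s a U = seq_class \<alpha> L s (\<lambda>n. a * seq_of U n)"

definition fibre_inner ::
  "('s \<Rightarrow> 'a::cstar_algebra \<Rightarrow> 'a) \<Rightarrow> 's \<Rightarrow> (nat \<Rightarrow> 'a) set \<Rightarrow> (nat \<Rightarrow> 'a) set \<Rightarrow> 'a" where
  "fibre_inner L s U V = lim (\<lambda>n. L s (star (seq_of U n) * seq_of V n))"

definition product_system ::
  "('s \<Rightarrow> 'a::cstar_algebra \<Rightarrow> 'a) \<Rightarrow> ('s \<Rightarrow> 'a \<Rightarrow> 'a) \<Rightarrow> ('s \<times> (nat \<Rightarrow> 'a) set) set" where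
  "product_system \<alpha> L = (SIGMA s:UNIV. fibre \<alpha> L s)"

text \<open>On \<open>A\<^sub>s \<times> A\<^sub>t\<close> this is \<open>(s, x) (t, y) = (s + t, x \<alpha>\<^sub>s(y))\<close>; if \<open>x = a p\<close> with
  \<open>p\<close> the value of the extension of \<open>\<alpha>\<^sub>s\<close> at \<open>1\<close>, then \<open>x \<alpha>\<^sub>s(y) = a \<alpha>\<^sub>s(y)\<close>.\<close>

definition ps_mult ::
  "('s::comm_monoid_add \<Rightarrow> 'a::cstar_algebra \<Rightarrow> 'a) \<Rightarrow> ('s \<Rightarrow> 'a \<Rightarrow> 'a) \<Rightarrow>
     's \<times> (nat \<Rightarrow> 'a) set \<Rightarrow> 's \<times> (nat \<Rightarrow> 'a) set \<Rightarrow> 's \<times> (nat \<Rightarrow> 'a) set" where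
  "ps_mult \<alpha> L u v = (fst u + fst v,
     seq_class \<alpha> L (fst u + fst v) (\<lambda>n. seq_of (snd u) n * \<alpha> (fst u) (seq_of (snd v) n)))"


section \<open>Toeplitz representations and the Toeplitz algebra\<close>

definition coeff_map ::
  "('s::comm_monoid_add \<Rightarrow> 'a::cstar_algebra \<Rightarrow> 'a) \<Rightarrow> ('s \<Rightarrow> 'a \<Rightarrow> 'a) \<Rightarrow>
     ('s \<times> (nat \<Rightarrow> 'a) set \<Rightarrow> 'b) \<Rightarrow> 'a \<Rightarrow> 'b" where
  "coeff_map \<alpha> L \<psi> a = \<psi> (0, fibre_of \<alpha> L 0 a)"

definition toeplitz_rep ::
  "('s::comm_monoid_add \<Rightarrow> 'a::cstar_algebra \<Rightarrow> 'a) \<Rightarrow> ('s \<Rightarrow> 'a \<Rightarrow> 'a) \<Rightarrow>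
     ('s \<times> (nat \<Rightarrow> 'a) set \<Rightarrow> 'b::cstar_algebra) \<Rightarrow> bool" where
  "toeplitz_rep \<alpha> L \<psi> \<longleftrightarrow>
     (\<forall>u\<in>product_system \<alpha> L. \<forall>v\<in>product_system \<alpha> L. \<psi> u * \<psi> v = \<psi> (ps_mult \<alpha> L u v)) \<and>
     star_hom (coeff_map \<alpha> L \<psi>) \<and>
     (\<forall>s. \<forall>U\<in>fibre \<alpha> L s.
        (\<forall>V\<in>fibre \<alpha> L s. \<psi> (s, fibre_add \<alpha> L s U V) = \<psi> (s, U) + \<psi> (s, V)) \<and>
        (\<forall>c. \<psi> (s, fibre_scale \<alpha> L s c U) = c *\<^sub>C \<psi> (s, U)) \<and>
        (\<forall>a. \<psi> (s, right_act \<alpha> L s U a) = \<psi> (s, U) * coeff_map \<alpha> L \<psi> a) \<and>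
        (\<forall>V\<in>fibre \<alpha> L s. star (\<psi> (s, U)) * \<psi> (s, V) = coeff_map \<alpha> L \<psi> (fibre_inner L s U V)) \<and>
        (\<forall>a. \<psi> (s, left_act \<alpha> L s a U) = coeff_map \<alpha> L \<psi> a * \<psi> (s, U)))"

text \<open>The type argument is the C*-algebra \<open>'b\<close> in which the universal property is tested, since a
  formula cannot quantify over types. The Toeplitz algebra satisfies the predicate for every
  \<open>'b\<close>; assuming it for one \<open>'b\<close> only is the weaker hypothesis.\<close>

definition toeplitz_algebra ::
  "'b::cstar_algebra itself \<Rightarrow> ('s::comm_monoid_add \<Rightarrow> 'a::cstar_algebra \<Rightarrow> 'a) \<Rightarrow> ('s \<Rightarrow> 'a \<Rightarrow> 'a) \<Rightarrow>
     ('s \<times> (nat \<Rightarrow> 'a) set \<Rightarrow> 't::cstar_algebra) \<Rightarrow> bool" where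
  "toeplitz_algebra _ \<alpha> L i \<longleftrightarrow>
     toeplitz_rep \<alpha> L i \<and>
     (\<forall>s. \<forall>U\<in>fibre \<alpha> L s. norm (i (s, U)) = sqrt (norm (fibre_inner L s U U))) \<and>
     cstar_generated (i ` product_system \<alpha> L) = UNIV \<and>
     (\<forall>\<psi> :: 's \<times> (nat \<Rightarrow> 'a) set \<Rightarrow> 'b. toeplitz_rep \<alpha> L \<psi> \<longrightarrow>
        (\<exists>\<rho>. star_hom \<rho> \<and> (\<forall>u\<in>product_system \<alpha> L. \<rho> (i u) = \<psi> u)))"


section \<open>Toeplitz crossed products\<close>

definition semigroup_rep :: "('s::comm_monoid_add \<Rightarrow> 'b::monoid_mult) \<Rightarrow> bool" where
  "semigroup_rep V \<longleftrightarrow> V 0 = 1 \<and> (\<forall>s t. V (s + t) = V s * V t)"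

definition toeplitz_covariant ::
  "('s::comm_monoid_add \<Rightarrow> 'a::cstar_algebra \<Rightarrow> 'a) \<Rightarrow> ('s \<Rightarrow> 'a \<Rightarrow> 'a) \<Rightarrow>
     ('a \<Rightarrow> 'h::chilbert_space bop) \<Rightarrow> ('s \<Rightarrow> 'h bop) \<Rightarrow> bool" where
  "toeplitz_covariant \<alpha> L \<pi> V \<longleftrightarrow> nondegenerate_rep \<pi> \<and> semigroup_rep V \<and>
     (\<forall>s a. V s * \<pi> a = \<pi> (\<alpha> s a) * V s) \<and>
     (\<forall>s a. star (V s) * \<pi> a * V s = \<pi> (L s a))"

text \<open>The type argument is the Hilbert space of the representations in the two universal
  conditions. A theorem concluding this predicate for a type variable \<open>'h\<close> covers all of them.\<close>

definition toeplitz_crossed_product ::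
  "'h::chilbert_space itself \<Rightarrow> ('s::comm_monoid_add \<Rightarrow> 'a::cstar_algebra \<Rightarrow> 'a) \<Rightarrow> ('s \<Rightarrow> 'a \<Rightarrow> 'a) \<Rightarrow>
     ('a \<Rightarrow> 'b::cstar_algebra) \<Rightarrow> ('s \<Rightarrow> 'b multiplier) \<Rightarrow> bool" where
  "toeplitz_crossed_product _ \<alpha> L iA iS \<longleftrightarrow>
     nondegenerate_hom iA \<and> semigroup_rep iS \<and>
     (\<forall>\<sigma> :: 'b \<Rightarrow> 'h bop. nondegenerate_rep \<sigma> \<longrightarrow>
        toeplitz_covariant \<alpha> L (\<sigma> \<circ> iA) (rep_extension \<sigma> \<circ> iS)) \<and>
     (\<forall>(\<pi> :: 'a \<Rightarrow> 'h bop) V. toeplitz_covariant \<alpha> L \<pi> V \<longrightarrow>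
        (\<exists>\<rho>. star_hom \<rho> \<and> \<rho> \<circ> iA = \<pi> \<and> rep_extension \<rho> \<circ> iS = V)) \<and>
     cstar_generated {rmul (iA a) (iS s) |a s. True} = UNIV"

end

(* The algebraic heart is that M_s carries a genuine norm. This needs the Cauchy-Schwarz
   inequality for <x, y> = L_s(x^* y), which follows from the module property of L_s once it is known
   that |a^* a| <= |a^* a + b^* b| in every C*-algebra. The latter, and the fact that *-homomorphisms
   are contractive, only use square roots, obtained by iteration.

   Write E_s(x) = i_X(s, x) for x in A_s and p_s for the value at 1 of the extension of alpha_s. Then
   E_s(alpha_s(u)) E_0(b) = E_s(alpha_s(u b)) and E_0(b) E_s(alpha_s(u)) = E_s(b alpha_s(u)), and
   alpha_s(u) tends strictly to p_s; since i_A = E_0 maps approximate units to approximate units of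
   T_X, the strict limit i_S(s) exists and is determined by i_S(s) i_A(b) = E_s(alpha_s(b)) and
   i_A(b) i_S(s) = E_s(b p_s). These two formulas give the semigroup law, covariance and
   generation. Conversely a covariant representation (pi, V) induces the Toeplitz representation
   sending the class of (x_n) in M_s to lim pi(x_n) V_s, and T_X is universal for those. *)

theory Submission
  imports Defs
begin

section \<open>Positivity in C*-algebras\<close>

text \<open>The inequality |a^* a| <= |a^* a + b^* b| is enough because positivity of L_s always
  supplies a remainder of the form v^* v, and the inequality allows it to be dropped; no order on A
  has to be introduced. Its proof rests on x^* x being the square of a self-adjoint element, which
  is the hard point and is settled in \<open>cpos_star_mult\<close>. All limits along the net rest
  on one principle: the points at which an eventually bounded net of operators converges form a
  closed set. Two things make these limits delicate. The multiplier p_s is characterised through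
  some approximate unit, not necessarily the given one, and \<open>tendsto_p\<close> bridges the
  gap. The given unit need be neither self-adjoint nor monotone, so its adjoint net is carried along
  when i_A is shown to preserve approximate units. Commutativity of S enters through L_{s+t} = L_t
  L_s: in the norm of x alpha_s(y) the factor alpha_s(y) has to be freed by L_s before L_t is
  applied.\<close>

lemma star_hom_simps:
  assumes "star_hom f"
  shows "f (x + y) = f x + f y" "f (c *\<^sub>C x) = c *\<^sub>C f x" "f (x * y) = f x * f y" "f (star x) = star (f x)"
  using assms unfolding star_hom_def clinear_map_def by blast+

lemma clinear_map_linear:
  assumes "clinear_map f"
  shows "linear f"
  using assms unfolding clinear_map_def by (intro linearI) (auto simp: scaleR_scaleC)

lemma star_hom_linear: "star_hom f \<Longrightarrow> linear f"
  by (simp add: star_hom_def clinear_map_linear)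

lemma scaleC_minus_left: "(- c) *\<^sub>C x = - (c *\<^sub>C (x::'a::cnormed_space))"
  using scaleC_add_left[of c "- c" x] by (simp add: eq_neg_iff_add_eq_0 add.commute)

text \<open>The element \<open>p + \<i> *\<^sub>C q\<close> is normal, so the C*-identity turns its
  norm into that of \<open>p * p + q * q\<close>. Reading off real and imaginary parts with the help
  of the adjoint then replaces functional calculus for commuting elements.\<close>

lemma norm_add_ii_square:
  fixes p q :: "'a::cstar_algebra"
  assumes "star p = p" "star q = q" "p * q = q * p"
  shows "(norm (p + \<i> *\<^sub>C q))\<^sup>2 = norm (p * p + q * q)"
    and "star (p + \<i> *\<^sub>C q) = p - \<i> *\<^sub>C q"
proof -
  show sz: "star (p + \<i> *\<^sub>C q) = p - \<i> *\<^sub>C q"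
    by (simp add: star_add star_scaleC assms scaleC_minus_left)
  have "star (p + \<i> *\<^sub>C q) * (p + \<i> *\<^sub>C q) = p * p + q * q"
    unfolding sz by (simp add: algebra_simps mult_scaleC_left mult_scaleC_right scaleC_scaleC
        scaleC_minus_left scaleC_diff_right assms)
  then show "(norm (p + \<i> *\<^sub>C q))\<^sup>2 = norm (p * p + q * q)"
    using cstar_identity by metis
qed

lemma star_one [simp]: "star 1 = (1::'u::{cstar_algebra,monoid_mult})"
  by (metis mult_1_right star_mult star_star)

text \<open>Only an inequality: in the zero algebra, which is the multiplier algebra of 0, the unit
  has norm 0.\<close>

lemma norm_one_le: "norm (1::'u::{cstar_algebra,monoid_mult}) \<le> 1"
proof -
  have "norm (1::'u) * norm (1::'u) = norm (1::'u)"
    using cstar_identity[of "1::'u"] by (simp add: power2_eq_square)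
  then show ?thesis by (cases "norm (1::'u) = 0") auto
qed

section \<open>Square roots by iteration\<close>

lemma norm_self_adjoint_square: "star s = s \<Longrightarrow> norm (s * s) = (norm (s::'a::cstar_algebra))\<^sup>2"
  using cstar_identity[of s] by simp

text \<open>The solution \<open>y = 1 - (1 - k)\<^bsup>1/2\<^esup>\<close> of \<open>2y = k + y\<^sup>2\<close>. The iteration is dominated by the
  same iteration for the scalar \<open>\<parallel>k\<parallel> \<le> 1\<close>, which increases and is bounded by \<open>1\<close>.\<close>

lemma sqrt_iteration:
  fixes k :: "'a::cstar_algebra"
  assumes sa: "star k = k" and k1: "norm k \<le> 1"
  obtains y where "star y = y" "norm y \<le> 1" "2 *\<^sub>R y = k + y * y" "\<And>c. c * k = k * c \<Longrightarrow> c * y = y * c"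
proof -
  define y where "y = rec_nat 0 (\<lambda>_ z. (1/2) *\<^sub>R (k + z * z))"
  define Y where "Y = rec_nat 0 (\<lambda>_ z. (norm k + z\<^sup>2) / 2)"
  have y0: "y 0 = 0" and yS: "y (Suc n) = (1/2) *\<^sub>R (k + y n * y n)" for n by (simp_all add: y_def)
  have Y0: "Y 0 = 0" and YS: "Y (Suc n) = (norm k + (Y n)\<^sup>2) / 2" for n by (simp_all add: Y_def)
  have Yb: "0 \<le> Y n \<and> Y n \<le> 1" for n
  proof (induction n)
    case (Suc n)
    then have "(Y n)\<^sup>2 \<le> 1" by (simp add: power_le_one)
    with k1 show ?case by (simp add: YS)
  qed (simp add: Y0)
  have yY: "norm (y n) \<le> Y n" for n
  proof (induction n)
    case (Suc n)
    have "norm (k + y n * y n) \<le> norm k + norm (y n) * norm (y n)"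
      by (meson norm_triangle_mono norm_mult_ineq order_refl)
    also have "\<dots> \<le> norm k + Y n * Y n" using Suc by (simp add: mult_mono Yb)
    finally show ?case by (simp add: yS YS power2_eq_square)
  qed (simp add: y0 Y0)
  have step: "norm (y (Suc n) - y n) \<le> Y (Suc n) - Y n" for n
  proof (induction n)
    case 0
    show ?case by (simp add: yS YS y0 Y0)
  next
    case (Suc n)
    let ?d = "y (Suc n) - y n"
    \<comment> \<open>A difference of squares is split as \<open>(a - b) * a + b * (a - b)\<close>,
      which needs no commutativity. The scalar increments obey the same recursion.\<close>
    have "y (Suc (Suc n)) - y (Suc n) = (1/2) *\<^sub>R (?d * y (Suc n) + y n * ?d)"
      unfolding yS[of "Suc n"] yS[of n, symmetric]
      by (subst (2) yS) (simp add: algebra_simps flip: scaleR_diff_right)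
    also have "norm \<dots> \<le> (1/2) * (norm ?d * norm (y (Suc n)) + norm (y n) * norm ?d)"
      by (simp, meson norm_triangle_mono norm_mult_ineq)
    also have "\<dots> \<le> (1/2) * ((Y (Suc n) - Y n) * Y (Suc n) + Y n * (Y (Suc n) - Y n))"
      using Suc yY[of n] yY[of "Suc n"] Yb[of n] Yb[of "Suc n"] order_trans[OF norm_ge_zero Suc]
      by (intro mult_left_mono add_mono mult_mono) auto
    also have "\<dots> = ((Y (Suc n))\<^sup>2 - (Y n)\<^sup>2) / 2"
      by (simp add: power2_eq_square field_simps)
    also have "\<dots> = Y (Suc (Suc n)) - Y (Suc n)"
    proof -
      have "(Y n)\<^sup>2 = 2 * Y (Suc n) - norm k" by (simp add: YS field_simps)
      then show ?thesis by (simp only: YS[of "Suc n"]) (simp add: field_simps)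
    qed
    finally show ?case .
  qed
  have diff: "norm (y (n + m) - y n) \<le> Y (n + m) - Y n" for m n
  proof (induction m)
    case (Suc m)
    have "norm (y (n + Suc m) - y n) \<le> norm (y (Suc (n + m)) - y (n + m)) + norm (y (n + m) - y n)"
      using norm_triangle_ineq[of "y (Suc (n + m)) - y (n + m)" "y (n + m) - y n"] by simp
    with Suc step[of "n + m"] show ?case by simp
  qed simp
  \<comment> \<open>Monotonicity of the scalar iteration comes for free: by \<open>step\<close> its
    increments dominate norms.\<close>
  have "Y n \<le> Y (Suc n)" for n
    using order_trans[OF norm_ge_zero step[of n]] by simp
  then have "incseq Y" by (rule incseq_SucI)
  then obtain l where "Y \<longlonglongrightarrow> l"
    using Yb by (blast intro: incseq_convergent[of Y 1])
  then have "Cauchy Y" by (rule LIMSEQ_imp_Cauchy)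
  have "Cauchy y"
  proof (rule CauchyI')
    fix e :: real assume "0 < e"
    with \<open>Cauchy Y\<close> obtain M where M: "\<And>m n. m \<ge> M \<Longrightarrow> n \<ge> M \<Longrightarrow> norm (Y m - Y n) < e"
      using CauchyD by blast
    have "dist (y m) (y n) < e" if "m \<ge> M" "n > m" for m n
      using diff[of m "n - m"] M[of n m] that by (simp add: dist_norm norm_minus_commute)
    then show "\<exists>M. \<forall>m\<ge>M. \<forall>n>m. dist (y m) (y n) < e" by blast
  qed
  then obtain z where z: "y \<longlonglongrightarrow> z" using Cauchy_convergent convergent_def by blast
  show thesis
  proof (rule that)
    have sy: "star (y n) = y n" for n
      by (induction n) (simp_all add: y0 yS star_scaleR star_add star_mult sa)
    have "(\<lambda>n. star (y n)) \<longlonglongrightarrow> star z" by (rule bounded_linear.tendsto[OF bounded_linear_star z])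
    then show "star z = z" unfolding sy using z LIMSEQ_unique by blast
    show "norm z \<le> 1"
      by (rule LIMSEQ_le_const2[OF tendsto_norm[OF z]]) (use yY Yb order_trans in blast)
    have "(\<lambda>n. (1/2) *\<^sub>R (k + y n * y n)) \<longlonglongrightarrow> (1/2) *\<^sub>R (k + z * z)"
      by (intro tendsto_intros z)
    moreover have "(\<lambda>n. (1/2) *\<^sub>R (k + y n * y n)) \<longlonglongrightarrow> z"
      using LIMSEQ_Suc[OF z] by (simp add: yS)
    ultimately have "z = (1/2) *\<^sub>R (k + z * z)" using LIMSEQ_unique by blast
    then have "2 *\<^sub>R z = 2 *\<^sub>R (1/2) *\<^sub>R (k + z * z)" by simp
    then show "2 *\<^sub>R z = k + z * z" by simp
    show "c * z = z * c" if c: "c * k = k * c" for c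
    proof -
      have cy: "c * y n = y n * c" for n
      proof (induction n)
        case (Suc n)
        then have "c * (y n * y n) = y n * y n * c" by (metis mult.assoc)
        with c show ?case by (simp add: yS distrib_left distrib_right)
      qed (simp add: y0)
      have "(\<lambda>n. c * y n) \<longlonglongrightarrow> c * z" "(\<lambda>n. y n * c) \<longlonglongrightarrow> z * c"
        by (intro tendsto_intros z)+
      then show ?thesis unfolding cy using LIMSEQ_unique by blast
    qed
  qed
qed

text \<open>Positivity is phrased through norms, so that no spectral theory is needed; by
  \<open>cpos_sqrt\<close> and \<open>cpos_square\<close> the positive elements are the squares of self-adjoint ones.\<close>

definition cpos :: "'u::{cstar_algebra,monoid_mult} \<Rightarrow> bool" where
  "cpos h \<longleftrightarrow> star h = h \<and> (\<exists>t>0. norm (t *\<^sub>R 1 - h) \<le> t)"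

text \<open>The bound on \<open>1 - s\<close> says that \<open>s\<close> is positive and not merely
  a self-adjoint root; it is what makes the absolute value in \<open>cpos_star_mult\<close> satisfy
  \<open>cpos\<close>.\<close>

lemma sqrt_one_minus:
  fixes k :: "'u::{cstar_algebra,monoid_mult}"
  assumes "star k = k" "norm k \<le> 1"
  obtains s where "star s = s" "s * s = 1 - k" "\<And>c. c * k = k * c \<Longrightarrow> c * s = s * c" "norm (1 - s) \<le> 1"
proof -
  obtain y where y: "star y = y" "norm y \<le> 1" "2 *\<^sub>R y = k + y * y" "\<And>c. c * k = k * c \<Longrightarrow> c * y = y * c"
    using sqrt_iteration[OF assms] by blast
  show thesis
  proof (rule that[of "1 - y"])
    show "(1 - y) * (1 - y) = 1 - k"
      using y(3) by (simp add: algebra_simps scaleR_2)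
    show "c * (1 - y) = (1 - y) * c" if "c * k = k * c" for c
      using y(4)[OF that] by (simp add: right_diff_distrib left_diff_distrib)
  qed (simp_all add: star_diff y(1,2))
qed

text \<open>If \<open>t\<close> is a witness for \<open>cpos h\<close>, then h/t = 1 - k for a
  contraction k. The commutation clause is kept because \<open>norm_square_le_commuting\<close>
  compares only commuting elements.\<close>

lemma cpos_sqrt:
  assumes "cpos h"
  obtains s where "star s = s" "s * s = h" "\<And>c. c * h = h * c \<Longrightarrow> c * s = s * c"
proof -
  obtain t where t: "0 < t" "norm (t *\<^sub>R 1 - h) \<le> t" and sa: "star h = h"
    using assms unfolding cpos_def by blast
  define k where "k = 1 - (1/t) *\<^sub>R h"
  have "k = (1/t) *\<^sub>R (t *\<^sub>R 1 - h)" using t by (simp add: k_def scaleR_diff_right)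
  then have "norm k \<le> 1" using t by simp
  moreover have "star k = k" by (simp add: k_def star_diff star_scaleR sa)
  ultimately obtain s where s: "star s = s" "s * s = 1 - k" "\<And>c. c * k = k * c \<Longrightarrow> c * s = s * c"
    using sqrt_one_minus by metis
  show thesis
  proof (rule that[of "sqrt t *\<^sub>R s"])
    show "sqrt t *\<^sub>R s * sqrt t *\<^sub>R s = h" using t s(2) by (simp add: k_def)
    show "c * sqrt t *\<^sub>R s = sqrt t *\<^sub>R s * c" if "c * h = h * c" for c
      using s(3)[of c] that by (simp add: k_def algebra_simps)
  qed (simp add: star_scaleR s)
qed

text \<open>For a self-adjoint contraction \<open>h\<close>, the element \<open>h + i (1 - h\<^sup>2)\<^bsup>1/2\<^esup>\<close> is unitary.\<close>

lemma norm_one_minus_square: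
  fixes h :: "'u::{cstar_algebra,monoid_mult}"
  assumes sa: "star h = h" and "norm h \<le> 1"
  shows "norm (1 - h * h) \<le> 1"
proof -
  have "norm (h * h) \<le> 1" using assms by (simp add: norm_self_adjoint_square power_le_one)
  moreover have "star (h * h) = h * h" by (simp add: star_mult sa)
  ultimately obtain s where s: "star s = s" "s * s = 1 - h * h" "\<And>c. c * (h * h) = h * h * c \<Longrightarrow> c * s = s * c"
    using sqrt_one_minus by metis
  have hs: "h * s = s * h" by (rule s(3)) (simp add: mult.assoc)
  let ?u = "h + \<i> *\<^sub>C s"
  have "(norm ?u)\<^sup>2 \<le> 1"
    using norm_one_le[where 'u='u] by (simp add: norm_add_ii_square(1)[OF sa s(1) hs] s(2))
  then have nu: "norm ?u \<le> 1" using power2_le_imp_le[of "norm ?u" 1] by simp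
  \<comment> \<open>\<open>s\<close> is the imaginary part of \<open>?u\<close>, so its norm is at
    most the mean of the norms of \<open>?u\<close> and its adjoint.\<close>
  have "?u - star ?u = (2 * \<i>) *\<^sub>C s"
    using scaleC_add_left[of \<i> \<i> s] by (simp add: norm_add_ii_square(2)[OF sa s(1) hs])
  then have "2 * norm s = norm (?u - star ?u)" by (simp add: norm_scaleC norm_mult)
  also have "\<dots> \<le> 2" using norm_triangle_ineq4[of ?u "star ?u"] nu by simp
  finally have "norm s \<le> 1" by simp
  then show ?thesis unfolding s(2)[symmetric]
    using s(1) by (simp add: norm_self_adjoint_square power_le_one)
qed

lemma norm_minus_square_le:
  fixes s :: "'u::{cstar_algebra,monoid_mult}"
  assumes sa: "star s = s" and "(norm s)\<^sup>2 \<le> t" "0 < t"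
  shows "norm (t *\<^sub>R 1 - s * s) \<le> t"
proof -
  let ?h = "(1 / sqrt t) *\<^sub>R s"
  have "norm s \<le> sqrt t" using assms(2) by (simp add: real_le_rsqrt)
  then have "norm (1 - ?h * ?h) \<le> 1"
    using assms by (intro norm_one_minus_square) (simp_all add: star_scaleR)
  moreover have "t *\<^sub>R 1 - s * s = t *\<^sub>R (1 - ?h * ?h)"
    using assms(3) by (simp add: scaleR_diff_right real_sqrt_mult_self)
  ultimately show ?thesis using assms(3) by simp
qed

text \<open>The summand 1 in the witness keeps it positive when \<open>s\<close> is 0.\<close>

lemma cpos_square: "star s = s \<Longrightarrow> cpos (s * s)"
  unfolding cpos_def
  by (auto simp: star_mult intro!: exI[of _ "(norm s)\<^sup>2 + 1"] norm_minus_square_le add_nonneg_pos)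

text \<open>Here the norm formulation pays off: witnesses add by the triangle inequality, whereas a
  sum of squares is not visibly a square.\<close>

lemma cpos_add:
  assumes "cpos h" "cpos k"
  shows "cpos (h + k)"
proof -
  obtain t r where "0 < t" "norm (t *\<^sub>R 1 - h) \<le> t" "0 < r" "norm (r *\<^sub>R 1 - k) \<le> r"
    using assms unfolding cpos_def by blast
  moreover have eq: "(t + r) *\<^sub>R 1 - (h + k) = (t *\<^sub>R 1 - h) + (r *\<^sub>R 1 - k)"
    by (simp add: algebra_simps)
  ultimately have "0 < t + r \<and> norm ((t + r) *\<^sub>R 1 - (h + k)) \<le> t + r"
    unfolding eq by (simp add: norm_triangle_mono)
  moreover have "star (h + k) = h + k" using assms by (simp add: cpos_def star_add)
  ultimately show ?thesis unfolding cpos_def by blast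
qed

lemma cpos_scalar_minus:
  assumes "star h = h" "norm h \<le> c"
  shows "cpos (c *\<^sub>R 1 - h)"
proof -
  \<comment> \<open>The witness \<open>c + 1\<close> cancels the scalar part and leaves
    \<open>1 + h\<close>; it is positive even if \<open>c\<close> is 0.\<close>
  have "norm ((c + 1) *\<^sub>R 1 - (c *\<^sub>R 1 - h)) \<le> c + 1"
  proof -
    have eq: "(c + 1) *\<^sub>R 1 - (c *\<^sub>R 1 - h) = 1 + h" by (simp add: algebra_simps)
    show ?thesis unfolding eq
      using norm_triangle_ineq[of 1 h] assms norm_one_le[where 'u='a] by simp
  qed
  moreover have "0 < c + 1" using assms(2) norm_ge_zero[of h] by linarith
  ultimately show ?thesis using assms unfolding cpos_def by (auto simp: star_diff star_scaleR)
qed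

text \<open>Commuting squares are compared through the normal element \<open>p + i q\<close>.\<close>

lemma norm_square_le_commuting:
  fixes p q :: "'a::cstar_algebra"
  assumes "star p = p" "star q = q" "p * q = q * p"
  shows "norm (p * p) \<le> norm (p * p + q * q)"
proof -
  let ?z = "p + \<i> *\<^sub>C q"
  have "?z + star ?z = 2 *\<^sub>R p" by (simp add: norm_add_ii_square(2)[OF assms] scaleR_2)
  then have "2 * norm p \<le> norm ?z + norm (star ?z)"
    by (metis abs_numeral norm_scaleR norm_triangle_ineq)
  then show ?thesis unfolding norm_add_ii_square(1)[OF assms, symmetric] norm_self_adjoint_square[OF assms(1)] by (simp add: power_mono)
qed


text \<open>Kelley-Vaught without spectra. Let \<open>h = x\<^sup>* x\<close>, \<open>p = \<bar>h\<bar>\<close> and \<open>n = p - h\<close>, twice the negative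
  part. Then \<open>y = x n\<close> satisfies \<open>y\<^sup>* y = - w\<^sup>2\<close> with \<open>w = p\<^bsup>1/2\<^esup> n\<close>, and \<open>y y\<^sup>* = v\<^sup>2\<close> is positive
  because \<open>y\<^sup>* y + y y\<^sup>*\<close> is a sum of squares. With \<open>c = \<parallel>y\<parallel>\<^sup>2\<close>, the element
  \<open>y (c - w\<^sup>2) y\<^sup>* = c v\<^sup>2 + v\<^sup>4 \<ge> 2 v\<^sup>4\<close> has norm at least \<open>2 c\<^sup>2\<close> and at most \<open>c\<^sup>2\<close>, so \<open>y = 0\<close>.\<close>

lemma cpos_star_mult:
  fixes x :: "'u::{cstar_algebra,monoid_mult}"
  shows "cpos (star x * x)"
proof -
  define h where "h = star x * x"
  have sah: "star h = h" by (simp add: h_def star_mult star_star)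
  obtain p where p: "star p = p" "p * p = h * h" "\<And>c. c * (h * h) = h * h * c \<Longrightarrow> c * p = p * c" and pp: "cpos p"
  proof (cases "h = 0")
    case True
    show thesis
      by (rule that[of 0]) (use True cpos_square[of "0::'u"] in auto)
  next
    case False
    define t where "t = norm h"
    have t: "0 < t" using False by (simp add: t_def)
    define k where "k = 1 - (1 / t\<^sup>2) *\<^sub>R (h * h)"
    have k': "k = (1 / t\<^sup>2) *\<^sub>R (t\<^sup>2 *\<^sub>R 1 - h * h)" using t by (simp add: k_def scaleR_diff_right)
    have "norm (t\<^sup>2 *\<^sub>R 1 - h * h) \<le> t\<^sup>2" using t by (intro norm_minus_square_le sah) (simp_all add: t_def)
    then have "norm k \<le> 1" using t unfolding k' by simp
    moreover have "star k = k" by (simp add: k_def star_diff star_scaleR star_mult sah)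
    ultimately obtain s where s: "star s = s" "s * s = 1 - k" "\<And>c. c * k = k * c \<Longrightarrow> c * s = s * c" "norm (1 - s) \<le> 1"
      using sqrt_one_minus by metis
    show thesis
    proof (rule that[of "t *\<^sub>R s"])
      show "t *\<^sub>R s * t *\<^sub>R s = h * h" using t s(2) by (simp add: k_def power2_eq_square)
      show "c * t *\<^sub>R s = t *\<^sub>R s * c" if "c * (h * h) = h * h * c" for c
        using s(3)[of c] that by (simp add: k_def right_diff_distrib left_diff_distrib)
      have "t *\<^sub>R 1 - t *\<^sub>R s = t *\<^sub>R (1 - s)" by (simp add: scaleR_diff_right)
      then have "norm (t *\<^sub>R 1 - t *\<^sub>R s) \<le> t" using t s(4) by simp
      then show "cpos (t *\<^sub>R s)" using t s(1) unfolding cpos_def by (auto simp: star_scaleR)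
    qed (simp add: star_scaleR s(1))
  qed
  have hp: "h * p = p * h" by (rule p(3)) (simp add: mult.assoc)
  obtain r where r: "star r = r" "r * r = p" "\<And>c. c * p = p * c \<Longrightarrow> c * r = r * c"
    using cpos_sqrt[OF pp] by metis
  have hr: "h * r = r * h" by (rule r(3)[OF hp])
  have rp: "r * p = p * r" unfolding r(2)[symmetric] by (simp add: mult.assoc)
  define n where "n = p - h"
  have san: "star n = n" by (simp add: n_def star_diff p sah)
  have nr: "n * r = r * n" unfolding n_def by (simp add: algebra_simps hr rp)
  have np: "n * p = p * n" unfolding n_def by (simp add: algebra_simps hp)
  have "(p + h) * n = 0"
    unfolding n_def by (simp add: algebra_simps p hp)
  then have hn: "h * n = - (p * n)" by (simp add: distrib_right eq_neg_iff_add_eq_0 add.commute)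
  define w where "w = r * n"
  have saw: "star w = w" by (simp add: w_def star_mult san r nr)
  define y where "y = x * n"
  have yy: "star y * y = - (w * w)"
  proof -
    have "star y * y = n * (h * n)" by (simp add: y_def h_def star_mult san mult.assoc)
    also have "\<dots> = - (n * (p * n))" by (simp add: hn)
    also have "n * (p * n) = w * w"
      unfolding w_def r(2)[symmetric] by (metis mult.assoc nr)
    finally show ?thesis .
  qed
  \<comment> \<open>Up to the factors 2 and -2 these are the real and imaginary parts of
    \<open>y\<close>, so \<open>a * a + b * b\<close> is twice the sum of \<open>y * star y\<close>
    and \<open>star y * y\<close>. The second term is \<open>- (w * w)\<close>, and moving it to the
    other side exhibits \<open>y * star y\<close> as a sum of squares.\<close>
  define a where "a = y + star y"
  define b where "b = \<i> *\<^sub>C (y - star y)"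
  have saa: "star a = a" by (simp add: a_def star_add star_star add.commute)
  have sab: "star b = b" by (simp add: b_def star_scaleC star_diff star_star scaleC_minus_left scaleC_diff_right)
  have "a * a + b * b = 2 *\<^sub>R (y * star y) + 2 *\<^sub>R (star y * y)"
    by (simp add: a_def b_def algebra_simps mult_scaleC_left mult_scaleC_right scaleC_scaleC
        scaleC_minus_left scaleC_diff_right scaleR_2)
  then have "2 *\<^sub>R (y * star y) = (a * a + b * b) + (w * w + w * w)"
    by (simp add: yy scaleR_2)
  moreover have "cpos ((a * a + b * b) + (w * w + w * w))"
    by (intro cpos_add cpos_square saa sab saw)
  ultimately obtain v' where v': "star v' = v'" "v' * v' = 2 *\<^sub>R (y * star y)"
    using cpos_sqrt by metis
  define v where "v = (1 / sqrt 2) *\<^sub>R v'"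
  have sav: "star v = v" by (simp add: v_def star_scaleR v')
  have vv: "v * v = y * star y" by (simp add: v_def v'(2))
  define c where "c = (norm y)\<^sup>2"
  have nv: "norm (v * v) = c" using cstar_identity[of "star y"] by (simp add: vv star_star c_def)
  have nw: "(norm w)\<^sup>2 = c"
    using cstar_identity[of y] by (simp add: yy c_def norm_self_adjoint_square[OF saw])
  have "c = 0"
  proof (rule ccontr)
    assume "c \<noteq> 0"
    then have c: "0 < c" by (simp add: c_def)
    have "cpos (c *\<^sub>R 1 - v * v)"
      by (rule cpos_scalar_minus) (simp_all add: star_mult sav nv)
    then obtain q where q: "star q = q" "q * q = c *\<^sub>R 1 - v * v"
      "\<And>d. d * (c *\<^sub>R 1 - v * v) = (c *\<^sub>R 1 - v * v) * d \<Longrightarrow> d * q = q * d"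
      using cpos_sqrt by metis
    have vq: "v * q = q * v" by (rule q(3)) (simp add: algebra_simps)
    have "y * (c *\<^sub>R 1 - w * w) * star y = c *\<^sub>R (v * v) + (v * v) * (v * v)"
    proof -
      have "y * (c *\<^sub>R 1 - w * w) * star y = y * (c *\<^sub>R 1 + star y * y) * star y"
        by (simp add: yy)
      also have "\<dots> = c *\<^sub>R (y * star y) + (y * star y) * (y * star y)"
        by (simp add: algebra_simps)
      finally show ?thesis by (simp add: vv)
    qed
    \<comment> \<open>The excess over twice the fourth power of \<open>v\<close> is the square of
      \<open>v * q\<close>. It commutes with \<open>v * v\<close>, so dropping it cannot increase
      the norm.\<close>
    also have "\<dots> = 2 *\<^sub>R ((v * v) * (v * v)) + v * (q * q) * v"
      unfolding q(2) by (simp add: algebra_simps scaleR_2)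
    also have "\<dots> = (sqrt 2 *\<^sub>R (v * v)) * (sqrt 2 *\<^sub>R (v * v)) + (v * q) * (v * q)"
      by (simp add: mult.assoc, metis mult.assoc vq)
    finally have eq: "y * (c *\<^sub>R 1 - w * w) * star y =
      (sqrt 2 *\<^sub>R (v * v)) * (sqrt 2 *\<^sub>R (v * v)) + (v * q) * (v * q)" .
    have "2 * c\<^sup>2 = norm ((sqrt 2 *\<^sub>R (v * v)) * (sqrt 2 *\<^sub>R (v * v)))"
      using norm_self_adjoint_square[of "v * v"] by (simp add: star_mult sav nv)
    also have "\<dots> \<le> norm (y * (c *\<^sub>R 1 - w * w) * star y)"
      unfolding eq
    proof (rule norm_square_le_commuting)
      have "v * v * (v * q) = v * q * (v * v)" by (metis mult.assoc vq)
      then show "(sqrt 2 *\<^sub>R (v * v)) * (v * q) = v * q * (sqrt 2 *\<^sub>R (v * v))" by simp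
    qed (simp_all add: star_scaleR star_mult sav q vq)
    also have "\<dots> \<le> norm y * norm (c *\<^sub>R 1 - w * w) * norm y"
      using norm_mult_ineq[of "y * (c *\<^sub>R 1 - w * w)" "star y"] norm_mult_ineq[of y "c *\<^sub>R 1 - w * w"]
      by (simp, meson mult_right_mono norm_ge_zero order_trans)
    also have "\<dots> \<le> norm y * c * norm y"
      by (intro mult_left_mono mult_right_mono norm_minus_square_le saw) (simp_all add: nw c)
    also have "\<dots> = c\<^sup>2" by (simp add: c_def power2_eq_square)
    finally show False using c by simp
  qed
  then have w0: "w = 0" using nw by simp
  \<comment> \<open>Since \<open>h * n = - (p * n)\<close>, the square of \<open>n\<close> is twice
    \<open>p * n\<close>, and \<open>p * n = r * w\<close> vanishes with \<open>w\<close>.\<close>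
  have "n * n * (n * n) = 0"
  proof -
    have "n * n = 2 *\<^sub>R (p * n)"
    proof -
      have "n * n = p * n - h * n" unfolding left_diff_distrib[symmetric] by (simp only: n_def)
      then show ?thesis by (simp add: hn scaleR_2)
    qed
    also have "p * n = r * w" unfolding w_def r(2)[symmetric] by (simp add: mult.assoc)
    finally show ?thesis by (simp add: w0)
  qed
  then have "n = 0"
    using norm_self_adjoint_square[of "n * n"] norm_self_adjoint_square[of n] by (simp add: star_mult san)
  then have "h = p" by (simp add: n_def)
  then show ?thesis using pp by (simp add: h_def)
qed

text \<open>\<open>h\<close> and \<open>k\<close> need not commute. With
  \<open>?c = norm (h + k)\<close>, the element \<open>?c - h\<close> is the sum of the positive
  elements \<open>?c - (h + k)\<close> and \<open>k\<close>; its root commutes with that of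
  \<open>h\<close>, and the two squares add up to the scalar \<open>?c\<close>. This reduces the
  claim to the commuting case.\<close>

lemma norm_le_norm_add_cpos:
  assumes "cpos h" "cpos k"
  shows "norm h \<le> norm (h + k)"
proof -
  let ?c = "norm (h + k)"
  have "cpos ((?c *\<^sub>R 1 - (h + k)) + k)"
    using assms by (intro cpos_add cpos_scalar_minus) (auto simp: cpos_def star_add)
  then have "cpos (?c *\<^sub>R 1 - h)" by simp
  then obtain q where q: "star q = q" "q * q = ?c *\<^sub>R 1 - h"
      "\<And>d. d * (?c *\<^sub>R 1 - h) = (?c *\<^sub>R 1 - h) * d \<Longrightarrow> d * q = q * d"
    using cpos_sqrt by metis
  obtain p where p: "star p = p" "p * p = h" using cpos_sqrt[OF assms(1)] by metis
  have "p * q = q * p" by (rule q(3)) (simp add: p(2)[symmetric] algebra_simps)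
  then have "norm h \<le> norm (p * p + q * q)"
    using norm_square_le_commuting[OF p(1) q(1)] p(2) by simp
  also have "p * p + q * q = ?c *\<^sub>R 1" by (simp add: p q)
  also have "norm (?c *\<^sub>R (1::'a)) \<le> ?c" using norm_one_le[where 'u='a] by (simp add: mult_left_le)
  finally show ?thesis .
qed

section \<open>The multiplier algebra as a unitisation\<close>

lemma norm_mult_of [simp]: "norm (mult_of a) = norm (a::'a::cstar_algebra)"
proof (rule antisym)
  have ap: "lmul (mult_of a) b = a * b" for b
    by (simp add: mult_of.rep_eq lmul.rep_eq blinfun_mult_right.rep_eq)
  show "norm (mult_of a) \<le> norm a"
    by (rule norm_multiplier_bound) (simp_all add: ap norm_mult_ineq)
  have "norm a * norm a \<le> norm (mult_of a) * norm a"
    using norm_lmul_le[of "mult_of a" "star a"] cstar_identity[of "star a"]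
    by (simp add: ap star_star power2_eq_square)
  then show "norm a \<le> norm (mult_of a)" by (cases "norm a = 0") auto
qed

lemma lmul_mult_of [simp]: "lmul (mult_of a) b = a * b"
  by (simp add: mult_of.rep_eq lmul.rep_eq blinfun_mult_right.rep_eq)

lemma rmul_mult: "rmul a m * b = a * lmul m b"
  using arg_cong[OF mult_of_rmul[of a m], of "\<lambda>x. lmul x b"] by (simp add: lmul_times)

lemma star_hom_mult_of: "star_hom mult_of"
  unfolding star_hom_def clinear_map_def star_multiplier_def
  by (auto intro!: lmul_eqI lmul_adj_unique[symmetric]
      simp: lmul_add_left lmul_scaleC_left lmul_times distrib_right mult_scaleC_left mult.assoc star_mult)

lemma norm_star_mult_le_add:
  fixes a b :: "'a::cstar_algebra"
  shows "norm (star a * a) \<le> norm (star a * a + star b * b)"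
  using norm_le_norm_add_cpos[OF cpos_star_mult[of "mult_of a"] cpos_star_mult[of "mult_of b"]]
  by (simp flip: star_hom_simps[OF star_hom_mult_of])

text \<open>For \<open>\<parallel>a\<parallel> \<le> 1\<close>, the image of \<open>1 - a\<^sup>* a\<close> is a square because its square root can be taken in the
  unitisation before applying \<open>f\<close>; hence \<open>0 \<le> f(a\<^sup>* a) \<le> 1\<close>.\<close>

lemma star_hom_contractive:
  fixes f :: "'a::cstar_algebra \<Rightarrow> 'b::cstar_algebra"
  assumes f: "star_hom f"
  shows "norm (f a) \<le> norm a"
proof -
  note fs = star_hom_simps[OF f]
  interpret f: linear f by (rule star_hom_linear[OF f])
  have 1: "norm (f a) \<le> 1" if "norm a \<le> 1" for a
  proof -
    let ?h = "star a * a"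
    have "norm ?h \<le> 1" using that by (simp add: cstar_identity power_le_one)
    moreover have "star ?h = ?h" by (simp add: star_mult star_star)
    ultimately obtain y where y: "star y = y" "2 *\<^sub>R y = ?h + y * y"
      using sqrt_iteration by metis
    let ?k = "mult_of (f ?h)"
    define q where "q = 1 - mult_of (f y)"
    have fy: "2 *\<^sub>R f y = f ?h + f y * f y" using arg_cong[OF y(2), of f] by (simp add: f.scaleR fs)
    interpret m: linear "mult_of :: 'b \<Rightarrow> _" by (rule star_hom_linear[OF star_hom_mult_of])
    have my: "2 *\<^sub>R mult_of (f y) = ?k + mult_of (f y) * mult_of (f y)"
      using arg_cong[OF fy, of mult_of] by (simp add: m.scaleR star_hom_simps[OF star_hom_mult_of])
    have saq: "star q = q"
      by (simp add: q_def star_diff y(1) flip: star_hom_simps(4)[OF star_hom_mult_of] fs(4))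
    have qq: "q * q = 1 - ?k" using my by (simp add: q_def algebra_simps scaleR_2)
    have "?k = star (mult_of (f a)) * mult_of (f a)"
      by (simp add: fs star_hom_simps[OF star_hom_mult_of])
    then have "cpos ?k" by (simp only: cpos_star_mult)
    then have "norm ?k \<le> norm (?k + q * q)"
      using cpos_square[OF saq] by (rule norm_le_norm_add_cpos)
    also have "\<dots> \<le> 1" using norm_one_le by (simp add: qq)
    finally have "(norm (f a))\<^sup>2 \<le> 1" by (simp add: fs cstar_identity)
    then show ?thesis using power2_le_imp_le[of "norm (f a)" 1] by simp
  qed
  show ?thesis
  proof (cases "a = 0")
    case False
    then have "norm (f ((1 / norm a) *\<^sub>R a)) \<le> 1" by (intro 1) simp
    then show ?thesis using False by (simp add: f.scaleR divide_simps)
  qed (simp add: f.zero)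
qed

lemma star_hom_bounded_linear: "star_hom f \<Longrightarrow> bounded_linear f"
  by (rule bounded_linear_intro[of _ 1])
    (simp_all add: star_hom_simps star_hom_contractive linear_scale[OF star_hom_linear])

section \<open>Strict limits and extensions of representations\<close>

text \<open>The equicontinuity argument: a point close to one where the net converges has values
  that are close to a limit, uniformly along a tail of the filter. The bound is only eventual
  because that is what an approximate unit provides.\<close>

lemma closed_bounded_net_convergent:
  fixes T :: "'i \<Rightarrow> 'a::real_normed_vector \<Rightarrow> 'b::banach"
  assumes F: "F \<noteq> bot" and lin: "\<And>i. linear (T i)"
    and bd: "\<forall>\<^sub>F i in F. \<forall>x. norm (T i x) \<le> K * norm x"
  shows "closed {x. \<exists>l. ((\<lambda>i. T i x) \<longlongrightarrow> l) F}"
  unfolding closed_sequential_limits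
proof (intro allI impI, elim conjE)
  fix x :: "nat \<Rightarrow> 'a" and z
  assume "\<forall>n. x n \<in> {x. \<exists>l. ((\<lambda>i. T i x) \<longlongrightarrow> l) F}" and xz: "x \<longlonglongrightarrow> z"
  then obtain l where l: "\<And>n. ((\<lambda>i. T i (x n)) \<longlongrightarrow> l n) F" by (auto simp: choice_iff)
  have ll: "norm (l n - l m) \<le> \<bar>K\<bar> * norm (x n - x m)" for n m
  proof (rule tendsto_upperbound[OF _ _ F])
    show "((\<lambda>i. norm (T i (x n) - T i (x m))) \<longlongrightarrow> norm (l n - l m)) F"
      by (intro tendsto_intros l)
    show "\<forall>\<^sub>F i in F. norm (T i (x n) - T i (x m)) \<le> \<bar>K\<bar> * norm (x n - x m)"
      using bd
    proof eventually_elim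
      case (elim i)
      then have "norm (T i (x n) - T i (x m)) \<le> K * norm (x n - x m)"
        by (simp flip: linear_diff[OF lin])
      also have "\<dots> \<le> \<bar>K\<bar> * norm (x n - x m)" by (simp add: mult_right_mono)
      finally show ?case .
    qed
  qed
  have "Cauchy l"
  proof (rule CauchyI)
    fix e :: real assume "0 < e"
    then have e: "0 < e / (\<bar>K\<bar> + 1)" by simp
    obtain M where M: "\<And>m n. m \<ge> M \<Longrightarrow> n \<ge> M \<Longrightarrow> norm (x m - x n) < e / (\<bar>K\<bar> + 1)"
      using CauchyD[OF LIMSEQ_imp_Cauchy[OF xz] e] by blast
    have "norm (l m - l n) < e" if "m \<ge> M" "n \<ge> M" for m n
    proof -
      have "norm (l m - l n) \<le> \<bar>K\<bar> * norm (x m - x n)" by (rule ll)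
      also have "\<dots> \<le> (\<bar>K\<bar> + 1) * norm (x m - x n)" by (simp add: mult_right_mono)
      also have "\<dots> < (\<bar>K\<bar> + 1) * (e / (\<bar>K\<bar> + 1))"
        using M[OF that] by (intro mult_strict_left_mono) auto
      finally show ?thesis by simp
    qed
    then show "\<exists>M. \<forall>m\<ge>M. \<forall>n\<ge>M. norm (l m - l n) < e" by blast
  qed
  then obtain l' where l': "l \<longlonglongrightarrow> l'" using Cauchy_convergent convergent_def by blast
  have "((\<lambda>i. T i z) \<longlongrightarrow> l') F"
  proof (rule tendstoI)
    fix e :: real assume e: "0 < e"
    have "(\<lambda>n. \<bar>K\<bar> * norm (z - x n)) \<longlonglongrightarrow> \<bar>K\<bar> * norm (z - z)"
      by (intro tendsto_intros xz)
    then have "\<forall>\<^sub>F n in sequentially. \<bar>K\<bar> * norm (z - x n) < e / 3"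
      using e by (intro order_tendstoD(2)) auto
    moreover have "\<forall>\<^sub>F n in sequentially. dist (l n) l' < e / 3"
      using tendstoD[OF l', of "e / 3"] e by simp
    ultimately have "\<forall>\<^sub>F n in sequentially. \<bar>K\<bar> * norm (z - x n) < e / 3 \<and> dist (l n) l' < e / 3"
      by (rule eventually_conj)
    then obtain n where n: "\<bar>K\<bar> * norm (z - x n) < e / 3" "dist (l n) l' < e / 3"
      by (auto simp: eventually_sequentially)
    have "\<forall>\<^sub>F i in F. dist (T i (x n)) (l n) < e / 3" using tendstoD[OF l, of "e / 3"] e by simp
    with bd show "\<forall>\<^sub>F i in F. dist (T i z) l' < e"
    proof eventually_elim
      case (elim i)
      have "dist (T i z) (T i (x n)) \<le> K * norm (z - x n)"
        using elim(1) by (simp add: dist_norm flip: linear_diff[OF lin])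
      also have "\<dots> \<le> \<bar>K\<bar> * norm (z - x n)" by (simp add: mult_right_mono)
      finally have "dist (T i z) (T i (x n)) < e / 3" using n by simp
      with elim n show ?case
        using dist_triangle[of "T i z" l' "T i (x n)"] dist_triangle[of "T i (x n)" l' "l n"] by simp
    qed
  qed
  then show "z \<in> {x. \<exists>l. ((\<lambda>i. T i x) \<longlongrightarrow> l) F}" by blast
qed

text \<open>The same three-term estimate for a limit operator known in advance: continuity of
  \<open>S\<close> takes over from the Cauchy property of the limits.\<close>

lemma closed_bounded_net_tendsto:
  fixes T :: "'i \<Rightarrow> 'a::real_normed_vector \<Rightarrow> 'b::banach"
  assumes F: "F \<noteq> bot" and lin: "\<And>i. linear (T i)"
    and bd: "\<forall>\<^sub>F i in F. \<forall>x. norm (T i x) \<le> K * norm x" and S: "bounded_linear S"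
  shows "closed {x. ((\<lambda>i. T i x) \<longlongrightarrow> S x) F}"
  unfolding closed_sequential_limits
proof (intro allI impI, elim conjE)
  fix x :: "nat \<Rightarrow> 'a" and z
  assume x: "\<forall>n. x n \<in> {x. ((\<lambda>i. T i x) \<longlongrightarrow> S x) F}" and xz: "x \<longlonglongrightarrow> z"
  have "((\<lambda>i. T i z) \<longlongrightarrow> S z) F"
  proof (rule tendstoI)
    fix e :: real assume e: "0 < e"
    have "(\<lambda>n. \<bar>K\<bar> * norm (z - x n)) \<longlonglongrightarrow> \<bar>K\<bar> * norm (z - z)"
      by (intro tendsto_intros xz)
    then have "\<forall>\<^sub>F n in sequentially. \<bar>K\<bar> * norm (z - x n) < e / 3"
      using e by (intro order_tendstoD(2)) auto
    moreover have "\<forall>\<^sub>F n in sequentially. dist (S (x n)) (S z) < e / 3"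
      using tendstoD[OF bounded_linear.tendsto[OF S xz], of "e / 3"] e by simp
    ultimately have "\<forall>\<^sub>F n in sequentially. \<bar>K\<bar> * norm (z - x n) < e / 3 \<and> dist (S (x n)) (S z) < e / 3"
      by (rule eventually_conj)
    then obtain n where n: "\<bar>K\<bar> * norm (z - x n) < e / 3" "dist (S (x n)) (S z) < e / 3"
      by (auto simp: eventually_sequentially)
    have "\<forall>\<^sub>F i in F. dist (T i (x n)) (S (x n)) < e / 3"
      using x e by (intro tendstoD) auto
    with bd show "\<forall>\<^sub>F i in F. dist (T i z) (S z) < e"
    proof eventually_elim
      case (elim i)
      have "dist (T i z) (T i (x n)) \<le> K * norm (z - x n)"
        using elim(1) by (simp add: dist_norm flip: linear_diff[OF lin])
      also have "\<dots> \<le> \<bar>K\<bar> * norm (z - x n)" by (simp add: mult_right_mono)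
      finally have "dist (T i z) (T i (x n)) < e / 3" using n by simp
      with elim n show ?case
        using dist_triangle[of "T i z" "S z" "T i (x n)"]
          dist_triangle[of "T i (x n)" "S z" "S (x n)"] by simp
    qed
  qed
  then show "z \<in> {x. ((\<lambda>i. T i x) \<longlongrightarrow> S x) F}" by blast
qed

lemma closure_span_subset: "closed C \<Longrightarrow> subspace C \<Longrightarrow> S \<subseteq> C \<Longrightarrow> closure (span S) \<subseteq> C"
  by (simp add: closure_minimal span_minimal)

lemma mult_all_eq_right: "(\<And>b. x * b = y * b) \<Longrightarrow> x = (y::'a::cstar_algebra)"
  by (metis mult_all_eq star_mult star_star)

lemma mult_of_inj: "mult_of a = mult_of b \<Longrightarrow> a = b"
  by (metis mult_all_eq_right lmul_mult_of)

lemma rmul_mult_of [simp]: "rmul a (mult_of b) = a * b"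
  by (rule mult_all_eq_right) (simp add: rmul_mult mult.assoc)

lemma rmul_add_left: "rmul (a + b) m = rmul a m + rmul b m"
  by (simp add: rmul_def star_add lmul_add_right)

lemma rmul_scaleC_left: "rmul (c *\<^sub>C a) m = c *\<^sub>C rmul a m"
  by (simp add: rmul_def star_scaleC lmul_scaleC_right)

lemma rmul_times: "rmul a (m * n) = rmul (rmul a m) n"
  by (simp add: rmul_def star_mult lmul_times star_star)

lemma rmul_mult_left: "rmul (a * b) m = a * rmul b m"
  by (simp add: rmul_def star_mult lmul_mult star_star)

lemma bounded_linear_rmul: "bounded_linear (\<lambda>a. rmul a m)"
  unfolding rmul_def
  by (intro bounded_linear_compose[OF bounded_linear_star] bounded_linear_compose[OF bounded_linear_lmul]
      bounded_linear_star)

text \<open>The left and right limits form a double centraliser: associativity gives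
  \<open>r a * b = a * l b\<close>. Taking adjoints, \<open>l\<close> is adjointable with adjoint
  \<open>\<lambda>b. star (r (star b))\<close>, hence a multiplier.\<close>

lemma strict_tendsto_exists:
  fixes f :: "'i \<Rightarrow> 'a::cstar_algebra"
  assumes F: "F \<noteq> bot" and bd: "\<forall>\<^sub>F i in F. norm (f i) \<le> K"
    and "\<And>t. \<exists>l. ((\<lambda>i. f i * t) \<longlongrightarrow> l) F" and "\<And>t. \<exists>r. ((\<lambda>i. t * f i) \<longlongrightarrow> r) F"
  shows "\<exists>m. strict_tendsto (\<lambda>i. mult_of (f i)) m F"
proof -
  obtain l r where l: "\<And>t. ((\<lambda>i. f i * t) \<longlongrightarrow> l t) F" and r: "\<And>t. ((\<lambda>i. t * f i) \<longlongrightarrow> r t) F"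
    using assms(3,4) by metis
  note uniq = tendsto_unique[OF F]
  have bdl: "norm (l t) \<le> norm t * K" for t
  proof (rule tendsto_upperbound[OF tendsto_norm[OF l] _ F])
    show "\<forall>\<^sub>F i in F. norm (f i * t) \<le> norm t * K"
      using bd
    proof eventually_elim
      case (elim i)
      have "norm (f i * t) \<le> norm (f i) * norm t" by (rule norm_mult_ineq)
      also have "\<dots> \<le> K * norm t" using elim by (simp add: mult_right_mono)
      finally show ?case by (simp add: mult.commute)
    qed
  qed
  have bdr: "norm (r t) \<le> norm t * K" for t
  proof (rule tendsto_upperbound[OF tendsto_norm[OF r] _ F])
    show "\<forall>\<^sub>F i in F. norm (t * f i) \<le> norm t * K"
      using bd
    proof eventually_elim
      case (elim i)
      have "norm (t * f i) \<le> norm t * norm (f i)" by (rule norm_mult_ineq)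
      also have "\<dots> \<le> norm t * K" using elim by (simp add: mult_left_mono)
      finally show ?case .
    qed
  qed
  have bl: "bounded_linear l"
  proof (rule bounded_linear_intro[OF _ _ bdl])
    show "l (x + y) = l x + l y" for x y
      using tendsto_add[OF l[of x] l[of y]] by (intro uniq[OF l]) (simp add: distrib_left)
    show "l (c *\<^sub>R x) = c *\<^sub>R l x" for c x
      using tendsto_scaleR[OF tendsto_const l[of x], of c] by (intro uniq[OF l]) simp
  qed
  have br: "bounded_linear r"
  proof (rule bounded_linear_intro[OF _ _ bdr])
    show "r (x + y) = r x + r y" for x y
      using tendsto_add[OF r[of x] r[of y]] by (intro uniq[OF r]) (simp add: distrib_right)
    show "r (c *\<^sub>R x) = c *\<^sub>R r x" for c x
      using tendsto_scaleR[OF tendsto_const r[of x], of c] by (intro uniq[OF r]) simp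
  qed
  have br': "bounded_linear (\<lambda>b. star (r (star b)))"
    by (intro bounded_linear_compose[OF bounded_linear_star] bounded_linear_compose[OF br] bounded_linear_star)
  have rl: "r a * b = a * l b" for a b
  proof (rule uniq)
    show "((\<lambda>i. a * f i * b) \<longlongrightarrow> r a * b) F" by (intro tendsto_intros r)
    show "((\<lambda>i. a * f i * b) \<longlongrightarrow> a * l b) F" unfolding mult.assoc by (intro tendsto_intros l)
  qed
  have "star (l a) * b = star a * star (r (star b))" for a b
    using arg_cong[OF rl[of "star b" a], of star] by (simp add: star_mult star_star)
  then have "Blinfun l \<in> {T. \<exists>T'::'a \<Rightarrow>\<^sub>L 'a. \<forall>a b. star (blinfun_apply T a) * b = star a * blinfun_apply T' b}"
    using bounded_linear_Blinfun_apply[OF bl] bounded_linear_Blinfun_apply[OF br']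
    by (auto intro!: exI[of _ "Blinfun (\<lambda>b. star (r (star b)))"])
  then have lm: "lmul (Mult (Blinfun l)) = l"
    by (simp add: lmul.rep_eq Mult_inverse bounded_linear_Blinfun_apply[OF bl])
  have "rmul a (Mult (Blinfun l)) = r a" for a
    by (rule mult_all_eq_right) (simp add: rmul_mult lm rl)
  with lm l r have "strict_tendsto (\<lambda>i. mult_of (f i)) (Mult (Blinfun l)) F"
    unfolding strict_tendsto_def by simp
  then show ?thesis by blast
qed

lemma strict_tendsto_Lim:
  assumes "F \<noteq> bot" "strict_tendsto f m F"
  shows "strict_Lim F f = m"
  unfolding strict_Lim_def
proof (rule the_equality)
  show "strict_tendsto f m F" by (rule assms(2))
next
  fix n assume "strict_tendsto f n F"
  with assms show "n = m"
    unfolding strict_tendsto_def by (blast intro: lmul_eqI tendsto_unique)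
qed

section \<open>Operators on a Hilbert space and extension of representations\<close>

lemma bop_exists:
  fixes f :: "'h::chilbert_space \<Rightarrow> 'h"
  assumes "\<And>x y. f (x + y) = f x + f y" "\<And>c x. f (c *\<^sub>C x) = c *\<^sub>C f x" "\<And>x. norm (f x) \<le> norm x * K"
  obtains T where "bop_apply T = f"
proof -
  have "bounded_linear f"
    using assms by (intro bounded_linear_intro[of _ K]) (simp_all add: scaleR_scaleC)
  then have f: "blinfun_apply (Blinfun f) = f" by (rule bounded_linear_Blinfun_apply)
  then have "bop_apply (Bop (Blinfun f)) = f"
    unfolding bop_apply.rep_eq by (subst Bop_inverse) (auto simp: assms)
  then show thesis by (rule that)
qed

lemma bounded_linear_bop_apply_left: "bounded_linear (\<lambda>T. bop_apply T \<xi>)"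
proof (rule bounded_linear_intro)
  show "norm (bop_apply T \<xi>) \<le> norm T * norm \<xi>" for T by (rule norm_bop_apply_le)
qed (simp_all add: bop_apply_add_left scaleR_scaleC bop_apply_scaleC_left)

lemma nondegenerate_rep_eqI:
  assumes nd: "nondegenerate_rep \<pi>" and eq: "\<And>a. X * \<pi> a = Y * \<pi> a"
  shows "X = Y"
proof (rule bop_eqI)
  fix \<xi>
  let ?C = "{\<xi>. bop_apply X \<xi> = bop_apply Y \<xi>}"
  have "closed ?C"
    by (intro closed_Collect_eq linear_continuous_on bounded_linear_bop_apply)
  moreover have "subspace ?C"
    by (rule subspaceI)
      (auto simp: bop_apply_add linear_0[OF bounded_linear.linear[OF bounded_linear_bop_apply]]
        linear_scale[OF bounded_linear.linear[OF bounded_linear_bop_apply]])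
  moreover have "{bop_apply (\<pi> a) \<xi> |a \<xi>. True} \<subseteq> ?C"
    using eq by (auto simp flip: bop_apply_times)
  ultimately have "closure (span {bop_apply (\<pi> a) \<xi> |a \<xi>. True}) \<subseteq> ?C"
    by (rule closure_span_subset)
  then have "\<xi> \<in> ?C" using nd unfolding nondegenerate_rep_def by blast
  then show "bop_apply X \<xi> = bop_apply Y \<xi>" by simp
qed

lemma star_hom_rep_mult:
  assumes "star_hom \<tau>" "\<And>b. \<tau> (mult_of b) = \<sigma> b"
  shows "\<tau> m * \<sigma> b = \<sigma> (lmul m b)"
  using assms by (metis mult_of_lmul star_hom_simps(3))

text \<open>The value at \<open>m\<close> is the pointwise limit of
  \<open>\<sigma> (lmul m (e i))\<close>. It exists on vectors in the range of some
  \<open>\<sigma> b\<close>, since \<open>m\<close> applied to \<open>e i * b\<close> tends to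
  \<open>lmul m b\<close>, and then everywhere by boundedness. All algebraic properties follow from
  the formula \<open>\<tau>\<sigma>\<close> by non-degeneracy.\<close>

lemma rep_extension_exists:
  fixes \<sigma> :: "'b::cstar_algebra \<Rightarrow> 'h::chilbert_space bop"
  assumes nd: "nondegenerate_rep \<sigma>" and e: "approximate_unit (e :: 'i \<Rightarrow> 'b) F"
  obtains \<tau> where "star_hom \<tau>" "\<And>b. \<tau> (mult_of b) = \<sigma> b"
proof -
  have \<sigma>: "star_hom \<sigma>" using nd by (simp add: nondegenerate_rep_def)
  note \<sigma>s = star_hom_simps[OF \<sigma>]
  have F: "F \<noteq> bot" and e1: "\<forall>\<^sub>F i in F. norm (e i) \<le> 1" and el: "\<And>b. ((\<lambda>i. e i * b) \<longlongrightarrow> b) F"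
    using e by (auto simp: approximate_unit_def)
  have conv: "((\<lambda>i. bop_apply (\<sigma> (lmul m (e i))) (bop_apply (\<sigma> b) \<eta>)) \<longlongrightarrow> bop_apply (\<sigma> (lmul m b)) \<eta>) F" for m b \<eta>
  proof -
    have "((\<lambda>i. bop_apply (\<sigma> (lmul m (e i * b))) \<eta>) \<longlongrightarrow> bop_apply (\<sigma> (lmul m b)) \<eta>) F"
      by (intro bounded_linear.tendsto[OF bounded_linear_bop_apply_left]
          bounded_linear.tendsto[OF star_hom_bounded_linear[OF \<sigma>]]
          bounded_linear.tendsto[OF bounded_linear_lmul] el)
    then show ?thesis by (simp add: lmul_mult \<sigma>s bop_apply_times)
  qed
  have bd: "\<forall>\<^sub>F i in F. \<forall>\<xi>. norm (bop_apply (\<sigma> (lmul m (e i))) \<xi>) \<le> norm m * norm \<xi>" for m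
    using e1
  proof eventually_elim
    case (elim i)
    have "norm (\<sigma> (lmul m (e i))) \<le> norm (lmul m (e i))" by (rule star_hom_contractive[OF \<sigma>])
    also have "\<dots> \<le> norm m * norm (e i)" by (rule norm_lmul_le)
    also have "\<dots> \<le> norm m" using elim by (simp add: mult_left_le)
    finally show ?case by (meson mult_right_mono norm_bop_apply_le norm_ge_zero order_trans)
  qed
  have ex: "\<exists>l. ((\<lambda>i. bop_apply (\<sigma> (lmul m (e i))) \<xi>) \<longlongrightarrow> l) F" for m \<xi>
  proof -
    let ?C = "{\<xi>. \<exists>l. ((\<lambda>i. bop_apply (\<sigma> (lmul m (e i))) \<xi>) \<longlongrightarrow> l) F}"
    have "closed ?C"
      by (rule closed_bounded_net_convergent[OF F bounded_linear.linear[OF bounded_linear_bop_apply] bd])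
    moreover have "subspace ?C"
    proof (rule subspaceI)
      show "c *\<^sub>R \<zeta> \<in> ?C" if "\<zeta> \<in> ?C" for c \<zeta>
        using that tendsto_scaleR[OF tendsto_const, of _ _ F c]
        by (auto simp: linear_scale[OF bounded_linear.linear[OF bounded_linear_bop_apply]])
    qed (auto simp: bop_apply_add linear_0[OF bounded_linear.linear[OF bounded_linear_bop_apply]]
        intro: tendsto_add tendsto_const)
    moreover have "{bop_apply (\<sigma> a) \<xi> |a \<xi>. True} \<subseteq> ?C" using conv by blast
    ultimately have "closure (span {bop_apply (\<sigma> a) \<xi> |a \<xi>. True}) \<subseteq> ?C"
      by (rule closure_span_subset)
    then have "\<xi> \<in> ?C" using nd unfolding nondegenerate_rep_def by blast
    then show ?thesis by simp
  qed
  then obtain t where t: "\<And>m \<xi>. ((\<lambda>i. bop_apply (\<sigma> (lmul m (e i))) \<xi>) \<longlongrightarrow> t m \<xi>) F" by metis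
  have "\<exists>T. bop_apply T = t m" for m
  proof (rule bop_exists)
    show "t m (x + y) = t m x + t m y" for x y
      using tendsto_add[OF t[of m x] t[of m y]] by (intro tendsto_unique[OF F t]) (simp add: bop_apply_add)
    show "t m (c *\<^sub>C x) = c *\<^sub>C t m x" for c x
      using bounded_linear.tendsto[OF bounded_linear_scaleC_right t[of m x], of c]
      by (intro tendsto_unique[OF F t]) (simp add: bop_apply_scaleC)
    show "norm (t m x) \<le> norm x * norm m" for x
      by (rule tendsto_upperbound[OF tendsto_norm[OF t] _ F])
        (use bd[of m] in \<open>auto elim!: eventually_mono simp: mult.commute\<close>)
  qed blast
  then obtain \<tau> where \<tau>: "\<And>m. bop_apply (\<tau> m) = t m" by metis
  have \<tau>\<sigma>: "\<tau> m * \<sigma> b = \<sigma> (lmul m b)" for m b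
    by (rule bop_eqI) (simp add: bop_apply_times \<tau> tendsto_unique[OF F t conv])
  note eqI = nondegenerate_rep_eqI[OF nd]
  show thesis
  proof (rule that)
    show "\<tau> (mult_of b) = \<sigma> b" for b by (rule eqI) (simp add: \<tau>\<sigma> \<sigma>s)
    \<comment> \<open>\<open>\<tau>\<sigma>\<close> evaluates only products with
      \<open>\<sigma>\<close> on the right. Passing to adjoints once more puts
      \<open>\<tau> m\<close> itself, rather than its adjoint, in front of some
      \<open>\<sigma> b\<close>.\<close>
    have "star (\<tau> m) = \<tau> (star m)" for m
    proof (rule eqI)
      fix c
      have "star (star (\<tau> m) * \<sigma> c) = star (\<tau> (star m) * \<sigma> c)"
      proof (rule eqI)
        fix b
        have "star (star (\<tau> m) * \<sigma> c) * \<sigma> b = \<sigma> (star c * lmul m b)"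
          by (simp add: star_mult star_star mult.assoc \<tau>\<sigma> \<sigma>s)
        also have "star c * lmul m b = star (lmul (star m) c) * b"
          by (simp add: star_multiplier_def lmul_adj')
        also have "\<sigma> \<dots> = star (\<tau> (star m) * \<sigma> c) * \<sigma> b" by (simp add: \<tau>\<sigma> \<sigma>s)
        finally show "star (star (\<tau> m) * \<sigma> c) * \<sigma> b = star (\<tau> (star m) * \<sigma> c) * \<sigma> b" .
      qed
      then show "star (\<tau> m) * \<sigma> c = \<tau> (star m) * \<sigma> c" by (metis star_star)
    qed
    moreover have "\<tau> (m + n) = \<tau> m + \<tau> n" for m n
      by (rule eqI) (simp add: \<tau>\<sigma> \<sigma>s lmul_add_left distrib_right)
    moreover have "\<tau> (c *\<^sub>C m) = c *\<^sub>C \<tau> m" for c m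
      by (rule eqI) (simp add: \<tau>\<sigma> \<sigma>s lmul_scaleC_left mult_scaleC_left)
    moreover have "\<tau> (m * n) = \<tau> m * \<tau> n" for m n
      by (rule eqI) (simp add: \<tau>\<sigma> lmul_times mult.assoc)
    ultimately show "star_hom \<tau>" by (simp add: star_hom_def clinear_map_def)
  qed
qed

lemma rep_extension:
  fixes \<sigma> :: "'b::cstar_algebra \<Rightarrow> 'h::chilbert_space bop"
  assumes nd: "nondegenerate_rep \<sigma>" and e: "approximate_unit (e :: 'i \<Rightarrow> 'b) F"
  shows "star_hom (rep_extension \<sigma>)" and "rep_extension \<sigma> (mult_of b) = \<sigma> b"
proof -
  obtain \<tau> where \<tau>: "star_hom \<tau>" "\<And>b. \<tau> (mult_of b) = \<sigma> b"
    using rep_extension_exists[OF assms] by blast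
  have "rep_extension \<sigma> = \<tau>"
    unfolding rep_extension_def
  proof (rule the_equality)
    fix \<tau>' assume \<tau>': "star_hom \<tau>' \<and> (\<forall>b. \<tau>' (mult_of b) = \<sigma> b)"
    show "\<tau>' = \<tau>"
    proof
      show "\<tau>' m = \<tau> m" for m
        by (rule nondegenerate_rep_eqI[OF nd])
          (metis \<tau> \<tau>' star_hom_rep_mult)
    qed
  qed (use \<tau> in blast)
  with \<tau> show "star_hom (rep_extension \<sigma>)" "rep_extension \<sigma> (mult_of b) = \<sigma> b" by auto
qed

section \<open>Transfer operators\<close>

lemma continuous_linear_bounded:
  assumes "linear f" "continuous_on UNIV f"
  shows "bounded_linear f"
proof -
  interpret linear f by (rule assms(1))
  have "isCont f 0" using assms(2) by (simp add: continuous_on_eq_continuous_at)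
  then obtain d where d: "0 < d" "\<And>x. norm x < d \<Longrightarrow> norm (f x) < 1"
    unfolding continuous_at_eps_delta by (auto simp: dist_norm zero intro: zero_less_one)
  show ?thesis
  proof (rule bounded_linear_intro[OF add scaleR])
    show "norm (f x) \<le> norm x * (2 / d)" for x
    proof (cases "x = 0")
      case False
      have "norm (f ((d / (2 * norm x)) *\<^sub>R x)) < 1" using d(1) False by (intro d(2)) simp
      then show ?thesis using d(1) False by (simp add: scaleR field_simps)
    qed (simp add: zero)
  qed
qed

locale transfer_system =
  fixes \<alpha> L :: "'s::comm_monoid_add \<Rightarrow> 'a::cstar_algebra \<Rightarrow> 'a"
    and u :: "'i \<Rightarrow> 'a" and F :: "'i filter"
  assumes \<alpha>_extendible: "extendible_action \<alpha>" and L_transfer: "transfer_action \<alpha> L" and au: "approximate_unit u F"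
begin

lemma F_ne: "F \<noteq> bot" and u_bd: "\<forall>\<^sub>F i in F. norm (u i) \<le> 1"
  and u_left: "((\<lambda>i. u i * a) \<longlongrightarrow> a) F" and u_right: "((\<lambda>i. a * u i) \<longlongrightarrow> a) F"
  using au by (auto simp: approximate_unit_def)

lemma \<alpha>_hom: "star_hom (\<alpha> s)"
  using \<alpha>_extendible by (simp add: extendible_action_def extendible_def)

lemmas \<alpha>_simps = star_hom_simps[OF \<alpha>_hom]

lemma \<alpha>_zero: "\<alpha> 0 a = a" and \<alpha>_add: "\<alpha> (s + t) a = \<alpha> s (\<alpha> t a)"
  using \<alpha>_extendible by (simp_all add: extendible_action_def semigroup_action_def)

lemma L_zero: "L 0 a = a" and L_add: "L (s + t) a = L s (L t a)"
  using L_transfer by (simp_all add: transfer_action_def semigroup_action_def)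

lemma L_clinear: "clinear_map (L s)"
  using L_transfer by (simp add: transfer_action_def)

lemma L_linear: "linear (L s)" and L_scaleC: "L s (c *\<^sub>C a) = c *\<^sub>C L s a"
  using L_clinear[of s] by (simp_all add: clinear_map_linear clinear_map_def)

lemma L_bounded_linear: "bounded_linear (L s)"
  using L_transfer by (intro continuous_linear_bounded L_linear) (simp add: transfer_action_def)

lemmas L_linear_simps = linear_add[OF L_linear] linear_diff[OF L_linear] linear_scale[OF L_linear] linear_0[OF L_linear]

lemma L_positive:
  obtains v where "L s (star x * x) = star v * v"
  using L_transfer unfolding transfer_action_def positive_map_def positive_elem_def by blast

lemma L_module: "L s (\<alpha> s a * b) = a * L s b"
proof -
  obtain L' where "\<And>a. L' (mult_of a) = mult_of (L s a)" "\<And>a m. L s (rmul (\<alpha> s a) m) = rmul a (L' m)"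
    using L_transfer unfolding transfer_action_def by blast
  then show ?thesis by (metis rmul_mult_of)
qed

text \<open>Positivity gives this on \<open>y\<^sup>* z\<close> by polarisation; an approximate unit does the rest.\<close>

lemma L_star: "L s (star x) = star (L s x)"
proof -
  have sa: "star (L s (star y * y)) = L s (star y * y)" for y
    by (rule L_positive[of s y]) (simp add: star_mult star_star)
  have polar: "4 *\<^sub>C (star y * z) = star (y + z) * (y + z) - star (y - z) * (y - z)
     - \<i> *\<^sub>C (star (y + \<i> *\<^sub>C z) * (y + \<i> *\<^sub>C z)) + \<i> *\<^sub>C (star (y - \<i> *\<^sub>C z) * (y - \<i> *\<^sub>C z))" for y z :: 'a
  proof -
    have "4 *\<^sub>C w = w + w + w + w" for w :: 'a
      using scaleC_add_left[of 2 2 w] scaleC_add_left[of 1 1 w] by simp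
    then show ?thesis
      by (simp add: star_add star_diff star_scaleC algebra_simps mult_scaleC_left mult_scaleC_right
          scaleC_scaleC scaleC_minus_left scaleC_diff_right scaleC_add_right)
  qed
  have hermitian: "L s (star (star y * z)) = star (L s (star y * z))" for y z
  proof -
    have "4 *\<^sub>C L s (star (star y * z)) = L s (star (cnj 4 *\<^sub>C (star y * z)))"
      by (simp add: star_scaleC L_scaleC)
    also have "\<dots> = star (L s (4 *\<^sub>C (star y * z)))"
      unfolding complex_cnj_numeral polar
      by (simp only: L_linear_simps L_scaleC star_add star_diff star_scaleC star_mult star_star sa[unfolded star_mult])
        (simp only: star_mult[symmetric] star_add[symmetric] star_diff[symmetric] star_scaleC[symmetric] sa complex_cnj_cnj)
    also have "\<dots> = 4 *\<^sub>C star (L s (star y * z))" by (simp add: L_scaleC star_scaleC)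
    finally have "(1/4) *\<^sub>C 4 *\<^sub>C L s (star (star y * z)) = (1/4) *\<^sub>C 4 *\<^sub>C star (L s (star y * z))"
      by simp
    then show ?thesis by (simp add: scaleC_scaleC)
  qed
  show ?thesis
  proof (rule tendsto_unique[OF F_ne])
    have "((\<lambda>i. L s (star (star (star (u i)) * x))) \<longlongrightarrow> L s (star x)) F"
      by (intro bounded_linear.tendsto[OF L_bounded_linear] bounded_linear.tendsto[OF bounded_linear_star])
        (simp add: star_star u_left)
    then show "((\<lambda>i. star (L s (star (star (u i)) * x))) \<longlongrightarrow> L s (star x)) F"
      unfolding hermitian .
    show "((\<lambda>i. star (L s (star (star (u i)) * x))) \<longlongrightarrow> star (L s x)) F"
      by (intro bounded_linear.tendsto[OF L_bounded_linear] bounded_linear.tendsto[OF bounded_linear_star])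
        (simp add: star_star u_left)
  qed
qed

lemma L_module_right: "L s (b * \<alpha> s a) = L s b * a"
proof -
  have "L s (b * \<alpha> s a) = star (L s (star (b * \<alpha> s a)))" by (simp only: L_star star_star)
  also have "star (b * \<alpha> s a) = \<alpha> s (star a) * star b" by (simp add: star_mult \<alpha>_simps)
  finally show ?thesis by (simp add: L_module star_mult star_star L_star)
qed

section \<open>The projections p_s and the subspaces A_s\<close>

abbreviation p where "p s \<equiv> mult_extension (\<alpha> s) 1"

lemma is_mult_extension: "is_mult_extension (\<alpha> s) (mult_extension (\<alpha> s))"
  unfolding mult_extension_def
  by (rule theI'[of "is_mult_extension (\<alpha> s)"]) (use \<alpha>_extendible in \<open>simp add: extendible_action_def extendible_def\<close>)

lemma p_idem: "p s * p s = p s"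
  using is_mult_extension[of s] by (simp add: is_mult_extension_def flip: star_hom_simps(3))

lemma rmul_p: "rmul (\<alpha> s a) (p s) = \<alpha> s a" and lmul_p: "lmul (p s) (\<alpha> s a) = \<alpha> s a"
proof -
  have h: "star_hom (mult_extension (\<alpha> s))" and e: "mult_of (\<alpha> s a) = mult_extension (\<alpha> s) (mult_of a)"
    using is_mult_extension[of s] unfolding is_mult_extension_def by auto
  show "rmul (\<alpha> s a) (p s) = \<alpha> s a"
    by (rule mult_of_inj) (simp add: mult_of_rmul e flip: star_hom_simps(3)[OF h])
  show "lmul (p s) (\<alpha> s a) = \<alpha> s a"
    by (rule mult_of_inj) (simp add: mult_of_lmul e flip: star_hom_simps(3)[OF h])
qed

lemma pre_fibre_iff: "x \<in> pre_fibre \<alpha> s \<longleftrightarrow> rmul x (p s) = x"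
  unfolding pre_fibre_def by (auto simp: p_idem simp flip: rmul_times) metis

text \<open>The definition of \<open>p s\<close> provides one approximate unit \<open>F0\<close>;
  here convergence is transferred to any other. The set \<open>?C\<close> is closed and contains all
  \<open>b * \<alpha> s c\<close>, hence also their limit \<open>rmul a (p s)\<close> along
  \<open>F0\<close>. The additional \<open>p s\<close> then disappears, because it is idempotent and
  fixes the range of \<open>\<alpha> s\<close>.\<close>

lemma tendsto_p:
  assumes e: "approximate_unit e G"
  shows "((\<lambda>i. a * \<alpha> s (e i)) \<longlongrightarrow> rmul a (p s)) G"
proof -
  have G: "G \<noteq> bot" and e1: "\<forall>\<^sub>F i in G. norm (e i) \<le> 1" and er: "\<And>b. ((\<lambda>i. b * e i) \<longlongrightarrow> b) G"
    using e by (auto simp: approximate_unit_def)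
  let ?C = "{x. ((\<lambda>i. x * \<alpha> s (e i)) \<longlongrightarrow> rmul x (p s)) G}"
  have "closed ?C"
  proof (rule closed_bounded_net_tendsto[OF G _ _ bounded_linear_rmul])
    show "linear (\<lambda>x. x * \<alpha> s (e i))" for i
      by (rule bounded_linear.linear[OF bounded_linear_mult_left])
    show "\<forall>\<^sub>F i in G. \<forall>x. norm (x * \<alpha> s (e i)) \<le> 1 * norm x"
      using e1
    proof eventually_elim
      case (elim i)
      show ?case
      proof
        fix x
        have "norm (x * \<alpha> s (e i)) \<le> norm x * norm (\<alpha> s (e i))" by (rule norm_mult_ineq)
        also have "\<dots> \<le> norm x * 1"
          using elim star_hom_contractive[OF \<alpha>_hom, of s "e i"] by (intro mult_left_mono) auto
        finally show "norm (x * \<alpha> s (e i)) \<le> 1 * norm x" by simp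
      qed
    qed
  qed
  obtain F0 where F0: "approximate_unit (\<lambda>b. b) F0" "strict_tendsto (\<lambda>b. mult_of (\<alpha> s b)) (p s) F0"
    using is_mult_extension[of s] unfolding is_mult_extension_def by blast
  have "b * \<alpha> s c \<in> ?C" for b c
  proof -
    have "((\<lambda>i. b * \<alpha> s (c * e i)) \<longlongrightarrow> b * \<alpha> s c) G"
      by (intro tendsto_mult tendsto_const er bounded_linear.tendsto[OF star_hom_bounded_linear[OF \<alpha>_hom]])
    then show ?thesis by (simp add: \<alpha>_simps rmul_mult_left rmul_p mult.assoc)
  qed
  then have "rmul a (p s) \<in> ?C"
    using F0 \<open>closed ?C\<close>
    by (intro Lim_in_closed_set[of ?C "\<lambda>b. a * \<alpha> s b" F0])
      (auto simp: approximate_unit_def strict_tendsto_def)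
  then show ?thesis by (simp add: rmul_mult lmul_p p_idem flip: rmul_times)
qed

lemma pre_fibre_zero [simp]: "x \<in> pre_fibre \<alpha> 0"
  unfolding pre_fibre_iff
  using tendsto_unique[OF F_ne tendsto_p[OF au, of x 0]] u_right[of x] by (simp add: \<alpha>_zero)

lemma pre_fibre_closed:
  "x \<in> pre_fibre \<alpha> s \<Longrightarrow> y \<in> pre_fibre \<alpha> s \<Longrightarrow> x + y \<in> pre_fibre \<alpha> s"
  "x \<in> pre_fibre \<alpha> s \<Longrightarrow> c *\<^sub>C x \<in> pre_fibre \<alpha> s"
  "x \<in> pre_fibre \<alpha> s \<Longrightarrow> a * x \<in> pre_fibre \<alpha> s"
  by (simp_all add: pre_fibre_iff rmul_add_left rmul_scaleC_left rmul_mult_left)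

lemma \<alpha>_pre_fibre: "\<alpha> s a \<in> pre_fibre \<alpha> s"
  by (simp add: pre_fibre_iff rmul_p)

lemma rmul_pre_fibre: "rmul a (p s) \<in> pre_fibre \<alpha> s"
  unfolding pre_fibre_def by blast

text \<open>Behind this is that the extension of alpha_s maps p_t to p_{s+t}. The proof only
  compares two limits of the same net: \<open>y\<close> is the limit of
  \<open>y * \<alpha> t (u i)\<close>, and applying \<open>\<alpha> s\<close> to this turns
  \<open>\<alpha> t (u i)\<close> into \<open>\<alpha> (s + t) (u i)\<close>.\<close>

lemma prod_pre_fibre:
  assumes "y \<in> pre_fibre \<alpha> t"
  shows "x * \<alpha> s y \<in> pre_fibre \<alpha> (s + t)"
proof -
  have "((\<lambda>i. x * \<alpha> s (y * \<alpha> t (u i))) \<longlongrightarrow> x * \<alpha> s (rmul y (p t))) F"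
    by (intro tendsto_mult tendsto_const bounded_linear.tendsto[OF star_hom_bounded_linear[OF \<alpha>_hom]]
        tendsto_p au)
  moreover have "((\<lambda>i. x * \<alpha> s (y * \<alpha> t (u i))) \<longlongrightarrow> rmul (x * \<alpha> s y) (p (s + t))) F"
    using tendsto_p[OF au, of "x * \<alpha> s y" "s + t"] by (simp add: \<alpha>_simps \<alpha>_add mult.assoc)
  ultimately show ?thesis
    using assms tendsto_unique[OF F_ne] unfolding pre_fibre_iff by metis
qed

section \<open>The seminorm on A_s\<close>

abbreviation N where "N \<equiv> pre_norm L"

lemma N_nonneg [simp]: "0 \<le> N s x" and N_sq: "(N s x)\<^sup>2 = norm (L s (star x * x))"
  by (simp_all add: pre_norm_def)

lemma N_0 [simp]: "N s 0 = 0"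
  by (simp add: pre_norm_def L_linear_simps)

lemma N_scale: "N s (c *\<^sub>C x) = cmod c * N s x"
proof -
  have "star (c *\<^sub>C x) * (c *\<^sub>C x) = (cnj c * c) *\<^sub>C (star x * x)"
    by (simp add: star_scaleC mult_scaleC_left mult_scaleC_right scaleC_scaleC mult.commute)
  then show ?thesis
    by (simp add: pre_norm_def L_scaleC norm_scaleC norm_mult real_sqrt_mult)
qed

lemma N_minus_commute: "N s (x - y) = N s (y - x)"
  using star_minus[of "x - y"] minus_mult_minus[of "star (x - y)" "x - y"] by (simp add: pre_norm_def)

text \<open>Minimise \<open>L\<^sub>s(w\<^sup>* w)\<close> over \<open>w = y - t x \<alpha>\<^sub>s(b)\<close>, where \<open>b = L\<^sub>s(x\<^sup>* y)\<close>.\<close>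

lemma Cauchy_Schwarz: "norm (L s (star x * y)) \<le> N s x * N s y"
proof -
  define b where "b = L s (star x * y)"
  have sb: "L s (star y * x) = star b" using L_star[of s "star x * y"] by (simp add: b_def star_mult star_star)
  define X where "X = (N s x)\<^sup>2"
  define Y where "Y = (N s y)\<^sup>2"
  define B where "B = (norm b)\<^sup>2"
  have ineq: "2 * t * B \<le> Y + t\<^sup>2 * B * X" if t: "0 < t" for t
  proof -
    let ?w = "y - t *\<^sub>R (x * \<alpha> s b)"
    obtain v where v: "L s (star ?w * ?w) = star v * v" by (rule L_positive)
    have "star ?w * ?w = star y * y - t *\<^sub>R (star y * x * \<alpha> s b) - t *\<^sub>R (\<alpha> s (star b) * (star x * y))
        + t\<^sup>2 *\<^sub>R (\<alpha> s (star b) * (star x * x * \<alpha> s b))"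
      by (simp add: star_diff star_scaleR star_mult \<alpha>_simps algebra_simps power2_eq_square)
    then have "L s (star ?w * ?w) = L s (star y * y) - t *\<^sub>R (star b * b) - t *\<^sub>R (star b * b)
        + t\<^sup>2 *\<^sub>R (star b * (L s (star x * x) * b))"
      by (simp only: L_linear_simps L_module L_module_right sb b_def[symmetric])
    then have eq: "t *\<^sub>R (star b * b) + t *\<^sub>R (star b * b) + star v * v
        = L s (star y * y) + t\<^sup>2 *\<^sub>R (star b * (L s (star x * x) * b))"
      unfolding v by (simp add: algebra_simps)
    \<comment> \<open>Writing 2t b^* b as \<open>star ?b * ?b\<close> brings it into the form in
      which \<open>norm_star_mult_le_add\<close> can discard the remainder
      \<open>star v * v\<close>.\<close>
    let ?b = "sqrt (2 * t) *\<^sub>R b"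
    have bb: "star ?b * ?b = t *\<^sub>R (star b * b) + t *\<^sub>R (star b * b)"
      using t by (simp add: star_scaleR flip: scaleR_left_distrib)
    have "2 * t * B = norm (star ?b * ?b)" unfolding cstar_identity using t by (simp add: B_def power_mult_distrib)
    also have "\<dots> \<le> norm (star ?b * ?b + star v * v)" by (rule norm_star_mult_le_add)
    also have "\<dots> \<le> norm (L s (star y * y)) + norm (t\<^sup>2 *\<^sub>R (star b * (L s (star x * x) * b)))"
      unfolding bb eq by (rule norm_triangle_ineq)
    also have "norm (t\<^sup>2 *\<^sub>R (star b * (L s (star x * x) * b))) \<le> t\<^sup>2 * (norm b * (X * norm b))"
    proof -
      have "norm (star b * (L s (star x * x) * b)) \<le> norm (star b) * norm (L s (star x * x) * b)"
        by (rule norm_mult_ineq)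
      also have "\<dots> \<le> norm (star b) * (norm (L s (star x * x)) * norm b)"
        by (intro mult_left_mono norm_mult_ineq) simp
      finally show ?thesis by (simp add: X_def N_sq mult_left_mono)
    qed
    finally show ?thesis by (simp add: B_def Y_def[unfolded N_sq, symmetric] power2_eq_square mult_ac)
  qed
  have "B \<le> X * Y"
  proof (cases "X = 0")
    case True
    have "B = 0"
    proof (rule ccontr)
      assume "B \<noteq> 0"
      then have B: "0 < B" by (simp add: B_def)
      have "0 \<le> Y" by (simp add: Y_def)
      \<comment> \<open>For \<open>X = 0\<close> the right side of \<open>ineq\<close> is constant
        in \<open>t\<close>; this choice gives 2Y + 2 \<le> Y.\<close>
      with B ineq[of "(Y + 1) / B"] True show False by simp
    qed
    then show ?thesis by (simp add: X_def Y_def)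
  next
    case False
    then have X: "0 < X" by (simp add: X_def)
    \<comment> \<open>\<open>t = 1 / X\<close> makes the difference of the two sides of
      \<open>ineq\<close> minimal.\<close>
    then have "2 * (1 / X) * B \<le> Y + (1 / X)\<^sup>2 * B * X" by (intro ineq) simp
    then show ?thesis using X by (simp add: field_simps power2_eq_square)
  qed
  then have "(norm b)\<^sup>2 \<le> (N s x * N s y)\<^sup>2" by (simp add: B_def X_def Y_def power_mult_distrib)
  then show ?thesis unfolding b_def by (rule power2_le_imp_le) simp
qed

lemma N_triangle: "N s (x + y) \<le> N s x + N s y"
proof (rule power2_le_imp_le)
  have "(N s (x + y))\<^sup>2 = norm (L s (star x * x) + L s (star x * y) + (L s (star y * x) + L s (star y * y)))"
    by (simp add: N_sq star_add distrib_left distrib_right L_linear_simps add_ac)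
  also have "\<dots> \<le> norm (L s (star x * x)) + norm (L s (star x * y)) + (norm (L s (star y * x)) + norm (L s (star y * y)))"
    by (meson add_mono norm_triangle_ineq norm_triangle_mono order_refl)
  also have "\<dots> \<le> (N s x)\<^sup>2 + N s x * N s y + (N s y * N s x + (N s y)\<^sup>2)"
    by (intro add_mono Cauchy_Schwarz) (simp_all add: N_sq)
  finally show "(N s (x + y))\<^sup>2 \<le> (N s x + N s y)\<^sup>2" by (simp add: power2_sum)
qed simp

lemma N_triangle_diff: "N s (x - z) \<le> N s (x - y) + N s (y - z)"
  using N_triangle[of s "x - y" "y - z"] by simp

lemma N_left: "N s (a * x) \<le> norm a * N s x"
proof (rule power2_le_imp_le)
  have "star (mult_of (star a * a)) = mult_of (star a * a)"
    by (simp add: star_mult star_star flip: star_hom_simps(4)[OF star_hom_mult_of])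
  then have "cpos ((norm a)\<^sup>2 *\<^sub>R 1 - mult_of (star a * a))"
    by (rule cpos_scalar_minus) (simp add: cstar_identity)
  then obtain q where q: "star q = q" "q * q = (norm a)\<^sup>2 *\<^sub>R 1 - mult_of (star a * a)"
    using cpos_sqrt by metis
  have "star (lmul q x) * lmul q x = star x * lmul (q * q) x"
    using q(1) by (simp add: lmul_adj lmul_times star_multiplier_def)
  also have "\<dots> = (norm a)\<^sup>2 *\<^sub>R (star x * x) - star (a * x) * (a * x)"
    by (simp add: q(2) lmul_diff_left scaleR_scaleC lmul_scaleC_left lmul_one star_mult mult.assoc
        right_diff_distrib mult_scaleC_right)
  finally have eq: "star (a * x) * (a * x) + star (lmul q x) * lmul q x = (norm a)\<^sup>2 *\<^sub>R (star x * x)"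
    by simp
  obtain v w where v: "L s (star (a * x) * (a * x)) = star v * v"
    and w: "L s (star (lmul q x) * lmul q x) = star w * w"
    by (metis L_positive)
  have "norm (star v * v) \<le> norm (star v * v + star w * w)" by (rule norm_star_mult_le_add)
  also have "star v * v + star w * w = (norm a)\<^sup>2 *\<^sub>R L s (star x * x)"
    using arg_cong[OF eq, of "L s"] by (simp only: L_linear_simps v w)
  finally show "(N s (a * x))\<^sup>2 \<le> (norm a * N s x)\<^sup>2"
    by (simp add: N_sq v power_mult_distrib)
qed simp

text \<open>By the module property, \<open>L s\<close> maps the square of
  \<open>x * \<alpha> s y\<close> to that of \<open>v * y\<close>, where \<open>star v * v\<close>
  is \<open>L s (star x * x)\<close>. The remaining \<open>L t\<close> is handled by
  \<open>N_left\<close>. Commutativity of the semigroup is what lets \<open>L s\<close> act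
  first.\<close>

lemma N_prod: "N (s + t) (x * \<alpha> s y) \<le> N s x * N t y"
proof -
  obtain v where v: "L s (star x * x) = star v * v" by (rule L_positive)
  have nv: "norm v = N s x"
    using cstar_identity[of v] by (simp add: pre_norm_def v)
  have eq: "star (x * \<alpha> s y) * (x * \<alpha> s y) = \<alpha> s (star y) * (star x * x * \<alpha> s y)"
    by (simp add: star_mult \<alpha>_simps mult.assoc)
  have "L s (star (x * \<alpha> s y) * (x * \<alpha> s y)) = star (v * y) * (v * y)"
    unfolding eq L_module L_module_right v by (simp add: star_mult mult.assoc)
  then have "N (s + t) (x * \<alpha> s y) = N t (v * y)"
    by (simp add: pre_norm_def add.commute[of s t] L_add)
  then show ?thesis using N_left[of t v y] by (simp add: nv)
qed

lemma N_zero_norm: "N 0 x = norm x"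
  by (simp add: pre_norm_def L_zero cstar_identity)

lemma N_right: "N s (x * \<alpha> s a) \<le> N s x * norm a"
  using N_prod[of s 0 x a] by (simp add: N_zero_norm)

text \<open>Lets norm limits in A, in particular along nets, pass to the fibres.\<close>

lemma N_bounded: obtains K where "0 \<le> K" "\<And>x. N s x \<le> K * norm x"
proof -
  obtain K where K: "0 \<le> K" "\<And>x. norm (L s x) \<le> norm x * K"
    using bounded_linear.nonneg_bounded[OF L_bounded_linear] by blast
  show thesis
  proof (rule that[of "sqrt K"])
    show "N s x \<le> sqrt K * norm x" for x
    proof (rule power2_le_imp_le)
      show "(N s x)\<^sup>2 \<le> (sqrt K * norm x)\<^sup>2"
        using K(2)[of "star x * x"] K(1) by (simp add: N_sq cstar_identity power_mult_distrib mult.commute)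
    qed (use K in simp)
  qed (use K in simp)
qed

end

section \<open>The fibres of the product system\<close>

context transfer_system
begin

abbreviation Cs where "Cs s \<equiv> Cauchy_seqs \<alpha> L s"
abbreviation cls where "cls s \<equiv> seq_class \<alpha> L s"

lemma Cs_pre_fibre: "x \<in> Cs s \<Longrightarrow> x n \<in> pre_fibre \<alpha> s"
  by (simp add: Cauchy_seqs_def)

text \<open>One criterion for all operations: they are Lipschitz on bounded sets. Unary operations
  take \<open>y = x\<close>, and \<open>r = 0\<close> covers sequences in A itself.\<close>

lemma Cs_I:
  assumes x: "x \<in> Cs s" and y: "y \<in> Cs t" and z: "\<And>n. z n \<in> pre_fibre \<alpha> r" and C: "0 \<le> C"
    and le: "\<And>m n. N r (z m - z n) \<le> C * (N s (x m - x n) + N t (y m - y n))"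
  shows "z \<in> Cs r"
  unfolding Cauchy_seqs_def mem_Collect_eq
proof (intro conjI allI impI)
  fix e :: real assume "0 < e"
  then have e: "0 < e / (2 * (C + 1))" using C by simp
  obtain N1 where N1: "\<And>m n. m \<ge> N1 \<Longrightarrow> n \<ge> N1 \<Longrightarrow> N s (x m - x n) < e / (2 * (C + 1))"
    using x e unfolding Cauchy_seqs_def by blast
  obtain N2 where N2: "\<And>m n. m \<ge> N2 \<Longrightarrow> n \<ge> N2 \<Longrightarrow> N t (y m - y n) < e / (2 * (C + 1))"
    using y e unfolding Cauchy_seqs_def by blast
  have "N r (z m - z n) < e" if "m \<ge> max N1 N2" "n \<ge> max N1 N2" for m n
  proof -
    have "N s (x m - x n) + N t (y m - y n) < e / (C + 1)"
      using N1[of m n] N2[of m n] that C by (simp add: field_simps)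
    then have "(C + 1) * (N s (x m - x n) + N t (y m - y n)) < e"
      using C by (simp add: field_simps)
    moreover have "C * (N s (x m - x n) + N t (y m - y n)) \<le> (C + 1) * (N s (x m - x n) + N t (y m - y n))"
      by (intro mult_right_mono) simp_all
    ultimately show ?thesis using le[of m n] by linarith
  qed
  then show "\<exists>K. \<forall>m\<ge>K. \<forall>n\<ge>K. N r (z m - z n) < e" by blast
qed (rule z)

lemma Cs_const: "x \<in> pre_fibre \<alpha> s \<Longrightarrow> (\<lambda>_. x) \<in> Cs s"
  by (simp add: Cauchy_seqs_def)

lemma Cs_bounded:
  assumes "x \<in> Cs s"
  obtains K where "0 \<le> K" "\<And>n. N s (x n) \<le> K"
proof -
  obtain M where M: "\<And>m n. m \<ge> M \<Longrightarrow> n \<ge> M \<Longrightarrow> N s (x m - x n) < 1"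
    using assms unfolding Cauchy_seqs_def using zero_less_one by blast
  define K where "K = Max ((\<lambda>n. N s (x n)) ` {..M}) + 1"
  have le: "N s (x n) \<le> K - 1" if "n \<le> M" for n
    unfolding K_def using that by simp
  show thesis
  proof (rule that)
    show "0 \<le> K" using le[of 0] N_nonneg[of s "x 0"] by linarith
    show "N s (x n) \<le> K" for n
    proof (cases "n \<le> M")
      case False
      then show ?thesis using N_triangle[of s "x n - x M" "x M"] M[of n M] le[of M] by simp
    qed (use le[of n] in simp)
  qed
qed

lemma Cs_add: "x \<in> Cs s \<Longrightarrow> y \<in> Cs s \<Longrightarrow> (\<lambda>n. x n + y n) \<in> Cs s"
proof (rule Cs_I[of x s y s _ s 1])
  show "N s (x m + y m - (x n + y n)) \<le> 1 * (N s (x m - x n) + N s (y m - y n))" for m n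
    using N_triangle[of s "x m - x n" "y m - y n"] by (simp add: add_diff_add)
qed (simp_all add: pre_fibre_closed Cs_pre_fibre)

lemma Cs_scale: "x \<in> Cs s \<Longrightarrow> (\<lambda>n. c *\<^sub>C x n) \<in> Cs s"
proof (rule Cs_I[of x s x s _ s "cmod c"])
  show "N s (c *\<^sub>C x m - c *\<^sub>C x n) \<le> cmod c * (N s (x m - x n) + N s (x m - x n))" for m n
    by (simp add: N_scale mult_left_mono flip: scaleC_diff_right)
qed (simp_all add: pre_fibre_closed Cs_pre_fibre)

lemma Cs_left: "x \<in> Cs s \<Longrightarrow> (\<lambda>n. a * x n) \<in> Cs s"
proof (rule Cs_I[of x s x s _ s "norm a"])
  show "N s (a * x m - a * x n) \<le> norm a * (N s (x m - x n) + N s (x m - x n))" for m n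
    using N_left[of s a "x m - x n"]
    by (simp add: right_diff_distrib) (smt (verit) N_nonneg mult_left_mono norm_ge_zero)
qed (simp_all add: pre_fibre_closed Cs_pre_fibre)

lemma N_prod_diff:
  "N (s + t) (x * \<alpha> s y - x' * \<alpha> s y') \<le> N s (x - x') * N t y + N s x' * N t (y - y')"
proof -
  have "x * \<alpha> s y - x' * \<alpha> s y' = (x - x') * \<alpha> s y + x' * \<alpha> s (y - y')"
    by (simp add: algebra_simps linear_diff[OF star_hom_linear[OF \<alpha>_hom]])
  then show ?thesis
    using N_triangle[of "s + t" "(x - x') * \<alpha> s y" "x' * \<alpha> s (y - y')"]
      N_prod[of s t "x - x'" y] N_prod[of s t x' "y - y'"] by simp
qed

lemma Cs_prod:
  assumes x: "x \<in> Cs s" and y: "y \<in> Cs t"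
  shows "(\<lambda>n. x n * \<alpha> s (y n)) \<in> Cs (s + t)"
proof -
  obtain K where K: "0 \<le> K" "\<And>n. N s (x n) \<le> K" using Cs_bounded[OF x] by blast
  obtain M where M: "0 \<le> M" "\<And>n. N t (y n) \<le> M" using Cs_bounded[OF y] by blast
  show ?thesis
  proof (rule Cs_I[OF x y, of _ _ "K + M"])
    show "x n * \<alpha> s (y n) \<in> pre_fibre \<alpha> (s + t)" for n
      by (rule prod_pre_fibre[OF Cs_pre_fibre[OF y]])
    fix m n
    have "N (s + t) (x m * \<alpha> s (y m) - x n * \<alpha> s (y n))
        \<le> N s (x m - x n) * N t (y m) + N s (x n) * N t (y m - y n)"
      by (rule N_prod_diff)
    also have "\<dots> \<le> N s (x m - x n) * (K + M) + (K + M) * N t (y m - y n)"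
      using K(2)[of n] M(2)[of m] K(1) M(1)
      by (intro add_mono mult_left_mono mult_right_mono) simp_all
    finally show "N (s + t) (x m * \<alpha> s (y m) - x n * \<alpha> s (y n)) \<le> (K + M) * (N s (x m - x n) + N t (y m - y n))"
      by (simp add: algebra_simps)
  qed (use K M in simp)
qed

lemma Cs_right: "x \<in> Cs s \<Longrightarrow> (\<lambda>n. x n * \<alpha> s a) \<in> Cs s"
  using Cs_prod[OF _ Cs_const[OF pre_fibre_zero], of x s a] by simp

lemma cls_eq:
  assumes "(\<lambda>n. N s (x n - y n)) \<longlonglongrightarrow> 0"
  shows "cls s x = cls s y"
proof -
  have *: "(\<lambda>n. N s (y n - z n)) \<longlonglongrightarrow> 0"
    if "(\<lambda>n. N s (x n - y n)) \<longlonglongrightarrow> 0" "(\<lambda>n. N s (x n - z n)) \<longlonglongrightarrow> 0" for x y z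
  proof (rule tendsto_sandwich[OF _ _ tendsto_const])
    show "(\<lambda>n. N s (x n - y n) + N s (x n - z n)) \<longlonglongrightarrow> 0"
      using tendsto_add[OF that] by simp
    show "\<forall>\<^sub>F n in sequentially. N s (y n - z n) \<le> N s (x n - y n) + N s (x n - z n)"
      using N_triangle_diff[of s "y _" "z _" "x _"] by (simp add: N_minus_commute[of s "y _" "x _"])
  qed simp
  have "(\<lambda>n. N s (y n - x n)) \<longlonglongrightarrow> 0" using assms by (simp add: N_minus_commute)
  with assms show ?thesis unfolding seq_class_def using * by blast
qed

text \<open>\<open>seq_of\<close> selects an arbitrary representative. That it is Cauchy and
  equivalent to any given one is all that is used to compute the operations on classes.\<close>

lemma seq_of_cls:
  assumes "x \<in> Cs s"
  shows "seq_of (cls s x) \<in> Cs s" and "(\<lambda>n. N s (x n - seq_of (cls s x) n)) \<longlonglongrightarrow> 0"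
proof -
  have "x \<in> cls s x" using assms by (simp add: seq_class_def)
  then have "seq_of (cls s x) \<in> cls s x" unfolding seq_of_def by (rule someI[of "\<lambda>y. y \<in> cls s x"])
  then show "seq_of (cls s x) \<in> Cs s" "(\<lambda>n. N s (x n - seq_of (cls s x) n)) \<longlonglongrightarrow> 0"
    by (simp_all add: seq_class_def)
qed

lemma cls_in_fibre: "x \<in> Cs s \<Longrightarrow> cls s x \<in> fibre \<alpha> L s"
  by (simp add: fibre_def)

lemma fibre_seq:
  assumes "U \<in> fibre \<alpha> L s"
  shows "seq_of U \<in> Cs s" "cls s (seq_of U) = U"
proof -
  obtain x where x: "x \<in> Cs s" "U = cls s x" using assms by (auto simp: fibre_def)
  show "seq_of U \<in> Cs s" "cls s (seq_of U) = U"
    using seq_of_cls[OF x(1)] cls_eq[of s x "seq_of (cls s x)"] by (simp_all add: x(2))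
qed

section \<open>Operations on classes, independently of the representatives\<close>

lemma L_inner_tendsto:
  assumes "(\<lambda>n. N s (x n - x' n)) \<longlonglongrightarrow> 0" "(\<lambda>n. N s (y n - y' n)) \<longlonglongrightarrow> 0" "x \<in> Cs s" "y' \<in> Cs s"
  shows "(\<lambda>n. L s (star (x n) * y n) - L s (star (x' n) * y' n)) \<longlonglongrightarrow> 0"
proof -
  obtain K where K: "0 \<le> K" "\<And>n. N s (x n) \<le> K" using Cs_bounded[OF assms(3)] by blast
  obtain M where M: "0 \<le> M" "\<And>n. N s (y' n) \<le> M" using Cs_bounded[OF assms(4)] by blast
  have "(\<lambda>n. K * N s (y n - y' n) + N s (x n - x' n) * M) \<longlonglongrightarrow> K * 0 + 0 * M"
    by (intro tendsto_intros assms)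
  then have "(\<lambda>n. K * N s (y n - y' n) + N s (x n - x' n) * M) \<longlonglongrightarrow> 0" by simp
  moreover have "\<forall>\<^sub>F n in sequentially. norm (L s (star (x n) * y n) - L s (star (x' n) * y' n))
      \<le> K * N s (y n - y' n) + N s (x n - x' n) * M"
  proof (rule always_eventually, rule allI)
    fix n
    have "L s (star (x n) * y n) - L s (star (x' n) * y' n)
        = L s (star (x n) * (y n - y' n)) + L s (star (x n - x' n) * y' n)"
      by (simp add: star_diff algebra_simps L_linear_simps)
    also have "norm \<dots> \<le> N s (x n) * N s (y n - y' n) + N s (x n - x' n) * N s (y' n)"
      by (meson norm_triangle_mono Cauchy_Schwarz)
    also have "\<dots> \<le> K * N s (y n - y' n) + N s (x n - x' n) * M"
      by (intro add_mono mult_left_mono mult_right_mono K M) simp_all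
    finally show "norm (L s (star (x n) * y n) - L s (star (x' n) * y' n))
      \<le> K * N s (y n - y' n) + N s (x n - x' n) * M" .
  qed
ultimately show ?thesis by (rule Lim_null_comparison[rotated])
qed

lemma L_inner_convergent:
  assumes x: "x \<in> Cs s" and y: "y \<in> Cs s"
  shows "convergent (\<lambda>n. L s (star (x n) * y n))"
proof -
  obtain K where K: "0 \<le> K" "\<And>n. N s (x n) \<le> K" using Cs_bounded[OF x] by blast
  obtain M where M: "0 \<le> M" "\<And>n. N s (y n) \<le> M" using Cs_bounded[OF y] by blast
  \<comment> \<open>Over 0 the seminorm is the norm of A and the pre-fibre is all of A, so ordinary
    Cauchy sequences are an instance of \<open>Cs_I\<close>.\<close>
  have "(\<lambda>n. L s (star (x n) * y n)) \<in> Cs 0"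
  proof (rule Cs_I[OF x y, of _ _ "K + M"])
    fix m n
    have "L s (star (x m) * y m) - L s (star (x n) * y n)
        = L s (star (x n) * (y m - y n)) + L s (star (x m - x n) * y m)"
      by (simp add: star_diff algebra_simps L_linear_simps)
    also have "norm \<dots> \<le> N s (x n) * N s (y m - y n) + N s (x m - x n) * N s (y m)"
      by (meson norm_triangle_mono Cauchy_Schwarz)
    also have "\<dots> \<le> (K + M) * N s (y m - y n) + N s (x m - x n) * (K + M)"
      using K(2)[of n] M(2)[of m] K(1) M(1)
      by (intro add_mono mult_left_mono mult_right_mono) simp_all
    finally show "N 0 (L s (star (x m) * y m) - L s (star (x n) * y n))
      \<le> (K + M) * (N s (x m - x n) + N s (y m - y n))"
      by (simp add: N_zero_norm algebra_simps)
  qed (use K M in simp_all)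
  then have "Cauchy (\<lambda>n. L s (star (x n) * y n))"
    by (auto simp: Cauchy_seqs_def N_zero_norm Cauchy_def dist_norm)
  then show ?thesis by (rule Cauchy_convergent)
qed

lemma fibre_inner_tendsto:
  assumes "U \<in> fibre \<alpha> L s" "V \<in> fibre \<alpha> L s"
  shows "(\<lambda>n. L s (star (seq_of U n) * seq_of V n)) \<longlonglongrightarrow> fibre_inner L s U V"
  unfolding fibre_inner_def
  using L_inner_convergent[OF fibre_seq(1)[OF assms(1)] fibre_seq(1)[OF assms(2)]]
  by (simp add: convergent_LIMSEQ_iff)

lemma fibre_inner_cls:
  assumes "x \<in> Cs s" "y \<in> Cs s"
  shows "(\<lambda>n. L s (star (x n) * y n)) \<longlonglongrightarrow> fibre_inner L s (cls s x) (cls s y)"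
  using tendsto_add[OF L_inner_tendsto[OF seq_of_cls(2)[OF assms(1)] seq_of_cls(2)[OF assms(2)] assms(1)
        seq_of_cls(1)[OF assms(2)]]
      fibre_inner_tendsto[OF cls_in_fibre[OF assms(1)] cls_in_fibre[OF assms(2)]]]
  by simp

lemma fibre_add_cls:
  assumes "x \<in> Cs s" "y \<in> Cs s"
  shows "fibre_add \<alpha> L s (cls s x) (cls s y) = cls s (\<lambda>n. x n + y n)"
  unfolding fibre_add_def
proof (rule cls_eq, rule tendsto_sandwich[OF _ _ tendsto_const])
  show "(\<lambda>n. N s (x n - seq_of (cls s x) n) + N s (y n - seq_of (cls s y) n)) \<longlonglongrightarrow> 0"
    using tendsto_add[OF seq_of_cls(2)[OF assms(1)] seq_of_cls(2)[OF assms(2)]] by simp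
  show "\<forall>\<^sub>F n in sequentially. N s (seq_of (cls s x) n + seq_of (cls s y) n - (x n + y n))
      \<le> N s (x n - seq_of (cls s x) n) + N s (y n - seq_of (cls s y) n)"
  proof (rule always_eventually, rule allI)
    fix n
    show "N s (seq_of (cls s x) n + seq_of (cls s y) n - (x n + y n))
      \<le> N s (x n - seq_of (cls s x) n) + N s (y n - seq_of (cls s y) n)"
      using N_triangle[of s "x n - seq_of (cls s x) n" "y n - seq_of (cls s y) n"]
      by (subst N_minus_commute) (simp add: add_diff_add)
  qed
qed simp

lemma fibre_scale_cls:
  assumes "x \<in> Cs s"
  shows "fibre_scale \<alpha> L s c (cls s x) = cls s (\<lambda>n. c *\<^sub>C x n)"
  unfolding fibre_scale_def
proof (rule cls_eq)
  have "(\<lambda>n. cmod c * N s (x n - seq_of (cls s x) n)) \<longlonglongrightarrow> cmod c * 0"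
    by (intro tendsto_intros seq_of_cls assms)
  then show "(\<lambda>n. N s (c *\<^sub>C seq_of (cls s x) n - c *\<^sub>C x n)) \<longlonglongrightarrow> 0"
    by (simp add: N_scale N_minus_commute[of s "x _"] flip: scaleC_diff_right)
qed

lemma left_act_cls:
  assumes "x \<in> Cs s"
  shows "left_act \<alpha> L s a (cls s x) = cls s (\<lambda>n. a * x n)"
  unfolding left_act_def
proof (rule cls_eq, rule tendsto_sandwich[OF _ _ tendsto_const])
  have "(\<lambda>n. norm a * N s (x n - seq_of (cls s x) n)) \<longlonglongrightarrow> norm a * 0"
    by (intro tendsto_intros seq_of_cls assms)
  then show "(\<lambda>n. norm a * N s (seq_of (cls s x) n - x n)) \<longlonglongrightarrow> 0"
    by (simp add: N_minus_commute[of s "x _"])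
  show "\<forall>\<^sub>F n in sequentially. N s (a * seq_of (cls s x) n - a * x n) \<le> norm a * N s (seq_of (cls s x) n - x n)"
    by (simp add: N_left flip: right_diff_distrib)
qed simp

lemma ps_mult_cls:
  assumes x: "x \<in> Cs s" and y: "y \<in> Cs t"
  shows "ps_mult \<alpha> L (s, cls s x) (t, cls t y) = (s + t, cls (s + t) (\<lambda>n. x n * \<alpha> s (y n)))"
proof -
  let ?x = "seq_of (cls s x)" and ?y = "seq_of (cls t y)"
  obtain K where K: "0 \<le> K" "\<And>n. N t (?y n) \<le> K" using Cs_bounded[OF seq_of_cls(1)[OF y]] by blast
  obtain M where M: "0 \<le> M" "\<And>n. N s (x n) \<le> M" using Cs_bounded[OF x] by blast
  have "(\<lambda>n. N (s + t) (?x n * \<alpha> s (?y n) - x n * \<alpha> s (y n))) \<longlonglongrightarrow> 0"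
  proof (rule tendsto_sandwich[OF _ _ tendsto_const])
    have "(\<lambda>n. N s (x n - ?x n) * K + M * N t (y n - ?y n)) \<longlonglongrightarrow> 0 * K + M * 0"
      by (intro tendsto_intros seq_of_cls x y)
    then show "(\<lambda>n. N s (x n - ?x n) * K + M * N t (y n - ?y n)) \<longlonglongrightarrow> 0" by simp
    show "\<forall>\<^sub>F n in sequentially. N (s + t) (?x n * \<alpha> s (?y n) - x n * \<alpha> s (y n))
        \<le> N s (x n - ?x n) * K + M * N t (y n - ?y n)"
    proof (rule always_eventually, rule allI)
      fix n
      have "N (s + t) (?x n * \<alpha> s (?y n) - x n * \<alpha> s (y n)) \<le> N s (?x n - x n) * N t (?y n) + N s (x n) * N t (?y n - y n)"
        by (rule N_prod_diff)
      also have "\<dots> \<le> N s (?x n - x n) * K + M * N t (?y n - y n)"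
        by (intro add_mono mult_left_mono mult_right_mono K M) simp_all
      finally show "N (s + t) (?x n * \<alpha> s (?y n) - x n * \<alpha> s (y n)) \<le> N s (x n - ?x n) * K + M * N t (y n - ?y n)"
        by (simp add: N_minus_commute)
    qed
  qed simp
  then show ?thesis unfolding ps_mult_def by (auto intro!: cls_eq)
qed

lemma right_act_cls:
  assumes "x \<in> Cs s"
  shows "right_act \<alpha> L s (cls s x) a = cls s (\<lambda>n. x n * \<alpha> s a)"
  unfolding right_act_def
proof (rule cls_eq, rule tendsto_sandwich[OF _ _ tendsto_const])
  have "(\<lambda>n. N s (x n - seq_of (cls s x) n) * norm a) \<longlonglongrightarrow> 0 * norm a"
    by (intro tendsto_intros seq_of_cls assms)
  then show "(\<lambda>n. N s (seq_of (cls s x) n - x n) * norm a) \<longlonglongrightarrow> 0"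
    by (simp add: N_minus_commute[of s "x _"])
  show "\<forall>\<^sub>F n in sequentially. N s (seq_of (cls s x) n * \<alpha> s a - x n * \<alpha> s a) \<le> N s (seq_of (cls s x) n - x n) * norm a"
    by (simp add: N_right flip: left_diff_distrib)
qed simp

end

section \<open>The Toeplitz algebra as a crossed product\<close>

text \<open>Closed sets suffice as \<open>C\<close> because the elements of the product system are
  mapped to norm limits of products of i_A(a) and i_S(s).\<close>

lemma cstar_generated_eq_UNIV:
  assumes "cstar_generated G = UNIV"
    and "\<And>C. closed C \<Longrightarrow> H \<subseteq> C \<Longrightarrow> 0 \<in> C \<Longrightarrow> G \<subseteq> C"
  shows "cstar_generated H = UNIV"
proof -
  have "x \<in> C" if "H \<subseteq> C \<and> closed C \<and> 0 \<in> C \<and>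
     (\<forall>x\<in>C. \<forall>y\<in>C. x + y \<in> C \<and> x * y \<in> C) \<and> (\<forall>x\<in>C. star x \<in> C \<and> (\<forall>c. c *\<^sub>C x \<in> C))" for x C
  proof -
    have "G \<subseteq> C" using that assms(2) by simp
    moreover have "x \<in> cstar_generated G" using assms(1) by simp
    ultimately show ?thesis using that unfolding cstar_generated_def by blast
  qed
  then show ?thesis unfolding cstar_generated_def by blast
qed

lemma subspace_closure:
  fixes S :: "'a::real_normed_vector set"
  assumes S: "subspace S"
  shows "subspace (closure S)"
proof (rule subspaceI)
  show "0 \<in> closure S" using subspace_0[OF S] closure_subset by blast
  show "x + y \<in> closure S" if xy: "x \<in> closure S" "y \<in> closure S" for x y
  proof -
    obtain X Y where "\<And>n. X n \<in> S" "X \<longlonglongrightarrow> x" "\<And>n. Y n \<in> S" "Y \<longlonglongrightarrow> y"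
      using xy unfolding closure_sequential by blast
    then show ?thesis
      unfolding closure_sequential using tendsto_add[of X x sequentially Y y] subspace_add[OF S]
      by (intro exI[of _ "\<lambda>n. X n + Y n"]) simp
  qed
  show "c *\<^sub>R x \<in> closure S" if x: "x \<in> closure S" for c x
  proof -
    obtain X where "\<And>n. X n \<in> S" "X \<longlonglongrightarrow> x"
      using x unfolding closure_sequential by blast
    then show ?thesis
      unfolding closure_sequential using tendsto_scaleR[OF tendsto_const, of X x sequentially c] subspace_scale[OF S]
      by (intro exI[of _ "\<lambda>n. c *\<^sub>R X n"]) simp
  qed
qed

lemma toeplitz_repD:
  assumes "toeplitz_rep \<alpha> L \<psi>"
  shows "u \<in> product_system \<alpha> L \<Longrightarrow> v \<in> product_system \<alpha> L \<Longrightarrow> \<psi> (ps_mult \<alpha> L u v) = \<psi> u * \<psi> v"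
    and "star_hom (coeff_map \<alpha> L \<psi>)"
    and "U \<in> fibre \<alpha> L s \<Longrightarrow> V \<in> fibre \<alpha> L s \<Longrightarrow> \<psi> (s, fibre_add \<alpha> L s U V) = \<psi> (s, U) + \<psi> (s, V)"
    and "U \<in> fibre \<alpha> L s \<Longrightarrow> \<psi> (s, fibre_scale \<alpha> L s c U) = c *\<^sub>C \<psi> (s, U)"
    and "U \<in> fibre \<alpha> L s \<Longrightarrow> \<psi> (s, right_act \<alpha> L s U a) = \<psi> (s, U) * coeff_map \<alpha> L \<psi> a"
    and "U \<in> fibre \<alpha> L s \<Longrightarrow> V \<in> fibre \<alpha> L s \<Longrightarrow> star (\<psi> (s, U)) * \<psi> (s, V) = coeff_map \<alpha> L \<psi> (fibre_inner L s U V)"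
    and "U \<in> fibre \<alpha> L s \<Longrightarrow> \<psi> (s, left_act \<alpha> L s a U) = coeff_map \<alpha> L \<psi> a * \<psi> (s, U)"
  using assms unfolding toeplitz_rep_def by simp_all

context transfer_system
begin

lemma fibre_of_cls: "fibre_of \<alpha> L s x = cls s (\<lambda>_. x)"
  by (simp add: fibre_of_def)

text \<open>Needed because the unit is not assumed self-adjoint; see
  \<open>iA_approximate_unit\<close>.\<close>

lemma approximate_unit_star: "approximate_unit (\<lambda>i. star (u i)) F"
proof -
  have "((\<lambda>i. star (star a * u i)) \<longlongrightarrow> star (star a)) F" "((\<lambda>i. star (u i * star a)) \<longlongrightarrow> star (star a)) F" for a
    by (intro bounded_linear.tendsto[OF bounded_linear_star] u_left u_right)+
  then show ?thesis using F_ne u_bd by (simp add: approximate_unit_def star_mult star_star)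
qed

end

text \<open>The universal property is kept apart: it refers to a particular Hilbert space and is a
  hypothesis of \<open>rep_of_covariant_rep\<close>.\<close>

locale toeplitz_system = transfer_system \<alpha> L u F
  for \<alpha> L :: "'s::comm_monoid_add \<Rightarrow> 'a::cstar_algebra \<Rightarrow> 'a" and u :: "'i \<Rightarrow> 'a" and F +
  fixes iX :: "'s \<times> (nat \<Rightarrow> 'a) set \<Rightarrow> 't::cstar_algebra"
  assumes rep: "toeplitz_rep \<alpha> L iX"
    and isometric: "\<And>s U. U \<in> fibre \<alpha> L s \<Longrightarrow> norm (iX (s, U)) = sqrt (norm (fibre_inner L s U U))"
    and generated: "cstar_generated (iX ` product_system \<alpha> L) = UNIV"
begin

abbreviation E where "E s x \<equiv> iX (s, fibre_of \<alpha> L s x)"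
abbreviation iA where "iA a \<equiv> iX (0, fibre_of \<alpha> L 0 a)"

lemma coeff_map_iX: "coeff_map \<alpha> L iX a = iA a"
  by (simp add: coeff_map_def)

lemma iX_add: "x \<in> Cs s \<Longrightarrow> y \<in> Cs s \<Longrightarrow> iX (s, cls s (\<lambda>n. x n + y n)) = iX (s, cls s x) + iX (s, cls s y)"
  by (simp add: toeplitz_repD(3)[OF rep] cls_in_fibre flip: fibre_add_cls)

lemma iX_scale: "x \<in> Cs s \<Longrightarrow> iX (s, cls s (\<lambda>n. c *\<^sub>C x n)) = c *\<^sub>C iX (s, cls s x)"
  by (simp add: toeplitz_repD(4)[OF rep] cls_in_fibre flip: fibre_scale_cls)

lemma iX_diff:
  assumes "x \<in> Cs s" "y \<in> Cs s"
  shows "(\<lambda>n. x n - y n) \<in> Cs s" "iX (s, cls s (\<lambda>n. x n - y n)) = iX (s, cls s x) - iX (s, cls s y)"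
  using Cs_add[OF assms(1) Cs_scale[OF assms(2), of "-1"]]
    iX_add[OF assms(1) Cs_scale[OF assms(2), of "-1"]] iX_scale[OF assms(2), of "-1"]
  by (simp_all add: scaleC_minus_left)

lemma N_tendsto_norm_iX:
  assumes "x \<in> Cs s"
  shows "(\<lambda>n. N s (x n)) \<longlonglongrightarrow> norm (iX (s, cls s x))"
  unfolding isometric[OF cls_in_fibre[OF assms]] pre_norm_def
  by (intro tendsto_real_sqrt tendsto_norm fibre_inner_cls assms)

lemma E_diff: "x \<in> pre_fibre \<alpha> s \<Longrightarrow> y \<in> pre_fibre \<alpha> s \<Longrightarrow> E s (x - y) = E s x - E s y"
  using iX_diff(2)[OF Cs_const Cs_const] by (simp add: fibre_of_cls)

lemma norm_E: "x \<in> pre_fibre \<alpha> s \<Longrightarrow> norm (E s x) = N s x"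
  using LIMSEQ_unique[OF tendsto_const N_tendsto_norm_iX[OF Cs_const]] by (simp add: fibre_of_cls)

text \<open>Makes the elements \<open>E s x\<close> dense in the image of each fibre, so that closed
  conditions on the generators need be checked only for them.\<close>

lemma E_tendsto_iX:
  assumes x: "x \<in> Cs s"
  shows "(\<lambda>n. E s (x n)) \<longlonglongrightarrow> iX (s, cls s x)"
proof (rule LIMSEQ_I)
  fix e :: real assume "0 < e"
  then have "0 < e / 2" by simp
  then obtain M where M: "\<And>m n. m \<ge> M \<Longrightarrow> n \<ge> M \<Longrightarrow> N s (x m - x n) < e / 2"
    using x unfolding Cauchy_seqs_def by blast
  have "norm (E s (x n) - iX (s, cls s x)) < e" if n: "n \<ge> M" for n
  proof -
    have c: "(\<lambda>_. x n) \<in> Cs s" by (rule Cs_const[OF Cs_pre_fibre[OF x]])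
    \<comment> \<open>Since i_X is isometric, this norm is the limit of
      \<open>N s (x m - x n)\<close> as \<open>m\<close> grows with \<open>n\<close> fixed.\<close>
    have "norm (iX (s, cls s (\<lambda>m. x m - x n))) \<le> e / 2"
      by (rule LIMSEQ_le_const2[OF N_tendsto_norm_iX[OF iX_diff(1)[OF x c]]])
        (use M n less_imp_le in blast)
    then show ?thesis
      using \<open>0 < e\<close> by (simp add: iX_diff(2)[OF x c] fibre_of_cls norm_minus_commute)
  qed
  then show "\<exists>M. \<forall>n\<ge>M. norm (E s (x n) - iX (s, cls s x)) < e" by blast
qed

lemma iX_in_closed:
  assumes "closed C" "\<And>s x. x \<in> pre_fibre \<alpha> s \<Longrightarrow> E s x \<in> C"
  shows "iX ` product_system \<alpha> L \<subseteq> C"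
proof -
  have "iX (s, U) \<in> C" if "U \<in> fibre \<alpha> L s" for s U
    using closed_sequentially[OF assms(1) _ E_tendsto_iX[OF fibre_seq(1)[OF that]]]
      assms(2)[OF Cs_pre_fibre[OF fibre_seq(1)[OF that]]]
    by (simp add: fibre_seq(2)[OF that])
  then show ?thesis by (auto simp: product_system_def)
qed

lemma iA_hom: "star_hom (\<lambda>a. iA a)"
  using toeplitz_repD(2)[OF rep] by (simp add: coeff_map_iX[abs_def])

lemmas iA_simps = star_hom_simps[OF iA_hom]

lemma norm_iA: "norm (iA a) = norm a"
  by (simp add: norm_E N_zero_norm)

lemma E_left: "x \<in> pre_fibre \<alpha> s \<Longrightarrow> iA a * E s x = E s (a * x)"
  using toeplitz_repD(7)[OF rep, of "fibre_of \<alpha> L s x" s a] left_act_cls[OF Cs_const, of x s a]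
  by (simp add: coeff_map_iX) (simp add: fibre_of_cls cls_in_fibre[OF Cs_const])

lemma E_right: "x \<in> pre_fibre \<alpha> s \<Longrightarrow> E s x * iA a = E s (x * \<alpha> s a)"
  using toeplitz_repD(5)[OF rep, of "fibre_of \<alpha> L s x" s a] right_act_cls[OF Cs_const, of x s a]
  by (simp add: coeff_map_iX) (simp add: fibre_of_cls cls_in_fibre[OF Cs_const])

lemma E_prod: "x \<in> pre_fibre \<alpha> s \<Longrightarrow> y \<in> pre_fibre \<alpha> t \<Longrightarrow> E s x * E t y = E (s + t) (x * \<alpha> s y)"
  using toeplitz_repD(1)[OF rep, of "(s, fibre_of \<alpha> L s x)" "(t, fibre_of \<alpha> L t y)"]
    ps_mult_cls[OF Cs_const Cs_const, of x s y t]
  by (simp add: product_system_def fibre_of_cls cls_in_fibre[OF Cs_const])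

lemma E_star:
  assumes "x \<in> pre_fibre \<alpha> s" "y \<in> pre_fibre \<alpha> s"
  shows "star (E s x) * E s y = iA (L s (star x * y))"
proof -
  have "fibre_inner L s (cls s (\<lambda>_. x)) (cls s (\<lambda>_. y)) = L s (star x * y)"
    using LIMSEQ_unique[OF fibre_inner_cls[OF Cs_const Cs_const] tendsto_const] assms by simp
  then show ?thesis
    using toeplitz_repD(6)[OF rep, of "fibre_of \<alpha> L s x" s "fibre_of \<alpha> L s y"] assms
    by (simp add: coeff_map_iX) (simp add: fibre_of_cls cls_in_fibre[OF Cs_const])
qed

lemma E_tendsto:
  assumes "(x \<longlongrightarrow> z) G" "\<And>i. x i \<in> pre_fibre \<alpha> s" "z \<in> pre_fibre \<alpha> s"
  shows "((\<lambda>i. E s (x i)) \<longlongrightarrow> E s z) G"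
proof -
  obtain K where K: "\<And>x. N s x \<le> K * norm x" using N_bounded by blast
  have le: "norm (E s (x i) - E s z) \<le> norm (x i - z) * K" for i
  proof -
    have "x i - z \<in> pre_fibre \<alpha> s"
      using pre_fibre_closed(1)[OF assms(2)[of i] pre_fibre_closed(2)[OF assms(3), of "-1"]]
      by (simp add: scaleC_minus_left)
    then have "norm (E s (x i) - E s z) = N s (x i - z)" by (simp add: assms norm_E flip: E_diff)
    also have "\<dots> \<le> norm (x i - z) * K" using K[of "x i - z"] by (simp only: mult.commute)
    finally show ?thesis .
  qed
  have lim: "((\<lambda>i. norm (x i - z) * K) \<longlongrightarrow> 0) G"
    by (rule tendsto_mult_left_zero) (use assms(1) in \<open>simp add: LIM_zero_iff tendsto_norm_zero_iff\<close>)
  have "((\<lambda>i. E s (x i) - E s z) \<longlongrightarrow> 0) G"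
    by (rule Lim_null_comparison[OF always_eventually lim]) (simp only: le simp_thms)
  then show ?thesis by (simp add: LIM_zero_iff)
qed

section \<open>Approximate units of A in the Toeplitz algebra\<close>

lemma E_approximate_unit:
  assumes v: "approximate_unit v F" and x: "x \<in> pre_fibre \<alpha> s"
  shows "((\<lambda>i. iA (v i) * E s x) \<longlongrightarrow> E s x) F" "((\<lambda>i. E s x * iA (v i)) \<longlongrightarrow> E s x) F"
proof -
  show "((\<lambda>i. iA (v i) * E s x) \<longlongrightarrow> E s x) F"
    unfolding E_left[OF x]
    by (rule E_tendsto) (use v x in \<open>auto simp: approximate_unit_def pre_fibre_closed\<close>)
  have "((\<lambda>i. x * \<alpha> s (v i)) \<longlongrightarrow> x) F"
    using tendsto_p[OF v, of x s] x by (simp add: pre_fibre_iff)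
  then show "((\<lambda>i. E s x * iA (v i)) \<longlongrightarrow> E s x) F"
    unfolding E_right[OF x]
    by (rule E_tendsto) (use x in \<open>auto simp: pre_fibre_closed \<alpha>_pre_fibre\<close>)
qed

lemma closed_approximate_unit:
  assumes v: "approximate_unit v F"
  shows "closed {t. ((\<lambda>i. iA (v i) * t) \<longlongrightarrow> t) F}" "closed {t. ((\<lambda>i. t * iA (v i)) \<longlongrightarrow> t) F}"
proof -
  have v1: "\<forall>\<^sub>F i in F. norm (iA (v i)) \<le> 1" using v by (simp add: approximate_unit_def norm_iA)
  have "\<forall>\<^sub>F i in F. \<forall>t. norm (iA (v i) * t) \<le> 1 * norm t" "\<forall>\<^sub>F i in F. \<forall>t. norm (t * iA (v i)) \<le> 1 * norm t"
    using v1
    by (auto elim!: eventually_mono intro!: order_trans[OF norm_mult_ineq] simp: mult_left_le mult_left_le_one_le)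
  then show "closed {t. ((\<lambda>i. iA (v i) * t) \<longlongrightarrow> t) F}" "closed {t. ((\<lambda>i. t * iA (v i)) \<longlongrightarrow> t) F}"
    using closed_bounded_net_tendsto[OF F_ne _ _ bounded_linear_ident, of "\<lambda>i t. iA (v i) * t" 1]
      closed_bounded_net_tendsto[OF F_ne _ _ bounded_linear_ident, of "\<lambda>i t. t * iA (v i)" 1]
    by (simp_all add: bounded_linear.linear bounded_linear_mult_left bounded_linear_mult_right)
qed

text \<open>The elements on which the net acts as a unit from both sides form a closed subalgebra.
  Taking adjoints exchanges left convergence for a net with right convergence for the adjoint net,
  so closure under \<open>star\<close> is obtained by treating \<open>u\<close> and its adjoint
  together.\<close>

lemma iA_approximate_unit: "approximate_unit (\<lambda>i. iA (u i)) F"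
proof -
  define C1 where "C1 v = {t. ((\<lambda>i. iA (v i) * t) \<longlongrightarrow> t) F}" for v
  define C2 where "C2 v = {t. ((\<lambda>i. t * iA (v i)) \<longlongrightarrow> t) F}" for v
  let ?v = "\<lambda>i. star (u i)"
  let ?C = "C1 u \<inter> C2 u \<inter> (C1 ?v \<inter> C2 ?v)"
  note units = au approximate_unit_star
  have cl: "closed ?C"
    unfolding C1_def C2_def by (intro closed_Int closed_approximate_unit units)
  moreover have "0 \<in> ?C" by (simp add: C1_def C2_def)
  moreover have "x + y \<in> ?C \<and> x * y \<in> ?C" if "x \<in> ?C" "y \<in> ?C" for x y
  proof -
    have "x + y \<in> C1 v \<and> x + y \<in> C2 v" if "x \<in> C1 v" "y \<in> C1 v" "x \<in> C2 v" "y \<in> C2 v" for v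
      using that unfolding C1_def C2_def by (auto simp: distrib_left distrib_right intro: tendsto_add)
    moreover have "x * y \<in> C1 v \<and> x * y \<in> C2 v" if "x \<in> C1 v" "y \<in> C2 v" for v
      using that tendsto_mult[OF _ tendsto_const, of "\<lambda>i. iA (v i) * x" x F y]
        tendsto_mult[OF tendsto_const, of "\<lambda>i. y * iA (v i)" y F x]
      by (simp add: C1_def C2_def mult.assoc)
    ultimately show ?thesis using that by blast
  qed
  moreover have "star x \<in> ?C \<and> (\<forall>c. c *\<^sub>C x \<in> ?C)" if x: "x \<in> ?C" for x
  proof
    have 1: "star x \<in> C1 (\<lambda>i. star (v i))" if "x \<in> C2 v" for v
      using bounded_linear.tendsto[OF bounded_linear_star, of _ x F] that
      by (fastforce simp: C1_def C2_def iA_simps star_mult)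
    have 2: "star x \<in> C2 (\<lambda>i. star (v i))" if "x \<in> C1 v" for v
      using bounded_linear.tendsto[OF bounded_linear_star, of _ x F] that
      by (fastforce simp: C1_def C2_def iA_simps star_mult)
    show "star x \<in> ?C" using 1[of u] 2[of u] 1[of ?v] 2[of ?v] x by (simp add: star_star)
    show "\<forall>c. c *\<^sub>C x \<in> ?C"
      using x bounded_linear.tendsto[OF bounded_linear_scaleC_right, of _ x F]
      by (simp add: C1_def C2_def mult_scaleC_left mult_scaleC_right)
  qed
  moreover have "iX ` product_system \<alpha> L \<subseteq> ?C"
    by (rule iX_in_closed[OF cl]) (simp add: C1_def C2_def E_approximate_unit units)
  ultimately have "cstar_generated (iX ` product_system \<alpha> L) \<subseteq> ?C"
    unfolding cstar_generated_def by (intro Inter_lower) blast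
  then show ?thesis
    using F_ne u_bd unfolding approximate_unit_def generated C1_def C2_def by (auto simp: norm_iA)
qed

lemma iA_left: "((\<lambda>i. iA (u i) * t) \<longlongrightarrow> t) F" and iA_right: "((\<lambda>i. t * iA (u i)) \<longlongrightarrow> t) F"
  using iA_approximate_unit by (auto simp: approximate_unit_def)

lemma nondegenerate_iA: "nondegenerate_hom (\<lambda>a. iA a)"
proof -
  have "t \<in> closure (span {iA a * b |a b. True})" for t
    by (rule Lim_in_closed_set[OF closed_closure _ F_ne iA_left])
      (auto intro!: always_eventually closure_subset[THEN subsetD] span_base)
  then show ?thesis using iA_hom by (auto simp: nondegenerate_hom_def)
qed

lemma inj_iA: "inj (\<lambda>a. iA a)"
proof (rule injI)
  fix a b assume "iA a = iA b"
  then have "iA (a - b) = 0" by (simp add: E_diff)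
  then show "a = b" using norm_iA[of "a - b"] by simp
qed

lemma iA_eqI: "(\<And>b. x * iA b = y * iA b) \<Longrightarrow> x = y"
  by (rule tendsto_unique[OF F_ne iA_right[of x]]) (simp add: iA_right)

lemma multiplier_iA_eqI:
  assumes "\<And>b. lmul m (iA b) = lmul n (iA b)"
  shows "m = n"
proof (rule lmul_eqI, rule tendsto_unique[OF F_ne])
  fix t
  show "((\<lambda>i. lmul m (iA (u i) * t)) \<longlongrightarrow> lmul m t) F"
    by (intro bounded_linear.tendsto[OF bounded_linear_lmul] iA_left)
  have "((\<lambda>i. lmul n (iA (u i) * t)) \<longlongrightarrow> lmul n t) F"
    by (intro bounded_linear.tendsto[OF bounded_linear_lmul] iA_left)
  then show "((\<lambda>i. lmul m (iA (u i) * t)) \<longlongrightarrow> lmul n t) F"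
    by (simp add: lmul_mult assms)
qed

section \<open>The isometry-like multipliers i_S(s): existence and relations\<close>

lemma E_\<alpha>_left: "((\<lambda>i. E s (\<alpha> s (u i)) * iA b) \<longlongrightarrow> E s (\<alpha> s b)) F"
proof -
  have "((\<lambda>i. \<alpha> s (u i * b)) \<longlongrightarrow> \<alpha> s b) F"
    by (intro bounded_linear.tendsto[OF star_hom_bounded_linear[OF \<alpha>_hom]] u_left)
  then have "((\<lambda>i. E s (\<alpha> s (u i * b))) \<longlongrightarrow> E s (\<alpha> s b)) F"
    by (rule E_tendsto) (simp_all add: \<alpha>_pre_fibre)
  then show ?thesis by (simp add: E_right \<alpha>_pre_fibre \<alpha>_simps)
qed

lemma E_\<alpha>_right: "((\<lambda>i. iA b * E s (\<alpha> s (u i))) \<longlongrightarrow> E s (rmul b (p s))) F"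
proof -
  have "((\<lambda>i. E s (b * \<alpha> s (u i))) \<longlongrightarrow> E s (rmul b (p s))) F"
    by (rule E_tendsto[OF tendsto_p[OF au]])
      (simp_all add: pre_fibre_closed \<alpha>_pre_fibre rmul_pre_fibre)
  then show ?thesis by (simp add: E_left \<alpha>_pre_fibre)
qed

lemma strict_limit_exists: "\<exists>m. strict_tendsto (\<lambda>i. mult_of (E s (\<alpha> s (u i)))) m F"
proof -
  obtain K where K: "0 \<le> K" "\<And>x. N s x \<le> K * norm x" using N_bounded by blast
  have bd: "\<forall>\<^sub>F i in F. norm (E s (\<alpha> s (u i))) \<le> K"
    using u_bd
  proof eventually_elim
    case (elim i)
    have "norm (E s (\<alpha> s (u i))) \<le> K * norm (\<alpha> s (u i))"
      by (simp add: norm_E \<alpha>_pre_fibre K)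
    also have "\<dots> \<le> K" using elim star_hom_contractive[OF \<alpha>_hom, of s "u i"] K by (simp add: mult_left_le)
    finally show ?case .
  qed
  let ?C1 = "{t. \<exists>l. ((\<lambda>i. E s (\<alpha> s (u i)) * t) \<longlongrightarrow> l) F}"
  let ?C2 = "{t. \<exists>l. ((\<lambda>i. t * E s (\<alpha> s (u i))) \<longlongrightarrow> l) F}"
  have "closed ?C1"
  proof (rule closed_bounded_net_convergent[OF F_ne])
    show "\<forall>\<^sub>F i in F. \<forall>t. norm (E s (\<alpha> s (u i)) * t) \<le> K * norm t"
      using bd by (auto elim!: eventually_mono intro!: order_trans[OF norm_mult_ineq] mult_right_mono)
  qed (rule bounded_linear.linear[OF bounded_linear_mult_right])
  moreover have "closed ?C2"
  proof (rule closed_bounded_net_convergent[OF F_ne])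
    show "\<forall>\<^sub>F i in F. \<forall>t. norm (t * E s (\<alpha> s (u i))) \<le> K * norm t"
      using bd
    proof eventually_elim
      case (elim i)
      then show ?case
        by (auto intro!: order_trans[OF norm_mult_ineq] simp: mult.commute[of K] mult_left_mono)
    qed
  qed (rule bounded_linear.linear[OF bounded_linear_mult_left])
  moreover have "iA b * t \<in> ?C1" for b t
    using tendsto_mult[OF E_\<alpha>_left tendsto_const, of s b t] by (auto simp: mult.assoc)
  moreover have "t * iA b \<in> ?C2" for b t
    using tendsto_mult[OF tendsto_const E_\<alpha>_right, of t b s] by (auto simp: mult.assoc)
  \<comment> \<open>Every \<open>t\<close> is a limit of \<open>iA (u i) * t\<close> and of
    \<open>t * iA (u i)\<close>, which lie in the closed sets \<open>?C1\<close> and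
    \<open>?C2\<close>.\<close>
  ultimately have "t \<in> ?C1" "t \<in> ?C2" for t
    using Lim_in_closed_set[OF _ _ F_ne iA_left, of ?C1 t] Lim_in_closed_set[OF _ _ F_ne iA_right, of ?C2 t]
    by simp_all
  then show ?thesis by (intro strict_tendsto_exists[OF F_ne bd]) auto
qed

definition iS :: "'s \<Rightarrow> 't multiplier" where
  "iS s = strict_Lim F (\<lambda>i. mult_of (E s (\<alpha> s (u i))))"

lemma iS_strict: "strict_tendsto (\<lambda>i. mult_of (E s (\<alpha> s (u i)))) (iS s) F"
  unfolding iS_def using strict_limit_exists[of s] strict_tendsto_Lim[OF F_ne] by metis

lemma lmul_iS_tendsto: "((\<lambda>i. E s (\<alpha> s (u i)) * t) \<longlongrightarrow> lmul (iS s) t) F"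
  and rmul_iS_tendsto: "((\<lambda>i. t * E s (\<alpha> s (u i))) \<longlongrightarrow> rmul t (iS s)) F"
  using iS_strict[of s] by (simp_all add: strict_tendsto_def)

lemma lmul_iS: "lmul (iS s) (iA b) = E s (\<alpha> s b)"
  by (rule tendsto_unique[OF F_ne lmul_iS_tendsto E_\<alpha>_left])

lemma rmul_iS: "rmul (iA b) (iS s) = E s (rmul b (p s))"
  by (rule tendsto_unique[OF F_ne rmul_iS_tendsto E_\<alpha>_right])

lemma semigroup_rep_iS: "semigroup_rep iS"
  unfolding semigroup_rep_def
proof (intro conjI allI)
  show "iS 0 = 1"
    by (rule multiplier_iA_eqI) (simp add: lmul_iS \<alpha>_zero lmul_one)
  show "iS (s + t) = iS s * iS t" for s t
  proof (rule multiplier_iA_eqI)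
    fix b
    \<comment> \<open>Here \<open>iS s\<close> acts on \<open>E t (\<alpha> t b)\<close>, which
      \<open>lmul_iS\<close> does not cover, so the value is computed from the defining strict
      limit.\<close>
    have "((\<lambda>i. \<alpha> s (u i * \<alpha> t b)) \<longlongrightarrow> \<alpha> s (\<alpha> t b)) F"
      by (intro bounded_linear.tendsto[OF star_hom_bounded_linear[OF \<alpha>_hom]] u_left)
    then have "((\<lambda>i. E (s + t) (\<alpha> s (u i * \<alpha> t b))) \<longlongrightarrow> E (s + t) (\<alpha> s (\<alpha> t b))) F"
    proof (rule E_tendsto)
      show "\<alpha> s (u i * \<alpha> t b) \<in> pre_fibre \<alpha> (s + t)" for i
        using prod_pre_fibre[OF \<alpha>_pre_fibre, of "\<alpha> s (u i)" s t b] by (simp add: \<alpha>_simps)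
      show "\<alpha> s (\<alpha> t b) \<in> pre_fibre \<alpha> (s + t)"
        using \<alpha>_pre_fibre[of "s + t" b] by (simp add: \<alpha>_add)
    qed
    then have "((\<lambda>i. E s (\<alpha> s (u i)) * E t (\<alpha> t b)) \<longlongrightarrow> E (s + t) (\<alpha> (s + t) b)) F"
      by (simp add: E_prod \<alpha>_pre_fibre \<alpha>_simps \<alpha>_add)
    then have "lmul (iS s) (E t (\<alpha> t b)) = E (s + t) (\<alpha> (s + t) b)"
      by (rule tendsto_unique[OF F_ne lmul_iS_tendsto])
    then show "lmul (iS (s + t)) (iA b) = lmul (iS s * iS t) (iA b)"
      by (simp add: lmul_times lmul_iS)
  qed
qed

lemma iS_covariant: "iS s * mult_of (iA a) = mult_of (iA (\<alpha> s a)) * iS s"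
  by (simp add: lmul_iS rmul_iS rmul_p flip: mult_of_lmul mult_of_rmul)

text \<open>The adjoint of \<open>iS s\<close> has no formula of its own. Its value at
  \<open>?t\<close> is found by pairing with \<open>iA b\<close>, which moves the adjoint to
  \<open>iS s\<close> acting on \<open>iA b\<close>; the Toeplitz inner product relation then
  produces \<open>L s\<close>.\<close>

lemma iS_transfer: "star (iS s) * mult_of (iA a) * iS s = mult_of (iA (L s a))"
proof (rule multiplier_iA_eqI)
  fix c
  let ?t = "E s (a * \<alpha> s c)"
  have t: "a * \<alpha> s c \<in> pre_fibre \<alpha> s" by (simp add: pre_fibre_closed \<alpha>_pre_fibre)
  have "star (lmul (star (iS s)) ?t) = star (iA (L s a * c))"
  proof (rule iA_eqI)
    fix b
    have "star (lmul (star (iS s)) ?t) * iA b = star ?t * E s (\<alpha> s b)"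
      by (simp add: star_multiplier_def lmul_adj' lmul_iS)
    also have "\<dots> = iA (L s (star (a * \<alpha> s c)) * b)"
      by (simp add: E_star t \<alpha>_pre_fibre L_module_right)
    also have "\<dots> = star (iA (L s a * c)) * iA b"
      by (simp only: L_star L_module_right iA_simps)
    finally show "star (lmul (star (iS s)) ?t) * iA b = star (iA (L s a * c)) * iA b" .
  qed
  then have "lmul (star (iS s)) ?t = iA (L s a * c)" by (metis star_star)
  then show "lmul (star (iS s) * mult_of (iA a) * iS s) (iA c) = lmul (mult_of (iA (L s a))) (iA c)"
    by (simp add: lmul_times lmul_iS E_left \<alpha>_pre_fibre)
qed

lemma generated_iA_iS: "cstar_generated {rmul (iA a) (iS s) |a s. True} = UNIV"
proof (rule cstar_generated_eq_UNIV[OF generated])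
  fix C assume C: "closed C" "{rmul (iA a) (iS s) |a s. True} \<subseteq> C"
  show "iX ` product_system \<alpha> L \<subseteq> C"
  proof (rule iX_in_closed[OF C(1)])
    fix s x assume "x \<in> pre_fibre \<alpha> s"
    then have "E s x = rmul (iA x) (iS s)" by (simp add: rmul_iS pre_fibre_iff)
    then show "E s x \<in> C" using C(2) by blast
  qed
qed

lemma rep_iA_nondegenerate:
  assumes nd: "nondegenerate_rep (\<sigma> :: 't \<Rightarrow> 'h::chilbert_space bop)"
  shows "nondegenerate_rep (\<sigma> \<circ> (\<lambda>a. iA a))"
proof -
  have \<sigma>: "star_hom \<sigma>" using nd by (simp add: nondegenerate_rep_def)
  let ?C = "closure (span {bop_apply ((\<sigma> \<circ> (\<lambda>a. iA a)) a) \<xi> |a \<xi>. True})"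
  have "bop_apply (\<sigma> b) \<xi> \<in> ?C" for b \<xi>
  proof (rule Lim_in_closed_set[OF closed_closure _ F_ne])
    show "((\<lambda>i. bop_apply (\<sigma> (iA (u i) * b)) \<xi>) \<longlongrightarrow> bop_apply (\<sigma> b) \<xi>) F"
      by (intro bounded_linear.tendsto[OF bounded_linear_bop_apply_left]
          bounded_linear.tendsto[OF star_hom_bounded_linear[OF \<sigma>]] iA_left)
    show "\<forall>\<^sub>F i in F. bop_apply (\<sigma> (iA (u i) * b)) \<xi> \<in> ?C"
      by (rule always_eventually) (auto simp: star_hom_simps(3)[OF \<sigma>] bop_apply_times
          intro!: closure_subset[THEN subsetD] span_base)
  qed
  then have "closure (span {bop_apply (\<sigma> a) \<xi> |a \<xi>. True}) \<subseteq> ?C"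
    by (intro closure_span_subset closed_closure subspace_closure subspace_span) auto
  moreover have "star_hom (\<sigma> \<circ> (\<lambda>a. iA a))"
    using \<sigma> iA_hom by (simp add: star_hom_def clinear_map_def)
  ultimately show ?thesis using nd unfolding nondegenerate_rep_def by blast
qed

lemma covariant_rep_of_rep:
  assumes nd: "nondegenerate_rep (\<sigma> :: 't \<Rightarrow> 'h::chilbert_space bop)"
  shows "toeplitz_covariant \<alpha> L (\<sigma> \<circ> (\<lambda>a. iA a)) (rep_extension \<sigma> \<circ> iS)"
proof -
  note \<tau> = rep_extension[OF nd iA_approximate_unit]
  note \<tau>s = star_hom_simps[OF \<tau>(1)]
  have "rep_extension \<sigma> 1 = 1"
    by (rule nondegenerate_rep_eqI[OF nd]) (simp add: star_hom_rep_mult[where \<sigma> = \<sigma>, OF \<tau>] lmul_one)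
  then have "semigroup_rep (rep_extension \<sigma> \<circ> iS)"
    using semigroup_rep_iS by (simp add: semigroup_rep_def \<tau>s)
  moreover have "rep_extension \<sigma> (iS s) * \<sigma> (iA a) = \<sigma> (iA (\<alpha> s a)) * rep_extension \<sigma> (iS s)" for s a
    using arg_cong[OF iS_covariant[of s a], of "rep_extension \<sigma>"] by (simp only: \<tau>s \<tau>(2))
  moreover have "star (rep_extension \<sigma> (iS s)) * \<sigma> (iA a) * rep_extension \<sigma> (iS s) = \<sigma> (iA (L s a))" for s a
    using arg_cong[OF iS_transfer[of s a], of "rep_extension \<sigma>"] by (simp only: \<tau>s \<tau>(2))
  ultimately show ?thesis
    using rep_iA_nondegenerate[OF nd] by (simp add: toeplitz_covariant_def)
qed

end

section \<open>The Toeplitz representation of a covariant representation\<close>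

locale covariant_rep = transfer_system \<alpha> L u F
  for \<alpha> L :: "'s::comm_monoid_add \<Rightarrow> 'a::cstar_algebra \<Rightarrow> 'a" and u :: "'i \<Rightarrow> 'a" and F +
  fixes \<pi> :: "'a \<Rightarrow> 'h::chilbert_space bop" and V :: "'s \<Rightarrow> 'h bop"
  assumes cov: "toeplitz_covariant \<alpha> L \<pi> V"
begin

lemma \<pi>_nondegenerate: "nondegenerate_rep \<pi>" and V_zero: "V 0 = 1" and V_add: "V (s + t) = V s * V t"
  and V_\<pi>: "V s * \<pi> a = \<pi> (\<alpha> s a) * V s" and V_\<pi>_V: "star (V s) * \<pi> a * V s = \<pi> (L s a)"
  using cov by (simp_all add: toeplitz_covariant_def semigroup_rep_def)

lemma \<pi>_hom: "star_hom \<pi>"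
  using \<pi>_nondegenerate by (simp add: nondegenerate_rep_def)

lemmas \<pi>_simps = star_hom_simps[OF \<pi>_hom]

lemma \<pi>V_inner: "star (\<pi> x * V s) * (\<pi> y * V s) = \<pi> (L s (star x * y))"
  by (simp add: star_mult \<pi>_simps mult.assoc flip: V_\<pi>_V)

text \<open>Contractivity for the seminorm is what makes x \<mapsto> \<pi>(x) V_s vanish on null
  vectors and extend to the completion.\<close>

lemma norm_\<pi>V: "norm (\<pi> x * V s) \<le> N s x"
proof (rule power2_le_imp_le)
  have "(norm (\<pi> x * V s))\<^sup>2 = norm (\<pi> (L s (star x * x)))"
    by (simp only: \<pi>V_inner flip: cstar_identity)
  also have "\<dots> \<le> (N s x)\<^sup>2" unfolding N_sq by (rule star_hom_contractive[OF \<pi>_hom])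
  finally show "(norm (\<pi> x * V s))\<^sup>2 \<le> (N s x)\<^sup>2" .
qed simp

lemma \<pi>V_diff: "\<pi> x * V s - \<pi> y * V s = \<pi> (x - y) * V s"
  by (simp add: linear_diff[OF star_hom_linear[OF \<pi>_hom]] left_diff_distrib)

definition \<psi> :: "'s \<times> (nat \<Rightarrow> 'a) set \<Rightarrow> 'h bop" where
  "\<psi> = (\<lambda>(s, U). lim (\<lambda>n. \<pi> (seq_of U n) * V s))"

lemma \<pi>V_convergent:
  assumes "x \<in> Cs s"
  shows "convergent (\<lambda>n. \<pi> (x n) * V s)"
proof (rule Cauchy_convergent, rule CauchyI)
  fix e :: real assume "0 < e"
  then obtain M where M: "\<And>m n. m \<ge> M \<Longrightarrow> n \<ge> M \<Longrightarrow> N s (x m - x n) < e"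
    using assms unfolding Cauchy_seqs_def by blast
  have "norm (\<pi> (x m) * V s - \<pi> (x n) * V s) < e" if "m \<ge> M" "n \<ge> M" for m n
    using le_less_trans[OF norm_\<pi>V M[OF that]] by (simp add: \<pi>V_diff)
  then show "\<exists>M. \<forall>m\<ge>M. \<forall>n\<ge>M. norm (\<pi> (x m) * V s - \<pi> (x n) * V s) < e" by blast
qed

lemma \<psi>_tendsto:
  assumes x: "x \<in> Cs s"
  shows "(\<lambda>n. \<pi> (x n) * V s) \<longlonglongrightarrow> \<psi> (s, cls s x)"
proof -
  let ?y = "seq_of (cls s x)"
  have y: "(\<lambda>n. \<pi> (?y n) * V s) \<longlonglongrightarrow> \<psi> (s, cls s x)"
    using \<pi>V_convergent[OF seq_of_cls(1)[OF x]] by (simp add: \<psi>_def convergent_LIMSEQ_iff)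
  have d: "(\<lambda>n. \<pi> (x n) * V s - \<pi> (?y n) * V s) \<longlonglongrightarrow> 0"
    by (rule Lim_null_comparison[OF always_eventually seq_of_cls(2)[OF x]])
      (simp add: \<pi>V_diff norm_\<pi>V)
  show ?thesis using tendsto_add[OF d y] by simp
qed

lemma \<psi>_eqI: "x \<in> Cs s \<Longrightarrow> (\<lambda>n. \<pi> (x n) * V s) \<longlonglongrightarrow> l \<Longrightarrow> \<psi> (s, cls s x) = l"
  using \<psi>_tendsto LIMSEQ_unique by blast

lemma \<psi>_fibre_of: "x \<in> pre_fibre \<alpha> s \<Longrightarrow> \<psi> (s, fibre_of \<alpha> L s x) = \<pi> x * V s"
  using \<psi>_eqI[OF Cs_const tendsto_const] by (simp add: fibre_of_cls)

lemma coeff_map_\<psi>: "coeff_map \<alpha> L \<psi> = \<pi>"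
  by (rule ext) (simp add: coeff_map_def \<psi>_fibre_of V_zero)

text \<open>Every identity holds on representing sequences and passes to the limit:
  \<open>V_\<pi>\<close> gives the product and the right action, and \<open>V_\<pi>_V\<close> gives
  the inner product.\<close>

lemma toeplitz_rep_\<psi>: "toeplitz_rep \<alpha> L \<psi>"
  unfolding toeplitz_rep_def coeff_map_\<psi>
proof (intro conjI ballI allI)
  show "star_hom \<pi>" by (rule \<pi>_hom)
next
  fix v w assume "v \<in> product_system \<alpha> L" "w \<in> product_system \<alpha> L"
  then obtain s x t y where x: "x \<in> Cs s" "v = (s, cls s x)" and y: "y \<in> Cs t" "w = (t, cls t y)"
    by (auto simp: product_system_def fibre_def)
  have "(\<lambda>n. (\<pi> (x n) * V s) * (\<pi> (y n) * V t)) \<longlonglongrightarrow> \<psi> v * \<psi> w"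
    unfolding x y by (intro tendsto_mult \<psi>_tendsto x y)
  moreover have "(\<pi> (x n) * V s) * (\<pi> (y n) * V t) = \<pi> (x n * \<alpha> s (y n)) * V (s + t)" for n
  proof -
    have "(\<pi> (x n) * V s) * (\<pi> (y n) * V t) = \<pi> (x n) * (V s * \<pi> (y n)) * V t" by (simp only: mult.assoc)
    then show ?thesis by (simp add: V_\<pi> V_add \<pi>_simps mult.assoc)
  qed
  ultimately show "\<psi> v * \<psi> w = \<psi> (ps_mult \<alpha> L v w)"
    unfolding x y ps_mult_cls[OF x(1) y(1)] by (intro \<psi>_eqI[symmetric] Cs_prod x y) simp
next
  fix s U W assume "U \<in> fibre \<alpha> L s" "W \<in> fibre \<alpha> L s"
  then obtain x y where x: "x \<in> Cs s" "U = cls s x" and y: "y \<in> Cs s" "W = cls s y"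
    by (auto simp: fibre_def)
  show "\<psi> (s, fibre_add \<alpha> L s U W) = \<psi> (s, U) + \<psi> (s, W)"
    unfolding x y fibre_add_cls[OF x(1) y(1)]
    using tendsto_add[OF \<psi>_tendsto[OF x(1)] \<psi>_tendsto[OF y(1)]]
    by (intro \<psi>_eqI Cs_add x y) (simp add: \<pi>_simps distrib_right)
  have "(\<lambda>n. star (\<pi> (x n) * V s) * (\<pi> (y n) * V s)) \<longlonglongrightarrow> star (\<psi> (s, U)) * \<psi> (s, W)"
    unfolding x y by (intro tendsto_mult bounded_linear.tendsto[OF bounded_linear_star] \<psi>_tendsto x y)
  moreover have "(\<lambda>n. \<pi> (L s (star (x n) * y n))) \<longlonglongrightarrow> \<pi> (fibre_inner L s U W)"
    unfolding x y
    by (intro bounded_linear.tendsto[OF star_hom_bounded_linear[OF \<pi>_hom]] fibre_inner_cls x y)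
  ultimately show "star (\<psi> (s, U)) * \<psi> (s, W) = \<pi> (fibre_inner L s U W)"
    unfolding \<pi>V_inner by (rule LIMSEQ_unique)
next
  fix s U assume "U \<in> fibre \<alpha> L s"
  then obtain x where x: "x \<in> Cs s" "U = cls s x" by (auto simp: fibre_def)
  show "\<psi> (s, fibre_scale \<alpha> L s c U) = c *\<^sub>C \<psi> (s, U)" for c
    unfolding x fibre_scale_cls[OF x(1)]
    using bounded_linear.tendsto[OF bounded_linear_scaleC_right \<psi>_tendsto[OF x(1)], of c]
    by (intro \<psi>_eqI Cs_scale x) (simp add: \<pi>_simps mult_scaleC_left)
  show "\<psi> (s, right_act \<alpha> L s U a) = \<psi> (s, U) * \<pi> a" for a
    unfolding x right_act_cls[OF x(1)]
    using tendsto_mult[OF \<psi>_tendsto[OF x(1)] tendsto_const, of "\<pi> a"]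
    by (intro \<psi>_eqI Cs_right x) (simp add: \<pi>_simps V_\<pi> mult.assoc)
  show "\<psi> (s, left_act \<alpha> L s a U) = \<pi> a * \<psi> (s, U)" for a
    unfolding x left_act_cls[OF x(1)]
    using tendsto_mult[OF tendsto_const \<psi>_tendsto[OF x(1)], of "\<pi> a"]
    by (intro \<psi>_eqI Cs_left x) (simp add: \<pi>_simps mult.assoc)
qed

end

context toeplitz_system
begin

text \<open>The representation \<open>\<rho>\<close> inherits non-degeneracy from its restriction
  \<open>\<pi>\<close>, so it extends to multipliers. Its extension is identified at
  \<open>iS s\<close> by multiplying with \<open>\<pi> a\<close>: both \<open>V s * \<pi> a\<close>
  and the image of \<open>lmul (iS s) (iA a)\<close> equal
  \<open>\<pi> (\<alpha> s a) * V s\<close>.\<close>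

lemma rep_of_covariant_rep:
  fixes \<pi> :: "'a \<Rightarrow> 'h::chilbert_space bop"
  assumes univ: "\<And>\<psi> :: 's \<times> (nat \<Rightarrow> 'a) set \<Rightarrow> 'h bop. toeplitz_rep \<alpha> L \<psi> \<Longrightarrow>
        \<exists>\<rho>. star_hom \<rho> \<and> (\<forall>v\<in>product_system \<alpha> L. \<rho> (iX v) = \<psi> v)"
    and cov: "toeplitz_covariant \<alpha> L \<pi> V"
  shows "\<exists>\<rho>. star_hom \<rho> \<and> \<rho> \<circ> (\<lambda>a. iA a) = \<pi> \<and> rep_extension \<rho> \<circ> iS = V"
proof -
  interpret covariant_rep \<alpha> L u F \<pi> V by unfold_locales (rule cov)
  obtain \<rho> where \<rho>: "star_hom \<rho>" "\<And>v. v \<in> product_system \<alpha> L \<Longrightarrow> \<rho> (iX v) = \<psi> v"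
    using univ[OF toeplitz_rep_\<psi>] by blast
  have \<rho>E: "\<rho> (E s x) = \<pi> x * V s" if x: "x \<in> pre_fibre \<alpha> s" for s x
  proof -
    have "(s, fibre_of \<alpha> L s x) \<in> product_system \<alpha> L"
      by (simp add: product_system_def fibre_of_cls cls_in_fibre Cs_const x)
    then show ?thesis by (simp add: \<rho>(2) \<psi>_fibre_of x)
  qed
  have \<rho>A: "\<rho> (iA a) = \<pi> a" for a by (simp add: \<rho>E V_zero)
  have "closure (span {bop_apply (\<rho> t) \<xi> |t \<xi>. True}) = UNIV"
  proof -
    have "{bop_apply (\<pi> a) \<xi> |a \<xi>. True} \<subseteq> {bop_apply (\<rho> t) \<xi> |t \<xi>. True}"
      by (auto simp flip: \<rho>A)
    then show ?thesis
      using \<pi>_nondegenerate closure_mono[OF span_mono] unfolding nondegenerate_rep_def by blast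
  qed
  with \<rho>(1) have nd: "nondegenerate_rep \<rho>" by (simp add: nondegenerate_rep_def)
  note \<tau> = rep_extension[OF nd iA_approximate_unit]
  have "rep_extension \<rho> (iS s) = V s" for s
  proof (rule nondegenerate_rep_eqI[OF \<pi>_nondegenerate])
    fix a
    have "rep_extension \<rho> (iS s) * \<rho> (iA a) = \<rho> (lmul (iS s) (iA a))"
      by (rule star_hom_rep_mult[where \<sigma> = \<rho>, OF \<tau>])
    then show "rep_extension \<rho> (iS s) * \<pi> a = V s * \<pi> a"
      by (simp add: \<rho>A lmul_iS \<rho>E \<alpha>_pre_fibre V_\<pi>)
  qed
  with \<rho>(1) \<rho>A show ?thesis by (intro exI[of _ \<rho>]) auto
qed

end

theorem proposition3p1:
  fixes \<alpha> L :: "'s::{comm_monoid_add,countable} \<Rightarrow> 'a::cstar_algebra \<Rightarrow> 'a"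
    and iX :: "'s \<times> (nat \<Rightarrow> 'a) set \<Rightarrow> 't::cstar_algebra"
    and u :: "'i \<Rightarrow> 'a" and F :: "'i filter"
  assumes "extendible_action \<alpha>"
    and "transfer_action \<alpha> L"
    and "toeplitz_algebra TYPE('h::chilbert_space bop) \<alpha> L iX"
    and "approximate_unit u F"
  shows "(\<forall>s. \<exists>m. strict_tendsto (\<lambda>i. mult_of (iX (s, fibre_of \<alpha> L s (\<alpha> s (u i))))) m F) \<and>
    (let iA = (\<lambda>a. iX (0, fibre_of \<alpha> L 0 a));
         iS = (\<lambda>s. strict_Lim F (\<lambda>i. mult_of (iX (s, fibre_of \<alpha> L s (\<alpha> s (u i))))))
     in toeplitz_crossed_product TYPE('h) \<alpha> L iA iS \<and> inj iA)"
proof -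
  interpret toeplitz_system \<alpha> L u F iX
    using assms by unfold_locales (auto simp: toeplitz_algebra_def)
  have univ: "\<exists>\<rho>. star_hom \<rho> \<and> (\<forall>v\<in>product_system \<alpha> L. \<rho> (iX v) = \<psi> v)"
    if "toeplitz_rep \<alpha> L \<psi>" for \<psi> :: "'s \<times> (nat \<Rightarrow> 'a) set \<Rightarrow> 'h bop"
    using assms(3) that by (simp add: toeplitz_algebra_def)
  have "toeplitz_crossed_product TYPE('h) \<alpha> L (\<lambda>a. iA a) iS"
    unfolding toeplitz_crossed_product_def
    by (intro conjI allI impI nondegenerate_iA semigroup_rep_iS covariant_rep_of_rep
        rep_of_covariant_rep univ generated_iA_iS)
  then show ?thesis
    using strict_limit_exists inj_iA by (simp add: Let_def iS_def[abs_def])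
qed

end
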